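(* For any $d\ge0$, the map $\mathrm K\colon\mathrm{St}_d(\mathbb Q)\to\overline K_d(\mathrm T_d)$, i.e. the unique $\mathbb Q$-linear map with $$\mathrm K([v_1,\dots,v_d])=\{1-x^{v_1},\dots,1-x^{v_d}\}$$ for every integral apartment $[v_1,\dots,v_d]\in\mathrm{St}_d(\mathbb Q)$, is injective.
   Context: **Steinberg module.** $\mathrm{St}_d(\mathbb Q)=\widetilde H_{d-2}(\mathcal T_V,\mathbb Q)$ is the top reduced homology of the Tits building of $V=\mathbb Q^d$ ($=\mathbb Q$ for $d\le1$). Equivalently, it is the $\mathbb Q$-vector space generated by apartments $[v_1,\dots,v_d]$, $v_i\in\mathbb Q^d\setminus\{0\}$, which vanish for linearly dependent $v_i$, are skew-symmetric, are unchanged when a $v_i$ is multiplied by an element of $\mathbb Q^\times$, and satisfy $\sum_{i=0}^d(-1)^i[v_0,\dots,\widehat{v_i},\dots,v_d]=0$ for nonzero $v_0,\dots,v_d$. An apartment $[v_1,\dots,v_d]$ is integral if $v_i\in\mathbb Z^d$ and $\det(v_1,\dots,v_d)=\pm1$. For $v=(a_1,\dots,a_d)\in\mathbb Z^d$, $x^v=x_1^{a_1}\cdots x_d^{a_d}$. **Milnor $K$-theory.** $K^M_*(F)$ is the quotient of the tensor algebra (over $\mathbb Z$) of $F^\times$ by the ideal generated by $a\otimes(1-a)$, $a,1-a\in F^\times$; $\{a_1,\dots,a_n\}$ is the class of $a_1\otimes\dots\otimes a_n$. $\mathrm T_d$ is the $d$-dimensional algebraic torus over $\overline{\mathbb Q}$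 with coordinates $x_1,\dots,x_d$. For a torus $\mathrm T$ over $\overline{\mathbb Q}$ with character lattice $\mathrm X(\mathrm T)\subset\overline{\mathbb Q}(\mathrm T)^\times$, $$\overline K_n(\mathrm T)=\mathrm{Coker}\Bigl(K^M_{n-1}(\overline{\mathbb Q}(\mathrm T))\otimes\mathrm X(\mathrm T)\to K^M_n(\overline{\mathbb Q}(\mathrm T))\Bigr)\otimes_{\mathbb Z}\mathbb Q,$$ the map being induced by $\mathrm X(\mathrm T)\hookrightarrow K^M_1(\overline{\mathbb Q}(\mathrm T))$ and multiplication in the Milnor ring. The map $\mathrm K$ exists and is unique. *)

theory Defs
  imports
    "Jordan_Normal_Form.VS_Connect"
    "HOL-Algebra.Free_Abelian_Groups"
    "HOL-Algebra.Algebraic_Closure_Type"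
    "HOL-Algebra.Generated_Groups"
    "HOL-Algebra.QuotRing"
begin

section \<open>Quotients of free modules over the rationals\<close>

text \<open>Vector spaces over the rationals are \<open>HOL-Algebra\<close> modules over \<^term>\<open>class_ring :: rat ring\<close>.
  The \<open>mult\<close> and \<open>one\<close> fields of a module record carry no meaning.\<close>

definition free_module :: "'a set \<Rightarrow> (rat, 'a \<Rightarrow>\<^sub>0 rat) module" where
  "free_module S =
     \<lparr>carrier = {f. Poly_Mapping.keys f \<subseteq> S}, monoid.mult = undefined, monoid.one = undefined,
      ring.zero = 0, ring.add = (+), module.smult = (\<lambda>r f. Poly_Mapping.map ((*) r) f)\<rparr>"

definition quotient_module :: "('r, 'a, 'b) module_scheme \<Rightarrow> 'a set \<Rightarrow> ('r, 'a set) module" where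
  "quotient_module M N =
     \<lparr>carrier = a_rcosets\<^bsub>M\<^esub> N, monoid.mult = undefined, monoid.one = undefined,
      ring.zero = N, ring.add = set_add M,
      module.smult = (\<lambda>r C. \<Union>x\<in>C. N +>\<^bsub>M\<^esub> (r \<odot>\<^bsub>M\<^esub> x))\<rparr>"

abbreviation rat_span :: "'a set \<Rightarrow> ('a \<Rightarrow>\<^sub>0 rat) set \<Rightarrow> ('a \<Rightarrow>\<^sub>0 rat) set" where
  "rat_span S B \<equiv> LinearCombinations.module.span class_ring (free_module S) B"

text \<open>For an abelian group \<open>A\<close> (written as a multiplicative record), \<open>A \<otimes> \<rat>\<close> over the integers is
  built as extension of scalars: the rational vector space on symbols \<open>a \<otimes> 1\<close> modulo additivity
  in \<open>a\<close>.\<close>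

definition tensor_rat_relations :: "('a, 'b) monoid_scheme \<Rightarrow> ('a \<Rightarrow>\<^sub>0 rat) set" where
  "tensor_rat_relations A = rat_span (carrier A)
     {Poly_Mapping.single (a \<otimes>\<^bsub>A\<^esub> b) 1 - Poly_Mapping.single a 1 - Poly_Mapping.single b 1 |a b.
        a \<in> carrier A \<and> b \<in> carrier A}"

definition tensor_rat :: "('a, 'b) monoid_scheme \<Rightarrow> (rat, ('a \<Rightarrow>\<^sub>0 rat) set) module" where
  "tensor_rat A = quotient_module (free_module (carrier A)) (tensor_rat_relations A)"

definition tensor_one :: "('a, 'b) monoid_scheme \<Rightarrow> 'a \<Rightarrow> ('a \<Rightarrow>\<^sub>0 rat) set" where
  "tensor_one A a = tensor_rat_relations A +>\<^bsub>free_module (carrier A)\<^esub> Poly_Mapping.single a 1"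


section \<open>The Steinberg module\<close>

text \<open>The presentation by apartments. For \<open>d = 0\<close> the only tuple is the empty one and there are no
  relations, so that the module is one-dimensional.\<close>

definition nonzero_tuples :: "nat \<Rightarrow> nat \<Rightarrow> rat vec list set" where
  "nonzero_tuples d n = {vs. length vs = n \<and> set vs \<subseteq> carrier_vec d - {0\<^sub>v d}}"

definition dependent_tuple :: "nat \<Rightarrow> rat vec list \<Rightarrow> bool" where
  "dependent_tuple d vs \<longleftrightarrow>
     (\<exists>c \<in> carrier_vec (length vs). c \<noteq> 0\<^sub>v (length vs) \<and> mat_of_cols d vs *\<^sub>v c = 0\<^sub>v d)"

definition steinberg_relations :: "nat \<Rightarrow> (rat vec list \<Rightarrow>\<^sub>0 rat) set" where
  "steinberg_relations d = rat_span (nonzero_tuples d d)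
     ({Poly_Mapping.single vs 1 |vs. vs \<in> nonzero_tuples d d \<and> dependent_tuple d vs}
      \<union> {Poly_Mapping.single (vs[i := vs ! j, j := vs ! i]) 1 + Poly_Mapping.single vs 1 |vs i j.
           vs \<in> nonzero_tuples d d \<and> i < j \<and> j < d}
      \<union> {Poly_Mapping.single (vs[i := c \<cdot>\<^sub>v (vs ! i)]) 1 - Poly_Mapping.single vs 1 |vs i c.
           vs \<in> nonzero_tuples d d \<and> i < d \<and> c \<noteq> 0}
      \<union> {(\<Sum>i\<le>d. Poly_Mapping.single (take i ws @ drop (Suc i) ws) ((-1) ^ i)) |ws.
           ws \<in> nonzero_tuples d (Suc d)})"

definition steinberg_module :: "nat \<Rightarrow> (rat, (rat vec list \<Rightarrow>\<^sub>0 rat) set) module" where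
  "steinberg_module d = quotient_module (free_module (nonzero_tuples d d)) (steinberg_relations d)"

definition apartment :: "nat \<Rightarrow> rat vec list \<Rightarrow> (rat vec list \<Rightarrow>\<^sub>0 rat) set" where
  "apartment d vs =
     steinberg_relations d +>\<^bsub>free_module (nonzero_tuples d d)\<^esub> Poly_Mapping.single vs 1"

definition integral_frame :: "nat \<Rightarrow> int vec list \<Rightarrow> bool" where
  "integral_frame d vs \<longleftrightarrow>
     length vs = d \<and> set vs \<subseteq> carrier_vec d \<and> det (mat_of_cols d vs) \<in> {1, - 1}"

definition integral_apartment :: "nat \<Rightarrow> int vec list \<Rightarrow> (rat vec list \<Rightarrow>\<^sub>0 rat) set" where
  "integral_apartment d vs = apartment d (map (map_vec rat_of_int) vs)"


section \<open>Milnor K-theory\<close>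

text \<open>The free associative ring on \<open>S\<close>: integral combinations of words, multiplied by
  concatenation.\<close>

definition free_ring :: "'a set \<Rightarrow> ('a list \<Rightarrow>\<^sub>0 int) ring" where
  "free_ring S =
     \<lparr>carrier = {p. Poly_Mapping.keys p \<subseteq> lists S},
      monoid.mult = (\<lambda>p q. frag_extend (\<lambda>u. frag_extend (\<lambda>v. frag_of (u @ v)) q) p),
      monoid.one = frag_of [], ring.zero = 0, ring.add = (+)\<rparr>"

text \<open>The tensor algebra over the integers of an abelian group \<open>G\<close>: the ring freely generated by
  \<open>G\<close> subject to the group law of \<open>G\<close> becoming addition.\<close>

definition tensor_algebra_ideal :: "('a, 'b) monoid_scheme \<Rightarrow> ('a list \<Rightarrow>\<^sub>0 int) set" where
  "tensor_algebra_ideal G = genideal (free_ring (carrier G))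
     {frag_of [a \<otimes>\<^bsub>G\<^esub> b] - frag_of [a] - frag_of [b] |a b. a \<in> carrier G \<and> b \<in> carrier G}"

definition tensor_algebra :: "('a, 'b) monoid_scheme \<Rightarrow> ('a list \<Rightarrow>\<^sub>0 int) set ring" where
  "tensor_algebra G = free_ring (carrier G) Quot tensor_algebra_ideal G"

definition tensor_gen :: "('a, 'b) monoid_scheme \<Rightarrow> 'a \<Rightarrow> ('a list \<Rightarrow>\<^sub>0 int) set" where
  "tensor_gen G a = tensor_algebra_ideal G +>\<^bsub>free_ring (carrier G)\<^esub> frag_of [a]"

definition pure_tensor :: "('a, 'b) monoid_scheme \<Rightarrow> 'a list \<Rightarrow> ('a list \<Rightarrow>\<^sub>0 int) set" where
  "pure_tensor G as = foldr (\<lambda>a t. tensor_gen G a \<otimes>\<^bsub>tensor_algebra G\<^esub> t) as \<one>\<^bsub>tensor_algebra G\<^esub>"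

definition milnor_ideal :: "('a, 'b) ring_scheme \<Rightarrow> ('a list \<Rightarrow>\<^sub>0 int) set set" where
  "milnor_ideal F = genideal (tensor_algebra (units_of F))
     {pure_tensor (units_of F) [a, \<one>\<^bsub>F\<^esub> \<ominus>\<^bsub>F\<^esub> a] |a. a \<in> Units F \<and> \<one>\<^bsub>F\<^esub> \<ominus>\<^bsub>F\<^esub> a \<in> Units F}"

definition milnor_ring :: "('a, 'b) ring_scheme \<Rightarrow> ('a list \<Rightarrow>\<^sub>0 int) set set ring" where
  "milnor_ring F = tensor_algebra (units_of F) Quot milnor_ideal F"

definition milnor_symbol :: "('a, 'b) ring_scheme \<Rightarrow> 'a list \<Rightarrow> ('a list \<Rightarrow>\<^sub>0 int) set set" where
  "milnor_symbol F as = milnor_ideal F +>\<^bsub>tensor_algebra (units_of F)\<^esub> pure_tensor (units_of F) as"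

text \<open>The degree \<open>n\<close> part of the Milnor ring, as an abelian group: the image of the \<open>n\<close>-fold
  tensor power.\<close>

definition milnor_K :: "('a, 'b) ring_scheme \<Rightarrow> nat \<Rightarrow> ('a list \<Rightarrow>\<^sub>0 int) set set monoid" where
  "milnor_K F n = subgroup_generated (add_monoid (milnor_ring F))
     {milnor_symbol F as |as. length as = n \<and> set as \<subseteq> Units F}"

text \<open>The image of \<open>K\<^sub>n\<^sub>-\<^sub>1(F) \<otimes> L\<close> in \<open>K\<^sub>n(F)\<close> under multiplication, for a subgroup \<open>L\<close> of the units;
  it is generated by the images of pure tensors, and is trivial for \<open>n = 0\<close> since \<open>K\<^sub>-\<^sub>1 = 0\<close>.\<close>

definition milnor_mult_image ::
    "('a, 'b) ring_scheme \<Rightarrow> 'a set \<Rightarrow> nat \<Rightarrow> ('a list \<Rightarrow>\<^sub>0 int) set set set" where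
  "milnor_mult_image F L n = generate (milnor_K F n)
     {y \<otimes>\<^bsub>milnor_ring F\<^esub> milnor_symbol F [\<chi>] |y \<chi> m.
        n = Suc m \<and> y \<in> carrier (milnor_K F m) \<and> \<chi> \<in> L}"

definition milnor_coker ::
    "('a, 'b) ring_scheme \<Rightarrow> 'a set \<Rightarrow> nat \<Rightarrow> ('a list \<Rightarrow>\<^sub>0 int) set set set monoid" where
  "milnor_coker F L n = milnor_K F n Mod milnor_mult_image F L n"

definition reduced_milnor_K ::
    "('a, 'b) ring_scheme \<Rightarrow> 'a set \<Rightarrow> nat \<Rightarrow>
     (rat, (('a list \<Rightarrow>\<^sub>0 int) set set set \<Rightarrow>\<^sub>0 rat) set) module" where
  "reduced_milnor_K F L n = tensor_rat (milnor_coker F L n)"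

definition reduced_milnor_symbol ::
    "('a, 'b) ring_scheme \<Rightarrow> 'a set \<Rightarrow> 'a list \<Rightarrow> (('a list \<Rightarrow>\<^sub>0 int) set set set \<Rightarrow>\<^sub>0 rat) set" where
  "reduced_milnor_symbol F L as =
     tensor_one (milnor_coker F L (length as))
       (milnor_mult_image F L (length as) #>\<^bsub>milnor_K F (length as)\<^esub> milnor_symbol F as)"


section \<open>The torus\<close>

text \<open>The function field of the \<open>d\<close>-dimensional torus is realised inside the fraction field of the
  Laurent polynomial ring in countably many variables over the algebraic closure of the rationals,
  so that \<open>d\<close> can be a natural number, including \<open>0\<close>. The coordinates are numbered from \<open>0\<close> to
  \<open>d - 1\<close>. A monomial is its exponent function \<open>nat \<Rightarrow>\<^sub>0 int\<close>.\<close>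

type_synonym laurent_poly = "(nat \<Rightarrow>\<^sub>0 int) \<Rightarrow>\<^sub>0 rat alg_closure"

definition torus_ring :: "nat \<Rightarrow> laurent_poly set" where
  "torus_ring d = {p. \<forall>m \<in> Poly_Mapping.keys p. Poly_Mapping.keys m \<subseteq> {..<d}}"

definition torus_field :: "nat \<Rightarrow> laurent_poly fract ring" where
  "torus_field d = class_ring
     \<lparr>carrier := {Fract p q |p q. p \<in> torus_ring d \<and> q \<in> torus_ring d \<and> q \<noteq> 0}\<rparr>"

definition torus_coord :: "nat \<Rightarrow> laurent_poly fract" where
  "torus_coord i = Fract (Poly_Mapping.single (Poly_Mapping.single i 1) 1) 1"

definition torus_char :: "int vec \<Rightarrow> laurent_poly fract" where
  "torus_char v = (\<Prod>i<dim_vec v. torus_coord i powi (v $ i))"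

definition character_lattice :: "nat \<Rightarrow> laurent_poly fract set" where
  "character_lattice d = torus_char ` carrier_vec d"

abbreviation torus_K :: "nat \<Rightarrow> nat \<Rightarrow>
    (rat, ((laurent_poly fract list \<Rightarrow>\<^sub>0 int) set set set \<Rightarrow>\<^sub>0 rat) set) module" where
  "torus_K n d \<equiv> reduced_milnor_K (torus_field d) (character_lattice d) n"

abbreviation torus_symbol :: "nat \<Rightarrow> laurent_poly fract list \<Rightarrow>
    ((laurent_poly fract list \<Rightarrow>\<^sub>0 int) set set set \<Rightarrow>\<^sub>0 rat) set" where
  "torus_symbol d as \<equiv> reduced_milnor_symbol (torus_field d) (character_lattice d) as"

end

theory Submission
  imports Defs
begin

text \<open>A full flag in general position with respect to the standard one assigns to an apartment the
  coefficient of that flag in the corresponding cycle of the Tits building. These functionals are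
  dual to the apartments of unitriangular frames, which span the Steinberg module, so they separate
  its elements.

  Each of them factors through \<open>K\<close>. Expand functions on the torus at the identity, in logarithmic
  coordinates adapted to the flag, and take leading exponents with respect to the total degree
  refined lexicographically. This is a valuation \<open>\<nu>\<close> of rank \<open>d\<close> on the function field, and
  \<open>{a\<^sub>1, ..., a\<^sub>d} \<mapsto> det (\<nu> a\<^sub>1, ..., \<nu> a\<^sub>d)\<close> is well defined on Milnor K-theory, because among \<open>\<nu> a\<close>,
  \<open>\<nu> (1 - a)\<close> and \<open>0\<close> two coincide. It vanishes on products with characters, which have value 1 at the
  identity, and \<open>\<nu> (1 - x^v)\<close> is the unit vector at the pivot of \<open>v\<close>, so that on integral apartments
  it agrees with the functional of the flag. Integral apartments span the Steinberg module, which
  gives agreement everywhere.\<close>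

section \<open>Rational linear algebra\<close>

text \<open>Up to sign, the functional is the one that \<open>d\<close> successive residue maps
  along the flag would produce on symbols; the determinant of a rank \<open>d\<close> valuation
  gives it at once, with no residue fields and no induction on \<open>d\<close>. Injectivity asks
  only for enough functionals on the target with known values on symbols, so nothing about the
  structure of Milnor K-theory enters. The base point is the identity because \<open>1 - x^v\<close>
  vanishes there to first order with linear part \<open>-v\<close>, so that linear algebra over the
  rationals governs its value. The obstacle is that two families of apartments must be used.
  \<open>K\<close> is known on integral apartments, but these satisfy relations among themselves;
  the dual family consists of unitriangular frames, whose entries may be fractions, and on these
  \<open>K\<close> has no formula at hand. The comparison is therefore made between two functionals
  on the entire Steinberg module. One exchange relation proves spanning for both families: the
  determinant decreases in one case, the number of nonzero entries in a row in the other.\<close>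

definition lin_ext :: "('c::zero \<Rightarrow> 'd::semiring_0) \<Rightarrow> ('a \<Rightarrow> 'd) \<Rightarrow> ('a \<Rightarrow>\<^sub>0 'c) \<Rightarrow> 'd" where
  "lin_ext h g p = (\<Sum>a\<in>Poly_Mapping.keys p. h (Poly_Mapping.lookup p a) * g a)"

lemma lin_ext_superset:
  assumes "h 0 = 0" "finite S" "Poly_Mapping.keys p \<subseteq> S"
  shows "lin_ext h g p = (\<Sum>a\<in>S. h (Poly_Mapping.lookup p a) * g a)"
  unfolding lin_ext_def
  by (rule sum.mono_neutral_left) (use assms in \<open>auto simp: in_keys_iff\<close>)

lemma lin_ext_zero [simp]: "lin_ext h g 0 = 0"
  by (simp add: lin_ext_def)

lemma lin_ext_single: "h 0 = 0 \<Longrightarrow> lin_ext h g (Poly_Mapping.single a c) = h c * g a"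
  by (simp add: lin_ext_superset[of h "{a}"])

text \<open>Both sides become sums over the union of the two supports. The coefficient map
  \<open>h\<close> is the identity for flag functionals, \<open>of_int\<close> for words and
  logarithms, and the embedding of constants for moments.\<close>

lemma lin_ext_add:
  fixes h :: "'c::monoid_add \<Rightarrow> 'd::semiring_0"
  assumes "h 0 = 0" "\<And>x y. h (x + y) = h x + h y"
  shows "lin_ext h g (p + q) = lin_ext h g p + lin_ext h g q"
proof -
  let ?S = "Poly_Mapping.keys p \<union> Poly_Mapping.keys q"
  have "Poly_Mapping.keys (p + q) \<subseteq> ?S" by (rule keys_add)
  then show ?thesis
    by (simp add: lin_ext_superset[of h ?S] assms lookup_add distrib_right sum.distrib)
qed

lemma lin_ext_diff:
  fixes h :: "'c::ab_group_add \<Rightarrow> 'd::ring"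
  assumes "h 0 = 0" "\<And>x y. h (x + y) = h x + h y"
  shows "lin_ext h g (p - q) = lin_ext h g p - lin_ext h g q"
  using lin_ext_add[where h = h and g = g and p = "p - q" and q = q] assms by (simp add: algebra_simps)

lemma lin_ext_sum:
  fixes h :: "'c::comm_monoid_add \<Rightarrow> 'd::semiring_0"
  assumes "h 0 = 0" "\<And>x y. h (x + y) = h x + h y"
  shows "lin_ext h g (\<Sum>i\<in>I. p i) = (\<Sum>i\<in>I. lin_ext h g (p i))"
  by (induction I rule: infinite_finite_induct) (simp_all add: lin_ext_add assms)

lemma poly_mapping_sum_single:
  "p = (\<Sum>a\<in>Poly_Mapping.keys p. Poly_Mapping.single a (Poly_Mapping.lookup p a))"
  by (rule poly_mapping_eqI)
     (auto simp: lookup_sum lookup_single when_def in_keys_iff sum.delta)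

lemma lookup_scale [simp]:
  "Poly_Mapping.lookup (Poly_Mapping.map ((*) r) f) k = r * Poly_Mapping.lookup f k" for r :: rat
  by (simp add: map.rep_eq when_def)

lemma scale_single [simp]:
  "Poly_Mapping.map ((*) r) (Poly_Mapping.single a c) = Poly_Mapping.single a (r * c)" for r :: rat
  by (rule poly_mapping_eqI) (simp add: lookup_single when_def)

lemma scale_one [simp]: "Poly_Mapping.map ((*) (1 :: rat)) f = f"
  by (rule poly_mapping_eqI) simp

lemma keys_scale: "Poly_Mapping.keys (Poly_Mapping.map ((*) (r :: rat)) f) \<subseteq> Poly_Mapping.keys f"
  by (auto simp: in_keys_iff)

lemma lin_ext_scale:
  "lin_ext (\<lambda>r. r) g (Poly_Mapping.map ((*) r) x) = r * lin_ext (\<lambda>r. r) g x" for r :: rat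
  using keys_scale[of r x]
  by (simp add: lin_ext_superset[of _ "Poly_Mapping.keys x"] sum_distrib_left mult.assoc)

lemma scale_add: "Poly_Mapping.map ((*) (r :: rat)) (f + g) =
    Poly_Mapping.map ((*) r) f + Poly_Mapping.map ((*) r) g"
  by (rule poly_mapping_eqI) (simp add: lookup_add algebra_simps)

lemma scale_add_left: "Poly_Mapping.map ((*) (r + s :: rat)) f =
    Poly_Mapping.map ((*) r) f + Poly_Mapping.map ((*) s) f"
  by (rule poly_mapping_eqI) (simp add: lookup_add algebra_simps)

lemma scale_scale: "Poly_Mapping.map ((*) (r * s :: rat)) f =
    Poly_Mapping.map ((*) r) (Poly_Mapping.map ((*) s) f)"
  by (rule poly_mapping_eqI) simp

lemma scale_diff: "Poly_Mapping.map ((*) (r :: rat)) (f - g) =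
    Poly_Mapping.map ((*) r) f - Poly_Mapping.map ((*) r) g"
  by (rule poly_mapping_eqI) (simp add: lookup_minus algebra_simps)

lemma scale_minus_one: "Poly_Mapping.map ((*) (- 1 :: rat)) f = - f"
  by (rule poly_mapping_eqI) simp

section \<open>Free modules, their submodules and quotients\<close>

lemma free_module_simps [simp]:
  "carrier (free_module S) = {f. Poly_Mapping.keys f \<subseteq> S}"
  "x \<oplus>\<^bsub>free_module S\<^esub> y = x + y"
  "r \<odot>\<^bsub>free_module S\<^esub> x = Poly_Mapping.map ((*) r) x"
  "\<zero>\<^bsub>free_module S\<^esub> = 0"
  by (simp_all add: free_module_def)

lemma module_free_module: "Module.module (class_ring :: rat ring) (free_module S)"
proof (rule moduleI)
  show "cring (class_ring :: rat ring)"
    by (rule class_cring.cring_axioms)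
  show "abelian_group (free_module S)"
  proof (rule abelian_groupI)
    fix x y assume "x \<in> carrier (free_module S)" "y \<in> carrier (free_module S)"
    then show "x \<oplus>\<^bsub>free_module S\<^esub> y \<in> carrier (free_module S)"
      using keys_add[of x y] by auto
  next
    fix x assume "x \<in> carrier (free_module S)"
    then show "\<exists>y\<in>carrier (free_module S). y \<oplus>\<^bsub>free_module S\<^esub> x = \<zero>\<^bsub>free_module S\<^esub>"
      by (intro bexI[of _ "- x"]) (auto simp: in_keys_iff)
  qed (simp_all add: ac_simps)
next
  fix a x assume "x \<in> carrier (free_module S)"
  then show "a \<odot>\<^bsub>free_module S\<^esub> x \<in> carrier (free_module S)"
    using keys_scale[of a x] by auto
qed (simp add: scale_add_left, simp add: scale_add, simp add: scale_scale, simp)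

text \<open>Unlike a submodule it names no carrier, so the kernel of a functional, or any set given
  by a linear condition, can serve directly as the bound in a span argument.\<close>

definition rat_closed :: "('a \<Rightarrow>\<^sub>0 rat) set \<Rightarrow> bool" where
  "rat_closed V \<longleftrightarrow> 0 \<in> V \<and> (\<forall>x\<in>V. \<forall>y\<in>V. x + y \<in> V) \<and>
     (\<forall>r. \<forall>x\<in>V. Poly_Mapping.map ((*) r) x \<in> V)"

lemma rat_closedD:
  assumes "rat_closed V"
  shows "0 \<in> V" "x \<in> V \<Longrightarrow> y \<in> V \<Longrightarrow> x + y \<in> V" "x \<in> V \<Longrightarrow> Poly_Mapping.map ((*) r) x \<in> V"
    "x \<in> V \<Longrightarrow> y \<in> V \<Longrightarrow> x - y \<in> V" "x \<in> V \<Longrightarrow> - x \<in> V"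
proof -
  show *: "0 \<in> V" "x \<in> V \<Longrightarrow> y \<in> V \<Longrightarrow> x + y \<in> V"
    "x \<in> V \<Longrightarrow> Poly_Mapping.map ((*) r) x \<in> V" for x y r
    using assms by (auto simp: rat_closed_def)
  show m: "x \<in> V \<Longrightarrow> - x \<in> V" for x
    using *(3)[of x "- 1"] by (simp add: scale_minus_one)
  show "x \<in> V \<Longrightarrow> y \<in> V \<Longrightarrow> x - y \<in> V"
    using *(2)[of x "- y"] m[of y] by simp
qed

lemma rat_closed_sum:
  assumes "rat_closed V" "\<And>i. i \<in> I \<Longrightarrow> f i \<in> V"
  shows "(\<Sum>i\<in>I. f i) \<in> V"
  using assms(2) by (induction I rule: infinite_finite_induct) (auto intro: rat_closedD[OF assms(1)])

lemma rat_closed_singles: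
  assumes V: "rat_closed V" and "\<And>a. a \<in> S \<Longrightarrow> Poly_Mapping.single a 1 \<in> V" and "Poly_Mapping.keys p \<subseteq> S"
  shows "p \<in> V"
proof -
  note poly_mapping_sum_single[of p]
  moreover have "Poly_Mapping.single a (Poly_Mapping.lookup p a) \<in> V" if "a \<in> Poly_Mapping.keys p" for a
    using rat_closedD(3)[OF V assms(2)[of a], of "Poly_Mapping.lookup p a"] that assms(3) by auto
  ultimately show ?thesis using rat_closed_sum[OF V] by metis
qed

lemma rat_closed_carrier: "rat_closed (carrier (free_module S))"
proof -
  have "Poly_Mapping.keys (x + y) \<subseteq> S"
    if "Poly_Mapping.keys x \<subseteq> S" "Poly_Mapping.keys y \<subseteq> S" for x y :: "'a \<Rightarrow>\<^sub>0 rat"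
    using that keys_add[of x y] by blast
  moreover have "Poly_Mapping.keys (Poly_Mapping.map ((*) r) x) \<subseteq> S"
    if "Poly_Mapping.keys x \<subseteq> S" for x and r :: rat
    using that keys_scale[of r x] by blast
  ultimately show ?thesis by (simp add: rat_closed_def)
qed

lemma submodule_iff_rat_closed:
  "submodule (class_ring :: rat ring) N (free_module S) \<longleftrightarrow> rat_closed N \<and> N \<subseteq> carrier (free_module S)"
proof -
  interpret M: Module.module "class_ring :: rat ring" "free_module S" by (rule module_free_module)
  show ?thesis
  proof
    assume "submodule class_ring N (free_module S)"
    then interpret submodule class_ring N "free_module S" .
    have "0 \<in> N" using zero_closed by simp
    moreover have "x + y \<in> N" if "x \<in> N" "y \<in> N" for x y using m_closed[OF that] by simp
    moreover have "Poly_Mapping.map ((*) r) x \<in> N" if "x \<in> N" for x r using smult_closed[of r x] that by simp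
    ultimately show "rat_closed N \<and> N \<subseteq> carrier (free_module S)"
      using subset by (simp add: rat_closed_def)
  next
    assume *: "rat_closed N \<and> N \<subseteq> carrier (free_module S)"
    then have N: "rat_closed N" by simp
    show "submodule class_ring N (free_module S)"
      by unfold_locales (use * rat_closedD[OF N] in auto)
  qed
qed

lemma
  assumes "B \<subseteq> carrier (free_module S)"
  shows rat_closed_rat_span: "rat_closed (rat_span S B)"
    and rat_span_subset_carrier: "rat_span S B \<subseteq> carrier (free_module S)"
    and rat_span_superset: "B \<subseteq> rat_span S B"
    and rat_span_minimal: "rat_closed V \<Longrightarrow> B \<subseteq> V \<Longrightarrow> rat_span S B \<subseteq> V"
proof -
  interpret M: Module.module "class_ring :: rat ring" "free_module S" by (rule module_free_module)
  show sub: "rat_closed (rat_span S B)" "rat_span S B \<subseteq> carrier (free_module S)"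
    using M.span_is_submodule[OF assms] submodule_iff_rat_closed by auto
  show "B \<subseteq> rat_span S B" using M.in_own_span[OF assms] .
  assume V: "rat_closed V" "B \<subseteq> V"
  \<comment> \<open>\<open>V\<close> may reach outside the carrier; only its intersection with the
    carrier is a submodule.\<close>
  let ?V = "V \<inter> carrier (free_module S)"
  have "rat_closed (carrier (free_module S))"
    by (rule rat_closed_carrier)
  then have "rat_closed ?V" using V(1) by (auto simp: rat_closed_def)
  then have "submodule class_ring ?V (free_module S)" by (auto simp: submodule_iff_rat_closed)
  then have "rat_span S B \<subseteq> ?V" using V(2) assms by (intro M.span_is_subset) auto
  then show "rat_span S B \<subseteq> V" by blast
qed

lemma a_r_coset_free_module: "N +>\<^bsub>free_module S\<^esub> x = (\<lambda>n. n + x) ` N"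
  by (auto simp: a_r_coset_def' free_module_def)

lemma a_r_coset_free_module_eq_iff:
  assumes "rat_closed N"
  shows "N +>\<^bsub>free_module S\<^esub> x = N +>\<^bsub>free_module S\<^esub> y \<longleftrightarrow> x - y \<in> N"
proof
  assume "N +>\<^bsub>free_module S\<^esub> x = N +>\<^bsub>free_module S\<^esub> y"
  moreover have "x \<in> N +>\<^bsub>free_module S\<^esub> x"
    using rat_closedD(1)[OF assms] by (force simp: a_r_coset_free_module)
  ultimately show "x - y \<in> N" by (auto simp: a_r_coset_free_module)
next
  assume *: "x - y \<in> N"
  have "n + x \<in> (\<lambda>n. n + y) ` N" "n + y \<in> (\<lambda>n. n + x) ` N" if "n \<in> N" for n
  proof -
    have "n + x = (n + (x - y)) + y" "n + y = (n - (x - y)) + x" by simp_all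
    then show "n + x \<in> (\<lambda>n. n + y) ` N" "n + y \<in> (\<lambda>n. n + x) ` N"
      using rat_closedD(2,4)[OF assms that *] by blast+
  qed
  then show "N +>\<^bsub>free_module S\<^esub> x = N +>\<^bsub>free_module S\<^esub> y"
    unfolding a_r_coset_free_module by blast
qed

lemma quotient_module_carrier:
  "carrier (quotient_module (free_module S) N) = (\<lambda>x. N +>\<^bsub>free_module S\<^esub> x) ` {f. Poly_Mapping.keys f \<subseteq> S}"
  by (auto simp: quotient_module_def A_RCOSETS_def')

lemma quotient_module_add:
  assumes "rat_closed N"
  shows "(N +>\<^bsub>free_module S\<^esub> x) \<oplus>\<^bsub>quotient_module (free_module S) N\<^esub> (N +>\<^bsub>free_module S\<^esub> y) = N +>\<^bsub>free_module S\<^esub> (x + y)"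
proof -
  have "(N +>\<^bsub>free_module S\<^esub> x) \<oplus>\<^bsub>quotient_module (free_module S) N\<^esub> (N +>\<^bsub>free_module S\<^esub> y) =
      {n + x + (m + y) |n m. n \<in> N \<and> m \<in> N}"
    by (auto simp: quotient_module_def set_add_def' a_r_coset_free_module)
  also have "\<dots> = (\<lambda>n. n + (x + y)) ` N"
  proof (intro Set.set_eqI iffI)
    fix z assume "z \<in> {n + x + (m + y) |n m. n \<in> N \<and> m \<in> N}"
    then obtain n m where "z = (n + m) + (x + y)" "n \<in> N" "m \<in> N" by (auto simp: algebra_simps)
    then show "z \<in> (\<lambda>n. n + (x + y)) ` N" using rat_closedD(2)[OF assms] by blast
  next
    fix z assume "z \<in> (\<lambda>n. n + (x + y)) ` N"
    then obtain n where "z = n + x + (0 + y)" "n \<in> N" by (auto simp: algebra_simps)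
    then show "z \<in> {n + x + (m + y) |n m. n \<in> N \<and> m \<in> N}" using rat_closedD(1)[OF assms] by blast
  qed
  finally show ?thesis by (simp add: a_r_coset_free_module)
qed

lemma quotient_module_smult:
  assumes "rat_closed N"
  shows "r \<odot>\<^bsub>quotient_module (free_module S) N\<^esub> (N +>\<^bsub>free_module S\<^esub> x) = N +>\<^bsub>free_module S\<^esub> Poly_Mapping.map ((*) r) x"
proof -
  have "N +>\<^bsub>free_module S\<^esub> Poly_Mapping.map ((*) r) y = N +>\<^bsub>free_module S\<^esub> Poly_Mapping.map ((*) r) x"
    if "y \<in> N +>\<^bsub>free_module S\<^esub> x" for y
    using that rat_closedD(3)[OF assms]
    by (subst a_r_coset_free_module_eq_iff[OF assms])
       (auto simp: a_r_coset_free_module scale_diff[symmetric])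
  moreover have "x \<in> N +>\<^bsub>free_module S\<^esub> x"
    using rat_closedD(1)[OF assms] by (force simp: a_r_coset_free_module)
  ultimately have "(\<Union>y\<in>N +>\<^bsub>free_module S\<^esub> x. N +>\<^bsub>free_module S\<^esub> Poly_Mapping.map ((*) r) y) =
      N +>\<^bsub>free_module S\<^esub> Poly_Mapping.map ((*) r) x"
    by (intro SUP_eq_const) blast+
  then show ?thesis by (simp add: quotient_module_def)
qed

text \<open>Any element of a coset may stand for it, since \<open>L\<close> is additive and kills
  \<open>N\<close>; \<open>SOME\<close> picks one.\<close>

lemma quotient_functional:
  fixes L :: "('a \<Rightarrow>\<^sub>0 rat) \<Rightarrow> rat"
  assumes "rat_closed N" "\<And>x. x \<in> N \<Longrightarrow> L x = 0" and "\<And>x y. L (x + y) = L x + L y"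
  obtains M where "\<And>x. M (N +>\<^bsub>free_module S\<^esub> x) = L x"
proof
  fix x
  have "x \<in> N +>\<^bsub>free_module S\<^esub> x"
    using rat_closedD(1)[OF assms(1)] by (force simp: a_r_coset_free_module)
  then have "(SOME y. y \<in> N +>\<^bsub>free_module S\<^esub> x) \<in> N +>\<^bsub>free_module S\<^esub> x" by (rule someI)
  then show "(\<lambda>C. L (SOME y. y \<in> C)) (N +>\<^bsub>free_module S\<^esub> x) = L x"
    using assms(2,3) by (auto simp: a_r_coset_free_module)
qed

section \<open>Exchange and integral apartments\<close>

lemma nonzero_tuples_nth:
  "vs \<in> nonzero_tuples d n \<Longrightarrow> i < n \<Longrightarrow> vs ! i \<in> carrier_vec d \<and> vs ! i \<noteq> 0\<^sub>v d"
  by (auto simp: nonzero_tuples_def dest: nth_mem)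

lemma nonzero_tuples_update:
  "vs \<in> nonzero_tuples d n \<Longrightarrow> w \<in> carrier_vec d \<Longrightarrow> w \<noteq> 0\<^sub>v d \<Longrightarrow> vs[i := w] \<in> nonzero_tuples d n"
  using set_update_subset_insert[of vs i w] by (auto simp: nonzero_tuples_def)

lemma nonzero_tuples_swap:
  "vs \<in> nonzero_tuples d n \<Longrightarrow> i < n \<Longrightarrow> j < n \<Longrightarrow> vs[i := vs ! j, j := vs ! i] \<in> nonzero_tuples d n"
  using nonzero_tuples_nth[of vs d n] by (intro nonzero_tuples_update) auto

lemma smult_vec_nonzero:
  "v \<noteq> 0\<^sub>v d \<Longrightarrow> v \<in> carrier_vec d \<Longrightarrow> c \<noteq> 0 \<Longrightarrow> c \<cdot>\<^sub>v v \<noteq> 0\<^sub>v d" for c :: "'a::field"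
  by (auto simp: vec_eq_iff)

lemma nonzero_tuples_scale:
  "vs \<in> nonzero_tuples d n \<Longrightarrow> i < n \<Longrightarrow> c \<noteq> 0 \<Longrightarrow> vs[i := c \<cdot>\<^sub>v vs ! i] \<in> nonzero_tuples d n"
  using nonzero_tuples_nth[of vs d n i] smult_vec_nonzero[of "vs ! i" d c]
  by (intro nonzero_tuples_update) auto

lemma nonzero_tuples_delete:
  "ws \<in> nonzero_tuples d (Suc n) \<Longrightarrow> i \<le> n \<Longrightarrow> take i ws @ drop (Suc i) ws \<in> nonzero_tuples d n"
  by (auto simp: nonzero_tuples_def dest: in_set_takeD in_set_dropD)

section \<open>The relations between apartments and the exchange formula\<close>

definition steinberg_generators :: "nat \<Rightarrow> (rat vec list \<Rightarrow>\<^sub>0 rat) set" where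
  "steinberg_generators d =
     ({Poly_Mapping.single vs 1 |vs. vs \<in> nonzero_tuples d d \<and> dependent_tuple d vs}
      \<union> {Poly_Mapping.single (vs[i := vs ! j, j := vs ! i]) 1 + Poly_Mapping.single vs 1 |vs i j.
           vs \<in> nonzero_tuples d d \<and> i < j \<and> j < d}
      \<union> {Poly_Mapping.single (vs[i := c \<cdot>\<^sub>v (vs ! i)]) 1 - Poly_Mapping.single vs 1 |vs i c.
           vs \<in> nonzero_tuples d d \<and> i < d \<and> c \<noteq> 0}
      \<union> {(\<Sum>i\<le>d. Poly_Mapping.single (take i ws @ drop (Suc i) ws) ((-1) ^ i)) |ws.
           ws \<in> nonzero_tuples d (Suc d)})"

lemma steinberg_relations_span:
  "steinberg_relations d = rat_span (nonzero_tuples d d) (steinberg_generators d)"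
  by (simp only: steinberg_relations_def steinberg_generators_def)

lemma steinberg_generators_carrier: "steinberg_generators d \<subseteq> carrier (free_module (nonzero_tuples d d))"
proof -
  let ?C = "carrier (free_module (nonzero_tuples d d)) :: (rat vec list \<Rightarrow>\<^sub>0 rat) set"
  note C = rat_closedD[OF rat_closed_carrier]
  have single: "Poly_Mapping.single vs c \<in> ?C" if "vs \<in> nonzero_tuples d d" for vs c
    using that by simp
  show ?thesis
    unfolding steinberg_generators_def
  proof (intro Un_least subsetI)
    fix x :: "rat vec list \<Rightarrow>\<^sub>0 rat" assume "x \<in> {Poly_Mapping.single (vs[i := vs ! j, j := vs ! i]) 1 + Poly_Mapping.single vs 1 |vs i j.
           vs \<in> nonzero_tuples d d \<and> i < j \<and> j < d}"
    then show "x \<in> ?C"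
      by (auto simp del: free_module_simps intro!: C(2) single nonzero_tuples_swap)
  next
    fix x :: "rat vec list \<Rightarrow>\<^sub>0 rat" assume "x \<in> {Poly_Mapping.single (vs[i := c \<cdot>\<^sub>v (vs ! i)]) 1 - Poly_Mapping.single vs 1 |vs i c.
           vs \<in> nonzero_tuples d d \<and> i < d \<and> c \<noteq> 0}"
    then show "x \<in> ?C"
      by (auto simp del: free_module_simps intro!: C(4) single nonzero_tuples_scale)
  next
    fix x :: "rat vec list \<Rightarrow>\<^sub>0 rat"
    assume "x \<in> {(\<Sum>i\<le>d. Poly_Mapping.single (take i ws @ drop (Suc i) ws) ((-1) ^ i)) |ws.
           ws \<in> nonzero_tuples d (Suc d)}"
    then show "x \<in> ?C"
      by (auto simp del: free_module_simps intro!: rat_closed_sum[OF rat_closed_carrier] single nonzero_tuples_delete)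
  qed auto
qed

lemmas rat_closed_steinberg = rat_closed_rat_span[OF steinberg_generators_carrier, folded steinberg_relations_span]
lemmas steinberg_relations_carrier = rat_span_subset_carrier[OF steinberg_generators_carrier, folded steinberg_relations_span]
lemmas steinberg_generators_subset = rat_span_superset[OF steinberg_generators_carrier, folded steinberg_relations_span]
lemmas steinberg_relations_minimal = rat_span_minimal[OF steinberg_generators_carrier, folded steinberg_relations_span]

lemma
  assumes "vs \<in> nonzero_tuples d d"
  shows steinberg_dependent: "dependent_tuple d vs \<Longrightarrow> Poly_Mapping.single vs 1 \<in> steinberg_relations d"
    and steinberg_swap: "i < j \<Longrightarrow> j < d \<Longrightarrow>
      Poly_Mapping.single (vs[i := vs ! j, j := vs ! i]) 1 + Poly_Mapping.single vs 1 \<in> steinberg_relations d"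
    and steinberg_scale: "i < d \<Longrightarrow> c \<noteq> 0 \<Longrightarrow>
      Poly_Mapping.single (vs[i := c \<cdot>\<^sub>v (vs ! i)]) 1 - Poly_Mapping.single vs 1 \<in> steinberg_relations d"
  by (rule subsetD[OF steinberg_generators_subset], use assms in \<open>unfold steinberg_generators_def, blast\<close>)+

lemma steinberg_alternating_sum:
  assumes "ws \<in> nonzero_tuples d (Suc d)"
  shows "(\<Sum>i\<le>d. Poly_Mapping.single (take i ws @ drop (Suc i) ws) ((-1) ^ i)) \<in> steinberg_relations d"
  by (rule subsetD[OF steinberg_generators_subset], use assms in \<open>unfold steinberg_generators_def, blast\<close>)

text \<open>An entry passes \<open>k\<close> others by adjacent swaps, each costing a sign. This
  translates between deletion from \<open>w # vs\<close>, as in the alternating relation, and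
  replacement in place, as with the columns of a matrix.\<close>

lemma steinberg_move_front:
  assumes "vs \<in> nonzero_tuples d d" "w \<in> carrier_vec d" "w \<noteq> 0\<^sub>v d" "k < d"
  shows "Poly_Mapping.single (w # take k vs @ drop (Suc k) vs) 1 -
      Poly_Mapping.single (vs[k := w]) ((-1) ^ k) \<in> steinberg_relations d"
  using assms(1,4)
proof (induction k arbitrary: vs)
  case 0
  then have "vs[0 := w] = w # drop 1 vs"
    by (cases vs) (auto simp: nonzero_tuples_def)
  then show ?case using rat_closedD(1)[OF rat_closed_steinberg] by simp
next
  case (Suc k)
  note R = rat_closedD[OF rat_closed_steinberg[of d]]
  have len: "length vs = d" using Suc.prems by (simp add: nonzero_tuples_def)
  \<comment> \<open>The entry \<open>vs ! k\<close> now occurs twice; the induction hypothesis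
    removes its copy at \<open>k\<close>, and the copy at \<open>Suc k\<close> keeps it in the
    list.\<close>
  let ?vs' = "vs[Suc k := vs ! k]" and ?us = "vs[Suc k := w]"
  have "?vs' \<in> nonzero_tuples d d"
    using Suc.prems nonzero_tuples_nth[of vs d d k] by (intro nonzero_tuples_update) auto
  from Suc.IH[OF this] Suc.prems(2)
  have 1: "Poly_Mapping.single (w # take k ?vs' @ drop (Suc k) ?vs') 1 -
      Poly_Mapping.single (?vs'[k := w]) ((-1) ^ k) \<in> steinberg_relations d" by simp
  have us: "?us \<in> nonzero_tuples d d"
    using Suc.prems(1) assms by (intro nonzero_tuples_update) auto
  have "?us[k := ?us ! Suc k, Suc k := ?us ! k] = ?vs'[k := w]"
    using Suc.prems(2) len by (simp add: list_update_swap)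
  then have 2: "Poly_Mapping.single (?vs'[k := w]) 1 + Poly_Mapping.single ?us 1 \<in> steinberg_relations d"
    using steinberg_swap[OF us, of k "Suc k"] Suc.prems(2) by simp
  have "take k ?vs' @ drop (Suc k) ?vs' = take (Suc k) vs @ drop (Suc (Suc k)) vs"
    using Suc.prems(2) len
    by (simp add: take_Suc_conv_app_nth Cons_nth_drop_Suc[symmetric, of "Suc k"])
  with R(2)[OF 1 R(3)[OF 2, of "(-1) ^ k"]] show ?case
    by (simp add: scale_add single_uminus)
qed

text \<open>This is the alternating relation for \<open>w # vs\<close>: deleting \<open>w\<close>
  gives \<open>vs\<close>, and in every other term the sign of the relation cancels the sign of
  moving \<open>w\<close> into place. Both spanning results rest on this form.\<close>

lemma steinberg_exchange:
  assumes "vs \<in> nonzero_tuples d d" "w \<in> carrier_vec d" "w \<noteq> 0\<^sub>v d"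
  shows "Poly_Mapping.single vs 1 - (\<Sum>k<d. Poly_Mapping.single (vs[k := w]) 1) \<in> steinberg_relations d"
proof -
  note R = rat_closedD[OF rat_closed_steinberg[of d]]
  let ?X = "\<lambda>k. w # take k vs @ drop (Suc k) vs"
  have "w # vs \<in> nonzero_tuples d (Suc d)" using assms by (auto simp: nonzero_tuples_def)
  from steinberg_alternating_sum[OF this]
  have 1: "Poly_Mapping.single vs 1 + (\<Sum>k<d. Poly_Mapping.single (?X k) (- ((-1) ^ k))) \<in> steinberg_relations d"
    unfolding sum.atMost_shift by (simp add: lessThan_Suc_atMost)
  have 2: "(\<Sum>k<d. Poly_Mapping.map ((*) ((-1) ^ k)) (Poly_Mapping.single (?X k) 1 -
      Poly_Mapping.single (vs[k := w]) ((-1) ^ k))) \<in> steinberg_relations d"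
    using assms by (intro rat_closed_sum[OF rat_closed_steinberg] R(3) steinberg_move_front) auto
  have "((-1) ^ k :: rat) * (-1) ^ k = 1" for k by (simp flip: power_mult_distrib)
  with R(2)[OF 1 2] show ?thesis
    by (simp add: scale_diff sum_subtractf single_uminus sum_negf)
qed

section \<open>Integral frames span: lowering the determinant\<close>

lemma mat_of_cols_update:
  assumes "length vs = d" "k < d"
  shows "mat_of_cols d (vs[k := w]) = replace_col (mat_of_cols d vs) w k"
  by (rule eq_matI) (use assms in \<open>auto simp: replace_col_def mat_of_cols_def nth_list_update\<close>)

lemma dependent_tuple_iff_det:
  "length vs = d \<Longrightarrow> dependent_tuple d vs \<longleftrightarrow> det (mat_of_cols d vs) = 0"
  unfolding dependent_tuple_def by (subst det_0_iff_vec_prod_zero[of _ d]) auto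

lemma steinberg_det_zero:
  "vs \<in> nonzero_tuples d d \<Longrightarrow> det (mat_of_cols d vs) = 0 \<Longrightarrow> Poly_Mapping.single vs 1 \<in> steinberg_relations d"
  by (rule steinberg_dependent) (auto simp: dependent_tuple_iff_det nonzero_tuples_def)

text \<open>The cofactors of column \<open>k\<close> do not see column \<open>k\<close>, so Cramer
  determinants are linear in the replacing vector.\<close>

lemma det_replace_col:
  assumes A: "(A :: 'a::comm_ring_1 mat) \<in> carrier_mat n n" and k: "k < n"
  shows "det (replace_col A b k) = (\<Sum>i<n. b $ i * cofactor A i k)"
proof -
  have "replace_col A b k \<in> carrier_mat n n" using A by (auto simp: replace_col_def)
  then show ?thesis
    by (subst laplace_expansion_column[OF _ k])
       (use A k in \<open>auto intro!: sum.cong arg_cong[of _ _ det] arg_cong[of _ _ "\<lambda>x. _ * x"] eq_matI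
         simp: replace_col_def cofactor_def mat_delete_def\<close>)
qed

text \<open>For \<open>1 < \<bar>det A\<bar>\<close> the columns span a proper sublattice, so some
  unit vector has a coordinate that is not an integer. Its reduction modulo the sublattice has
  coordinates of absolute value below 1, and by Cramer these are the ratios of the
  determinants.\<close>

lemma exists_smaller_replacement:
  fixes A :: "int mat"
  assumes A: "A \<in> carrier_mat d d" and D: "1 < \<bar>det A\<bar>"
  obtains w where "w \<in> carrier_vec d" "w \<noteq> 0\<^sub>v d" "\<And>k. k < d \<Longrightarrow> \<bar>det (replace_col A w k)\<bar> < \<bar>det A\<bar>"
proof -
  let ?D = "det A"
  note adj = adj_mat[OF A]
  \<comment> \<open>Otherwise the adjugate divided by \<open>?D\<close> is an integral inverse of
    \<open>A\<close>, and \<open>?D\<close> is a unit.\<close>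
  have "\<exists>i<d. \<exists>j<d. \<not> ?D dvd adj_mat A $$ (i, j)"
  proof (rule ccontr)
    assume "\<not> ?thesis"
    then have dvd: "?D dvd adj_mat A $$ (i, j)" if "i < d" "j < d" for i j using that by blast
    define N where "N = mat d d (\<lambda>ij. adj_mat A $$ ij div ?D)"
    have N: "N \<in> carrier_mat d d" by (simp add: N_def)
    have "adj_mat A = ?D \<cdot>\<^sub>m N"
      by (rule eq_matI) (use dvd adj(1) in \<open>auto simp: N_def\<close>)
    then have "?D \<cdot>\<^sub>m (A * N) = ?D \<cdot>\<^sub>m 1\<^sub>m d"
      using adj(2) mult_smult_distrib[OF A N] by simp
    then have "?D * (A * N) $$ (i, j) = ?D * 1\<^sub>m d $$ (i, j)" if "i < d" "j < d" for i j
      using arg_cong[of _ _ "\<lambda>M. M $$ (i, j)"] that A N by (metis carrier_matD index_mult_mat(2,3) index_one_mat(2,3) index_smult_mat(1))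
    then have "(A * N) $$ (i, j) = 1\<^sub>m d $$ (i, j)" if "i < d" "j < d" for i j
      using that D mult_left_cancel[of ?D] by (metis abs_0 not_one_less_zero)
    then have "A * N = 1\<^sub>m d"
      using A N by (intro eq_matI) auto
    then have "det A * det N = 1" using det_mult[OF A N] by simp
    then show False using D by (auto simp: zmult_eq_1_iff)
  qed
  then obtain i j where i: "i < d" and j: "j < d" and ndvd: "\<not> ?D dvd adj_mat A $$ (i, j)" by blast
  \<comment> \<open>\<open>?D\<close> times the coordinates of the unit vector \<open>j\<close> is
    column \<open>j\<close> of the adjugate; \<open>q\<close> and \<open>y\<close> are its quotients
    and remainders on division by \<open>?D\<close>. Hence \<open>w\<close> has coordinates
    \<open>y / ?D\<close>.\<close>
  define y where "y = vec d (\<lambda>k. adj_mat A $$ (k, j) mod ?D)"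
  define q where "q = vec d (\<lambda>k. adj_mat A $$ (k, j) div ?D)"
  define w where "w = unit_vec d j - A *\<^sub>v q"
  have carr: "y \<in> carrier_vec d" "q \<in> carrier_vec d" "w \<in> carrier_vec d"
    using A by (auto simp: y_def q_def w_def)
  have col: "col (adj_mat A) j = y + ?D \<cdot>\<^sub>v q"
    using adj(1) j by (intro eq_vecI) (auto simp: y_def q_def)
  have "A *\<^sub>v col (adj_mat A) j = ?D \<cdot>\<^sub>v unit_vec d j"
  proof -
    have "A *\<^sub>v col (adj_mat A) j = col (A * adj_mat A) j"
      using A adj(1) j by (intro eq_vecI) auto
    then show ?thesis using j unfolding adj(2) by (intro eq_vecI) auto
  qed
  moreover have smult: "A *\<^sub>v (?D \<cdot>\<^sub>v q) = ?D \<cdot>\<^sub>v (A *\<^sub>v q)"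
    using A carr by (intro eq_vecI) auto
  ultimately have "A *\<^sub>v y + ?D \<cdot>\<^sub>v (A *\<^sub>v q) = ?D \<cdot>\<^sub>v unit_vec d j"
    using A carr mult_add_distrib_mat_vec[OF A carr(1), of "?D \<cdot>\<^sub>v q"] smult by (simp add: col)
  then have eq: "(A *\<^sub>v y + ?D \<cdot>\<^sub>v (A *\<^sub>v q)) $ k = (?D \<cdot>\<^sub>v unit_vec d j) $ k" for k by simp
  have Ay: "A *\<^sub>v y = ?D \<cdot>\<^sub>v w"
  proof (rule eq_vecI)
    fix k assume "k < dim_vec (?D \<cdot>\<^sub>v w)"
    then have "k < d" using carr by simp
    then show "(A *\<^sub>v y) $ k = (?D \<cdot>\<^sub>v w) $ k"
      using eq[of k] A unfolding w_def
      by (simp add: algebra_simps del: index_mult_mat_vec index_unit_vec(1))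
  qed (use A carr in auto)
  have det: "det (replace_col A w k) = y $ k" if k: "k < d" for k
  proof -
    have "y $ k * ?D = det (replace_col A (?D \<cdot>\<^sub>v w) k)"
      using cramer_lemma_mat[OF A carr(1) k] Ay by simp
    also have "\<dots> = ?D * det (replace_col A w k)"
      using carr(3) by (simp add: det_replace_col[OF A k] sum_distrib_left mult.assoc)
    finally show ?thesis using D by auto
  qed
  \<comment> \<open>The entry not divisible by \<open>?D\<close> leaves a nonzero remainder, which
    rules out \<open>w = 0\<close>.\<close>
  have "det (replace_col A w i) \<noteq> 0"
    using det[OF i] i ndvd by (simp add: y_def mod_eq_0_iff_dvd)
  moreover have "det (replace_col A (0\<^sub>v d) i) = 0"
    using A i by (simp add: det_replace_col)
  ultimately have "w \<noteq> 0\<^sub>v d" by auto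
  moreover have "\<bar>det (replace_col A w k)\<bar> < \<bar>?D\<bar>" if "k < d" for k
    using det[OF that] that D abs_mod_less[of ?D] by (simp add: y_def)
  ultimately show ?thesis using that carr(3) by blast
qed

text \<open>The algorithm of Ash and Rudolph: an exchange with a lattice vector whose coordinates in the
  given frame are proper fractions lowers the determinant.\<close>

lemma integral_tuple_in_span:
  assumes V: "rat_closed V" "steinberg_relations d \<subseteq> V"
    and frames: "\<And>ws. integral_frame d ws \<Longrightarrow> Poly_Mapping.single (map (map_vec rat_of_int) ws) 1 \<in> V"
    and "length ws = d" "set ws \<subseteq> carrier_vec d - {0\<^sub>v d}"
  shows "Poly_Mapping.single (map (map_vec rat_of_int) ws) 1 \<in> V"
  using assms(4,5)
proof (induction "nat \<bar>det (mat_of_cols d ws)\<bar>" arbitrary: ws rule: less_induct)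
  case less
  let ?A = "mat_of_cols d ws"
  have A: "?A \<in> carrier_mat d d" using less.prems by auto
  have rat: "map (map_vec rat_of_int) us \<in> nonzero_tuples d d" "mat_of_cols d (map (map_vec rat_of_int) us) = map_mat rat_of_int (mat_of_cols d us)"
    if "length us = d" "set us \<subseteq> carrier_vec d - {0\<^sub>v d}" for us
  proof -
    have "dim_vec (us ! i) = d" if "i < d" for i
      using that \<open>length us = d\<close> \<open>set us \<subseteq> _\<close> nth_mem[of i us] by fastforce
    then show "mat_of_cols d (map (map_vec rat_of_int) us) = map_mat rat_of_int (mat_of_cols d us)"
      using that by (intro eq_matI) (auto simp: mat_of_cols_def)
    show "map (map_vec rat_of_int) us \<in> nonzero_tuples d d"
      using that by (auto simp: nonzero_tuples_def)
  qed
  note rat0 = rat[OF less.prems]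
  consider "det ?A = 0" | "\<bar>det ?A\<bar> = 1" | "1 < \<bar>det ?A\<bar>" by linarith
  then show ?case
  proof cases
    case 1
    then have "det (mat_of_cols d (map (map_vec rat_of_int) ws)) = 0" unfolding rat0(2) by simp
    then show ?thesis using steinberg_det_zero[OF rat0(1)] V by blast
  next
    case 2
    then have "integral_frame d ws" using less.prems by (auto simp: integral_frame_def)
    then show ?thesis by (rule frames)
  next
    case 3
    from exists_smaller_replacement[OF A 3] obtain w where w: "w \<in> carrier_vec d" "w \<noteq> 0\<^sub>v d"
      and small: "\<And>k. k < d \<Longrightarrow> \<bar>det (replace_col ?A w k)\<bar> < \<bar>det ?A\<bar>" by metis
    have "Poly_Mapping.single (map (map_vec rat_of_int) (ws[k := w])) 1 \<in> V" if "k < d" for k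
    proof (rule less.hyps)
      show "nat \<bar>det (mat_of_cols d (ws[k := w]))\<bar> < nat \<bar>det ?A\<bar>"
        using small[OF that] that less.prems by (simp add: mat_of_cols_update)
      show "set (ws[k := w]) \<subseteq> carrier_vec d - {0\<^sub>v d}"
        using less.prems w set_update_subset_insert[of ws k w] by blast
    qed (use less.prems in simp)
    then have "(\<Sum>k<d. Poly_Mapping.single ((map (map_vec rat_of_int) ws)[k := map_vec rat_of_int w]) 1) \<in> V"
      by (intro rat_closed_sum[OF V(1)]) (auto simp: map_update)
    moreover have "Poly_Mapping.single (map (map_vec rat_of_int) ws) 1 -
      (\<Sum>k<d. Poly_Mapping.single ((map (map_vec rat_of_int) ws)[k := map_vec rat_of_int w]) 1) \<in> V"
      using steinberg_exchange[OF rat0(1), of "map_vec rat_of_int w"] w V(2) by auto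
    ultimately show ?thesis using rat_closedD(2)[OF V(1)] by fastforce
  qed
qed

lemma exists_integral_multiple:
  assumes "v \<in> carrier_vec d"
  obtains c w where "c \<noteq> 0" "w \<in> carrier_vec d" "c \<cdot>\<^sub>v v = map_vec rat_of_int w"
proof -
  define c where "c = (\<Prod>i<d. snd (quotient_of (v $ i)))"
  have pos: "snd (quotient_of r) > 0" for r using quotient_of_denom_pos' by blast
  have "\<exists>z. rat_of_int c * v $ i = rat_of_int z" if "i < d" for i
  proof -
    have "v $ i = rat_of_int (fst (quotient_of (v $ i))) / rat_of_int (snd (quotient_of (v $ i)))"
      by (metis prod.collapse quotient_of_div)
    then have "rat_of_int (snd (quotient_of (v $ i))) * v $ i = rat_of_int (fst (quotient_of (v $ i)))"
      using pos[of "v $ i"] by (simp add: field_simps)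
    moreover have "c = (\<Prod>j\<in>{..<d} - {i}. snd (quotient_of (v $ j))) * snd (quotient_of (v $ i))"
      using that by (simp add: c_def prod.remove[of _ i] mult.commute)
    ultimately show ?thesis by (metis mult.assoc of_int_mult)
  qed
  then obtain z where "\<And>i. i < d \<Longrightarrow> rat_of_int c * v $ i = rat_of_int (z i)" by metis
  then have "rat_of_int c \<cdot>\<^sub>v v = map_vec rat_of_int (vec d z)" using assms by (intro eq_vecI) auto
  moreover have "rat_of_int c \<noteq> 0" using pos by (auto simp: c_def less_le)
  ultimately show ?thesis using that vec_carrier by blast
qed

lemma tuple_in_integral_span:
  assumes V: "rat_closed V" "steinberg_relations d \<subseteq> V"
    and frames: "\<And>ws. integral_frame d ws \<Longrightarrow> Poly_Mapping.single (map (map_vec rat_of_int) ws) 1 \<in> V"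
    and vs: "vs \<in> nonzero_tuples d d"
  shows "Poly_Mapping.single vs 1 \<in> V"
proof -
  \<comment> \<open>Entries from position \<open>k\<close> on are integral already; each step clears
    the denominators of one more entry, which does not change the apartment.\<close>
  have "Poly_Mapping.single vs 1 \<in> V"
    if "k \<le> d" "vs \<in> nonzero_tuples d d" "\<forall>i<d. k \<le> i \<longrightarrow> (\<exists>w\<in>carrier_vec d. vs ! i = map_vec rat_of_int w)" for k vs
    using that
  proof (induction k arbitrary: vs)
    case 0
    then have "\<forall>i<d. \<exists>w. w \<in> carrier_vec d \<and> vs ! i = map_vec rat_of_int w" by auto
    then obtain w where w: "\<And>i. i < d \<Longrightarrow> w i \<in> carrier_vec d \<and> vs ! i = map_vec rat_of_int (w i)" by metis
    have eq: "vs = map (map_vec rat_of_int) (map w [0..<d])"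
      using w 0(2) by (intro nth_equalityI) (auto simp: nonzero_tuples_def)
    have "w i \<noteq> 0\<^sub>v d" if "i < d" for i
      using w[OF that] nonzero_tuples_nth[OF 0(2) that] by auto
    then show ?case
      unfolding eq by (intro integral_tuple_in_span[OF V frames]) (use w in auto)
  next
    case (Suc k)
    then have k: "k < d" by simp
    from exists_integral_multiple nonzero_tuples_nth[OF Suc.prems(2) k]
    obtain c w where cw: "c \<noteq> 0" "w \<in> carrier_vec d" "c \<cdot>\<^sub>v (vs ! k) = map_vec rat_of_int w" by metis
    have "Poly_Mapping.single (vs[k := c \<cdot>\<^sub>v (vs ! k)]) 1 \<in> V"
    proof (rule Suc.IH)
      show "vs[k := c \<cdot>\<^sub>v vs ! k] \<in> nonzero_tuples d d"
        using Suc.prems(2) k cw(1) by (rule nonzero_tuples_scale)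
      show "\<forall>i<d. k \<le> i \<longrightarrow> (\<exists>w\<in>carrier_vec d. vs[k := c \<cdot>\<^sub>v vs ! k] ! i = map_vec rat_of_int w)"
        using Suc.prems cw by (auto simp: nth_list_update nonzero_tuples_def)
    qed (use k in simp)
    moreover have "Poly_Mapping.single (vs[k := c \<cdot>\<^sub>v (vs ! k)]) 1 - Poly_Mapping.single vs 1 \<in> V"
      using steinberg_scale[OF Suc.prems(2) k cw(1)] V(2) by blast
    ultimately show ?case using rat_closedD(4)[OF V(1)] by fastforce
  qed
  from this[of d vs] vs show ?thesis by simp
qed

section \<open>Unitriangular apartments and flag functionals\<close>

text \<open>An elimination in progress: the vectors from \<open>k\<close> on have their final shape,
  and the first \<open>k\<close> lie in the span of the first \<open>k\<close> unit vectors. The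
  condition is empty for \<open>k = d\<close> and is unitriangularity for
  \<open>k = 0\<close>.\<close>

definition triangular_from :: "nat \<Rightarrow> nat \<Rightarrow> rat vec list \<Rightarrow> bool" where
  "triangular_from d k vs \<longleftrightarrow>
     (\<forall>i<d. k \<le> i \<longrightarrow> vs ! i $ i = 1 \<and> (\<forall>j<d. i < j \<longrightarrow> vs ! i $ j = 0)) \<and>
     (\<forall>i<k. \<forall>j<d. k \<le> j \<longrightarrow> vs ! i $ j = 0)"

definition unitriangular :: "nat \<Rightarrow> rat vec list \<Rightarrow> bool" where
  "unitriangular d vs \<longleftrightarrow>
     vs \<in> nonzero_tuples d d \<and> (\<forall>i<d. vs ! i $ i = 1 \<and> (\<forall>j<d. i < j \<longrightarrow> vs ! i $ j = 0))"

text \<open>Pigeonhole in the Leibniz formula: in the columns up to \<open>k\<close> all coordinates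
  from \<open>k\<close> on vanish, so \<open>d - k\<close> rows have their nonzero entries in only
  \<open>d - k - 1\<close> columns.\<close>

lemma triangular_from_det_zero:
  fixes vs :: "rat vec list"
  assumes vs: "vs \<in> nonzero_tuples d d" and tri: "triangular_from d (Suc k) vs" and k: "k < d"
    and zero: "\<And>i. i \<le> k \<Longrightarrow> vs ! i $ k = 0"
  shows "det (mat_of_cols d vs) = 0"
proof -
  let ?A = "mat_of_cols d vs"
  have len: "length vs = d" using vs by (simp add: nonzero_tuples_def)
  have "(\<Prod>i = 0..<d. ?A $$ (i, p i)) = 0" if p: "p permutes {0..<d}" for p
  proof -
    have "\<exists>i\<in>{k..<d}. p i \<notin> {Suc k..<d}"
    proof (rule ccontr)
      assume "\<not> ?thesis"
      then have "p ` {k..<d} \<subseteq> {Suc k..<d}" by blast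
      then have "card {k..<d} \<le> card {Suc k..<d}"
        using permutes_inj_on[OF p] by (intro card_inj_on_le[of p]) auto
      then show False using k by simp
    qed
    then obtain i where i: "k \<le> i" "i < d" "p i \<notin> {Suc k..<d}" by auto
    have "p i < d" using permutes_in_image[OF p, of i] i by simp
    then have "p i \<le> k" using i by simp
    then have "vs ! p i $ i = 0"
      using zero tri i unfolding triangular_from_def by (cases "i = k") auto
    then have "?A $$ (i, p i) = 0" using i \<open>p i < d\<close> len by (simp add: mat_of_cols_def)
    then show ?thesis using i by (intro prod_zero) auto
  qed
  then show ?thesis
    using len by (subst det_def'[of _ d]) (auto intro!: sum.neutral simp del: prod_zero_iff)
qed

lemma triangular_from_update:
  fixes w :: "rat vec"
  assumes "triangular_from d k vs" "length vs = d" "i < k" "\<And>j. k \<le> j \<Longrightarrow> j < d \<Longrightarrow> w $ j = 0"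
  shows "triangular_from d k (vs[i := w])"
  using assms by (auto simp: triangular_from_def nth_list_update)

text \<open>Induction on how many of the first \<open>k + 1\<close> vectors involve coordinate
  \<open>k\<close>. Two such vectors have a combination \<open>w\<close> without that coordinate,
  and exchanging with \<open>w\<close> leaves only the two tuples in which one of them is replaced.
  A single such vector is moved to position \<open>k\<close> and normalised.\<close>

lemma triangular_step:
  assumes V: "rat_closed V" "steinberg_relations d \<subseteq> V"
    and step: "\<And>vs. vs \<in> nonzero_tuples d d \<Longrightarrow> triangular_from d k vs \<Longrightarrow> Poly_Mapping.single vs 1 \<in> V"
    and k: "k < d"
    and "vs \<in> nonzero_tuples d d" "triangular_from d (Suc k) vs"
  shows "Poly_Mapping.single vs 1 \<in> V"
  using assms(5,6)
proof (induction "card {i. i \<le> k \<and> vs ! i $ k \<noteq> 0}" arbitrary: vs rule: less_induct)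
  case less
  note vs = less.prems(1) and tri = less.prems(2)
  note V' = rat_closedD[OF V(1)]
  let ?A = "mat_of_cols d vs"
  define Z where "Z = {i. i \<le> k \<and> vs ! i $ k \<noteq> 0}"
  have len: "length vs = d" using vs by (simp add: nonzero_tuples_def)
  have A: "?A \<in> carrier_mat d d" using len by auto
  have dep: "Poly_Mapping.single us 1 \<in> V" if "us \<in> nonzero_tuples d d" "det (mat_of_cols d us) = 0" for us
    using steinberg_det_zero[OF that] V(2) by blast
  have scale: "Poly_Mapping.single us 1 \<in> V"
    if us: "us \<in> nonzero_tuples d d" "triangular_from d (Suc k) us" "us ! k $ k \<noteq> 0" "\<And>i. i < k \<Longrightarrow> us ! i $ k = 0"
    for us :: "rat vec list"
  proof -
    let ?c = "1 / us ! k $ k"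
    have "us[k := ?c \<cdot>\<^sub>v us ! k] \<in> nonzero_tuples d d"
      using us(1) k us(3) by (intro nonzero_tuples_scale) auto
    moreover have "triangular_from d k (us[k := ?c \<cdot>\<^sub>v us ! k])"
      unfolding triangular_from_def
    proof (intro conjI allI impI)
      have lu: "length us = d" and dim: "dim_vec (us ! k) = d"
        using us(1) nonzero_tuples_nth[OF us(1) k] by (auto simp: nonzero_tuples_def)
      fix i j
      show "us[k := ?c \<cdot>\<^sub>v us ! k] ! i $ i = 1" if "i < d" "k \<le> i"
        using that us lu dim k by (cases "i = k") (auto simp: triangular_from_def)
      show "us[k := ?c \<cdot>\<^sub>v us ! k] ! i $ j = 0" if "i < d" "k \<le> i" "j < d" "i < j"
        using that us lu dim k by (cases "i = k") (auto simp: triangular_from_def)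
      show "us[k := ?c \<cdot>\<^sub>v us ! k] ! i $ j = 0" if "i < k" "j < d" "k \<le> j"
        using that us lu dim k by (cases "j = k") (auto simp: triangular_from_def)
    qed
    ultimately have "Poly_Mapping.single (us[k := ?c \<cdot>\<^sub>v us ! k]) 1 \<in> V" by (rule step)
    moreover have "Poly_Mapping.single (us[k := ?c \<cdot>\<^sub>v us ! k]) 1 - Poly_Mapping.single us 1 \<in> V"
      using steinberg_scale[OF us(1) k, of ?c] us(3) V(2) by auto
    ultimately show ?thesis using V'(4) by fastforce
  qed
  have "Z = {} \<or> (\<exists>i. Z = {i}) \<or> (\<exists>i j. i \<in> Z \<and> j \<in> Z \<and> i < j)"
  proof (cases "\<exists>i. Z \<subseteq> {i}")
    case True
    then show ?thesis using subset_singletonD by metis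
  next
    case False
    then obtain i j where "i \<in> Z" "j \<in> Z" "i \<noteq> j" by blast
    then show ?thesis by (metis linorder_neqE_nat)
  qed
  then consider "Z = {}" | i where "Z = {i}" | i j where "i \<in> Z" "j \<in> Z" "i < j" by blast
  then show ?case
  proof cases
    case 1
    then show ?thesis using triangular_from_det_zero[OF vs tri k] dep[OF vs] unfolding Z_def by blast
  next
    case (2 i)
    then have "i \<in> Z" by simp
    then have i: "i \<le> k" "vs ! i $ k \<noteq> 0" by (simp_all add: Z_def)
    have only: "vs ! m $ k = 0" if "m \<le> k" "m \<noteq> i" for m
    proof (rule ccontr)
      assume "vs ! m $ k \<noteq> 0"
      then have "m \<in> Z" using that by (simp add: Z_def)
      then show False using 2 that by simp
    qed
    show ?thesis
    proof (cases "i = k")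
      case True
      then show ?thesis using i only by (intro scale[OF vs tri]) auto
    next
      case False
      with i have ik: "i < k" by simp
      let ?us = "vs[i := vs ! k, k := vs ! i]"
      have "Poly_Mapping.single ?us 1 \<in> V"
      proof (rule scale)
        show "?us \<in> nonzero_tuples d d" using nonzero_tuples_swap[OF vs] ik k by simp
        show "triangular_from d (Suc k) ?us"
          using tri ik k len by (intro triangular_from_update) (auto simp: triangular_from_def)
        show "?us ! k $ k \<noteq> 0" using i len k by simp
        show "?us ! l $ k = 0" if "l < k" for l
          using only that len ik k by (cases "l = i") auto
      qed
      moreover have "Poly_Mapping.single ?us 1 + Poly_Mapping.single vs 1 \<in> V"
        using steinberg_swap[OF vs ik k] V(2) by blast
      ultimately show ?thesis using V'(4) by fastforce
    qed
  next
    case (3 i j)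
    then have ij: "i < d" "j < d" "i \<le> k" "j \<le> k" "vs ! i $ k \<noteq> 0" "vs ! j $ k \<noteq> 0" using k by (auto simp: Z_def)
    \<comment> \<open>These coefficients make coordinate \<open>k\<close> of \<open>w\<close> equal
      to \<open>1 - 1 = 0\<close>.\<close>
    define t where "t = vec d (\<lambda>m. if m = i then 1 / vs ! i $ k else if m = j then - 1 / vs ! j $ k else 0)"
    define w where "w = ?A *\<^sub>v t"
    have t: "t \<in> carrier_vec d" "t \<noteq> 0\<^sub>v d"
      using ij by (auto simp: t_def vec_eq_iff)
    have w: "w \<in> carrier_vec d" using A t(1) by (simp add: w_def)
    have w_nth: "w $ l = vs ! i $ l / vs ! i $ k - vs ! j $ l / vs ! j $ k" if "l < d" for l
    proof -
      have "w $ l = (\<Sum>m = 0..<d. vs ! m $ l * t $ m)"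
        using that len by (simp add: w_def scalar_prod_def mat_of_cols_def t_def)
      also have "\<dots> = (\<Sum>m \<in> {i, j}. vs ! m $ l * t $ m)"
        by (rule sum.mono_neutral_right) (use ij in \<open>auto simp: t_def\<close>)
      also have "\<dots> = vs ! i $ l / vs ! i $ k - vs ! j $ l / vs ! j $ k"
        using 3(3) ij by (simp add: t_def)
      finally show ?thesis .
    qed
    show ?thesis
    proof (cases "w = 0\<^sub>v d")
      case True
      then have "det ?A = 0" using t A by (subst det_0_iff_vec_prod_zero[OF A]) (auto simp: w_def)
      then show ?thesis using dep vs by blast
    next
      case False
      have "Poly_Mapping.single (vs[m := w]) 1 \<in> V" if m: "m < d" for m
      proof (cases "m = i \<or> m = j")
        case True
        show ?thesis
        proof (rule less.hyps)
          show "vs[m := w] \<in> nonzero_tuples d d" using nonzero_tuples_update[OF vs w False] .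
          show "triangular_from d (Suc k) (vs[m := w])"
            using tri len ij True w_nth by (intro triangular_from_update) (auto simp: triangular_from_def)
          have "{l. l \<le> k \<and> vs[m := w] ! l $ k \<noteq> 0} \<subseteq> Z - {m}"
            using w_nth[OF k] ij len m by (auto simp: Z_def nth_list_update split: if_splits)
          moreover have "m \<in> Z" using True ij by (auto simp: Z_def)
          moreover have "finite Z" by (auto simp: Z_def)
          ultimately show "card {l. l \<le> k \<and> vs[m := w] ! l $ k \<noteq> 0} < card {l. l \<le> k \<and> vs ! l $ k \<noteq> 0}"
            unfolding Z_def by (intro psubset_card_mono) auto
        qed
      next
        case False
        \<comment> \<open>By Cramer this determinant is \<open>t $ m * det ?A\<close>, and
          \<open>t\<close> is supported on \<open>i\<close> and \<open>j\<close>.\<close>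
        have "det (mat_of_cols d (vs[m := w])) = 0"
          using cramer_lemma_mat[OF A t(1) m] False m len
          by (simp add: mat_of_cols_update w_def) (simp add: t_def)
        then show ?thesis using dep nonzero_tuples_update[OF vs w \<open>w \<noteq> 0\<^sub>v d\<close>] by blast
      qed
      then have "(\<Sum>m<d. Poly_Mapping.single (vs[m := w]) 1) \<in> V"
        by (intro rat_closed_sum[OF V(1)]) auto
      moreover have "Poly_Mapping.single vs 1 - (\<Sum>m<d. Poly_Mapping.single (vs[m := w]) 1) \<in> V"
        using steinberg_exchange[OF vs w False] V(2) by blast
      ultimately show ?thesis using V'(2) by fastforce
    qed
  qed
qed

lemma tuple_in_unitriangular_span:
  assumes V: "rat_closed V" "steinberg_relations d \<subseteq> V"
    and tri: "\<And>us. unitriangular d us \<Longrightarrow> Poly_Mapping.single us 1 \<in> V"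
    and vs: "vs \<in> nonzero_tuples d d"
  shows "Poly_Mapping.single vs 1 \<in> V"
proof -
  have "Poly_Mapping.single vs 1 \<in> V" if "k \<le> d" "vs \<in> nonzero_tuples d d" "triangular_from d k vs" for k vs
    using that
  proof (induction k arbitrary: vs)
    case 0
    then show ?case by (intro tri) (auto simp: unitriangular_def triangular_from_def)
  next
    case (Suc k)
    then show ?case using triangular_step[OF V, of k vs] by simp
  qed
  from this[of d vs] vs show ?thesis by (simp add: triangular_from_def)
qed

text \<open>A matrix \<open>B\<close> of this kind is a full flag in general position with respect to the flag of spans
  of unit vectors; only its entries below \<open>d\<close> matter, and it is infinite to be independent of \<open>d\<close>.\<close>

definition upper_unitriangular :: "(nat \<Rightarrow> nat \<Rightarrow> rat) \<Rightarrow> bool" where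
  "upper_unitriangular B \<longleftrightarrow> (\<forall>i. B i i = 1) \<and> (\<forall>i j. j < i \<longrightarrow> B i j = 0)"

text \<open>The common kernels of the first \<open>i\<close> rows of \<open>B\<close> form the flag;
  for nonzero \<open>v\<close> the pivot is the largest \<open>i\<close> for which \<open>v\<close>
  lies in the \<open>i\<close>-th of them.\<close>

definition pivot :: "(nat \<Rightarrow> nat \<Rightarrow> rat) \<Rightarrow> rat vec \<Rightarrow> nat" where
  "pivot B v = (LEAST i. (\<Sum>j<dim_vec v. B i j * v $ j) \<noteq> 0)"

text \<open>The coefficient of the flag \<open>B\<close> in the apartment: a term of the apartment is this flag exactly
  when it lists the vectors by their pivots, so the value is the sign of that permutation, if any.\<close>

definition pivot_det :: "(nat \<Rightarrow> nat \<Rightarrow> rat) \<Rightarrow> rat vec list \<Rightarrow> rat" where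
  "pivot_det B vs = det (mat (length vs) (length vs) (\<lambda>(i, j). of_bool (j = pivot B (vs ! i))))"

text \<open>At the last nonzero coordinate \<open>J\<close> of \<open>v\<close> only the diagonal
  entry of row \<open>J\<close> of \<open>B\<close> contributes, so that row does not annihilate
  \<open>v\<close>. Hence the \<open>LEAST\<close> is attained and is at most
  \<open>J\<close>.\<close>

lemma pivot_properties:
  assumes B: "upper_unitriangular B" and v: "v \<in> carrier_vec d" "v \<noteq> 0\<^sub>v d"
  shows pivot_less: "pivot B v < d"
    and pivot_nonzero: "(\<Sum>j<d. B (pivot B v) j * v $ j) \<noteq> 0"
    and before_pivot: "\<And>i. i < pivot B v \<Longrightarrow> (\<Sum>j<d. B i j * v $ j) = 0"
proof -
  define J where "J = Max {j. j < d \<and> v $ j \<noteq> 0}"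
  have fin: "finite {j. j < d \<and> v $ j \<noteq> 0}" by simp
  moreover have "{j. j < d \<and> v $ j \<noteq> 0} \<noteq> {}" using v by (auto simp: vec_eq_iff)
  ultimately have J: "J < d" "v $ J \<noteq> 0" using Max_in unfolding J_def by blast+
  have above: "v $ j = 0" if "j < d" "J < j" for j
  proof (rule ccontr)
    assume "v $ j \<noteq> 0"
    then have "j \<le> J" unfolding J_def using that fin by (intro Max_ge) auto
    then show False using that by simp
  qed
  have "(\<Sum>j<d. B J j * v $ j) = (\<Sum>j<d. if j = J then v $ J else 0)"
  proof (intro sum.cong refl)
    fix j assume "j \<in> {..<d}"
    then show "B J j * v $ j = (if j = J then v $ J else 0)"
      using B above[of j] by (cases j J rule: linorder_cases) (auto simp: upper_unitriangular_def)
  qed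
  then have ne: "(\<Sum>j<dim_vec v. B J j * v $ j) \<noteq> 0" using J v(1) by simp
  show "(\<Sum>j<d. B (pivot B v) j * v $ j) \<noteq> 0"
    using LeastI[of "\<lambda>i. (\<Sum>j<dim_vec v. B i j * v $ j) \<noteq> 0", OF ne] v(1) by (simp add: pivot_def)
  show "pivot B v < d"
    using Least_le[of "\<lambda>i. (\<Sum>j<dim_vec v. B i j * v $ j) \<noteq> 0", OF ne] J(1) by (simp add: pivot_def)
  show "(\<Sum>j<d. B i j * v $ j) = 0" if "i < pivot B v" for i
    using not_less_Least[of i "\<lambda>i. (\<Sum>j<dim_vec v. B i j * v $ j) \<noteq> 0"] that v(1) by (simp add: pivot_def)
qed

lemma pivot_smult: "c \<noteq> 0 \<Longrightarrow> pivot B (c \<cdot>\<^sub>v v) = pivot B v"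
proof -
  assume c: "c \<noteq> 0"
  have "(\<Sum>j<dim_vec v. B i j * (c \<cdot>\<^sub>v v) $ j) = c * (\<Sum>j<dim_vec v. B i j * v $ j)" for i
    unfolding sum_distrib_left by (intro sum.cong) auto
  then show ?thesis using c by (simp add: pivot_def)
qed

text \<open>Among the vectors with nonzero coefficient in a linear relation the smallest pivot
  occurs twice: otherwise the row of \<open>B\<close> at that pivot would see exactly one term. Two
  equal pivots give two equal rows.\<close>

lemma pivot_det_dependent:
  assumes B: "upper_unitriangular B" and vs: "vs \<in> nonzero_tuples d d" and "dependent_tuple d vs"
  shows "pivot_det B vs = 0"
proof -
  have len: "length vs = d" using vs by (simp add: nonzero_tuples_def)
  note nth = nonzero_tuples_nth[OF vs]
  from assms(3) len obtain c where c: "c \<in> carrier_vec d" "c \<noteq> 0\<^sub>v d" "mat_of_cols d vs *\<^sub>v c = 0\<^sub>v d"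
    by (auto simp: dependent_tuple_def)
  have comb: "(\<Sum>i<d. c $ i * (\<Sum>j<d. B l j * vs ! i $ j)) = 0" for l
  proof -
    have "(\<Sum>i<d. c $ i * (\<Sum>j<d. B l j * vs ! i $ j)) = (\<Sum>j<d. B l j * (\<Sum>i<d. vs ! i $ j * c $ i))"
      unfolding sum_distrib_left by (subst sum.swap) (intro sum.cong refl, simp add: mult_ac)
    also have "(\<Sum>i<d. vs ! i $ j * c $ i) = (mat_of_cols d vs *\<^sub>v c) $ j" if "j < d" for j
      using that c(1) len by (simp add: scalar_prod_def mat_of_cols_def lessThan_atLeast0)
    then have "(\<Sum>j<d. B l j * (\<Sum>i<d. vs ! i $ j * c $ i)) = 0" using c(3) by (intro sum.neutral) auto
    finally show ?thesis .
  qed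
  let ?I = "{i. i < d \<and> c $ i \<noteq> 0}"
  have "?I \<noteq> {}" using c by (auto simp: vec_eq_iff)
  then obtain i where i: "i \<in> ?I" and min: "\<And>m. m \<in> ?I \<Longrightarrow> pivot B (vs ! i) \<le> pivot B (vs ! m)"
    using ex_has_least_nat[of "\<lambda>i. i \<in> ?I" _ "\<lambda>i. pivot B (vs ! i)"] by blast
  have "\<exists>m<d. m \<noteq> i \<and> pivot B (vs ! m) = pivot B (vs ! i)"
  proof (rule ccontr)
    assume neg: "\<not> ?thesis"
    let ?l = "pivot B (vs ! i)"
    have "c $ m * (\<Sum>j<d. B ?l j * vs ! m $ j) = 0" if "m < d" "m \<noteq> i" for m
    proof (cases "c $ m = 0")
      case False
      then have "?l < pivot B (vs ! m)" using min[of m] neg that by (metis (mono_tags, lifting) le_neq_implies_less mem_Collect_eq)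
      then show ?thesis using before_pivot[OF B] nth[OF that(1)] by simp
    qed simp
    then have "(\<Sum>m\<in>{..<d} - {i}. c $ m * (\<Sum>j<d. B ?l j * vs ! m $ j)) = 0"
      by (intro sum.neutral) blast
    then have "(\<Sum>m<d. c $ m * (\<Sum>j<d. B ?l j * vs ! m $ j)) = c $ i * (\<Sum>j<d. B ?l j * vs ! i $ j)"
      using i by (subst sum.remove[of "{..<d}" i "\<lambda>m. c $ m * (\<Sum>j<d. B ?l j * vs ! m $ j)"]) auto
    moreover have "c $ i * (\<Sum>j<d. B ?l j * vs ! i $ j) \<noteq> 0"
      using i pivot_nonzero[OF B] nth[of i] by simp
    ultimately show False using comb by simp
  qed
  then obtain m where "m < d" "m \<noteq> i" "pivot B (vs ! m) = pivot B (vs ! i)" by blast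
  then show ?thesis
    unfolding pivot_det_def using i len
    by (intro det_identical_rows[of _ d i m]) (auto intro!: eq_vecI)
qed

lemma pivot_det_swap:
  assumes "i < j" "j < length vs"
  shows "pivot_det B (vs[i := vs ! j, j := vs ! i]) = - pivot_det B vs"
proof -
  let ?n = "length vs"
  let ?M = "\<lambda>vs. mat ?n ?n (\<lambda>(i, j). of_bool (j = pivot B (vs ! i))) :: rat mat"
  have "?M (vs[i := vs ! j, j := vs ! i]) = swaprows i j (?M vs)"
    by (rule eq_matI) (use assms in \<open>auto simp: nth_list_update mat_swaprows_def\<close>)
  then show ?thesis
    unfolding pivot_det_def using assms by (simp add: det_swaprows[of i ?n j])
qed

lemma pivot_det_scale:
  assumes "c \<noteq> 0"
  shows "pivot_det B (vs[i := c \<cdot>\<^sub>v (vs ! i)]) = pivot_det B vs"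
proof -
  have "pivot B (vs[i := c \<cdot>\<^sub>v (vs ! i)] ! k) = pivot B (vs ! k)" for k
    using pivot_smult[OF assms]
    by (cases "i < length vs"; cases "k = i") (auto simp: list_update_beyond)
  then show ?thesis by (simp add: pivot_det_def)
qed

text \<open>The sum is the expansion of a determinant whose first column consists of ones and hence is
  the sum of the other columns.\<close>

lemma pivot_det_alternating_sum:
  assumes B: "upper_unitriangular B" and ws: "ws \<in> nonzero_tuples d (Suc d)"
  shows "(\<Sum>i\<le>d. (-1) ^ i * pivot_det B (take i ws @ drop (Suc i) ws)) = 0"
proof -
  have len: "length ws = Suc d" using ws by (simp add: nonzero_tuples_def)
  define N :: "rat mat" where "N = mat (Suc d) (Suc d) (\<lambda>(i, j). if j = 0 then 1 else of_bool (j - 1 = pivot B (ws ! i)))"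
  have N: "N \<in> carrier_mat (Suc d) (Suc d)" by (simp add: N_def)
  define c :: "rat vec" where "c = vec (Suc d) (\<lambda>j. if j = 0 then 1 else - 1)"
  have c: "c \<in> carrier_vec (Suc d)" "c \<noteq> 0\<^sub>v (Suc d)" by (auto simp: c_def vec_eq_iff)
  have "N *\<^sub>v c = 0\<^sub>v (Suc d)"
  proof (rule eq_vecI)
    fix i assume "i < dim_vec (0\<^sub>v (Suc d) :: rat vec)"
    then have i: "i < Suc d" by simp
    have p: "pivot B (ws ! i) < d" using pivot_less[OF B] nonzero_tuples_nth[OF ws i] by blast
    have "(N *\<^sub>v c) $ i = (\<Sum>j<Suc d. N $$ (i, j) * c $ j)"
      using i N c(1) by (simp add: scalar_prod_def lessThan_atLeast0 del: sum.op_ivl_Suc)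
    also have "\<dots> = 1 - (\<Sum>j<d. of_bool (j = pivot B (ws ! i)))"
      unfolding sum.lessThan_Suc_shift using i by (simp add: N_def c_def sum_negf)
    also have "\<dots> = 0" using p by (simp add: of_bool_def)
    finally show "(N *\<^sub>v c) $ i = 0\<^sub>v (Suc d) $ i" using i by simp
  qed (use N in auto)
  then have "det N = 0" using c N by (subst det_0_iff_vec_prod_zero[OF N]) auto
  moreover have "det N = (\<Sum>i<Suc d. N $$ (i, 0) * cofactor N i 0)"
    by (rule laplace_expansion_column[OF N]) simp
  moreover have "N $$ (i, 0) * cofactor N i 0 = (-1) ^ i * pivot_det B (take i ws @ drop (Suc i) ws)" if "i < Suc d" for i
  proof -
    have "mat_delete N i 0 = mat d d (\<lambda>(k, j). of_bool (j = pivot B ((take i ws @ drop (Suc i) ws) ! k)))"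
      by (rule eq_matI) (use that len in \<open>auto simp: mat_delete_def N_def nth_append\<close>)
    moreover have "length (take i ws @ drop (Suc i) ws) = d" using that len by simp
    moreover have "N $$ (i, 0) = 1" using that by (simp add: N_def)
    ultimately show ?thesis by (simp only: cofactor_def pivot_det_def) simp
  qed
  ultimately show ?thesis by (simp add: lessThan_Suc_atMost)
qed

section \<open>Flags separate the elements of the Steinberg module\<close>

definition flag_functional :: "(nat \<Rightarrow> nat \<Rightarrow> rat) \<Rightarrow> (rat vec list \<Rightarrow>\<^sub>0 rat) \<Rightarrow> rat" where
  "flag_functional B = lin_ext (\<lambda>r. r) (pivot_det B)"

lemma flag_functional_simps:
  "flag_functional B (x + y) = flag_functional B x + flag_functional B y"
  "flag_functional B (x - y) = flag_functional B x - flag_functional B y"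
  "flag_functional B (Poly_Mapping.single vs c) = c * pivot_det B vs"
  "flag_functional B (\<Sum>i\<in>I. f i) = (\<Sum>i\<in>I. flag_functional B (f i))"
  "flag_functional B 0 = 0"
  by (simp_all add: flag_functional_def lin_ext_add lin_ext_diff lin_ext_single lin_ext_sum)

lemma flag_functional_steinberg:
  assumes B: "upper_unitriangular B" and x: "x \<in> steinberg_relations d"
  shows "flag_functional B x = 0"
proof -
  let ?V = "{x. flag_functional B x = 0}"
  have "rat_closed ?V"
    by (auto simp: rat_closed_def flag_functional_simps lin_ext_scale flag_functional_def lin_ext_add)
  moreover have "steinberg_generators d \<subseteq> ?V"
    unfolding steinberg_generators_def
    using pivot_det_dependent[OF B] pivot_det_alternating_sum[OF B]
    by (auto simp: flag_functional_simps pivot_det_scale pivot_det_swap nonzero_tuples_def)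
  ultimately show ?thesis using steinberg_relations_minimal x by blast
qed

text \<open>\<open>B\<close> is the inverse of the matrix with columns \<open>u\<close>, so it sends
  \<open>u ! i\<close> to the unit vector \<open>i\<close>. For any unitriangular frame
  \<open>pivot B (us ! i) \<le> i\<close>, so the matrix of pivots is triangular, and a nonzero
  determinant puts every pivot on the diagonal. Then \<open>B\<close> sends \<open>us ! i\<close> to
  the same unit vector, which forces \<open>us = u\<close>.\<close>

lemma exists_dual_flag:
  assumes u: "unitriangular d u"
  obtains B where "upper_unitriangular B"
    and "\<And>us. unitriangular d us \<Longrightarrow> pivot_det B us = of_bool (us = u)"
proof -
  have ut: "u \<in> nonzero_tuples d d" and len: "length u = d" using u by (auto simp: unitriangular_def nonzero_tuples_def)
  let ?U = "mat_of_cols d u"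
  have U: "?U \<in> carrier_mat d d" using len by auto
  have U_ij: "?U $$ (i, j) = (if i = j then 1 else 0)" if "i < d" "j \<le> i" for i j
    using that u len by (auto simp: unitriangular_def mat_of_cols_def)
  have "det ?U = prod_list (diag_mat ?U)"
    by (rule det_upper_triangular[OF _ U]) (use U_ij U in \<open>auto simp: upper_triangular_def\<close>)
  also have "\<dots> = 1"
    using U U_ij by (auto simp: diag_mat_def prod.list_conv_set_nth intro!: prod.neutral)
  finally have "det ?U = 1" .
  define C where "C = adj_mat ?U"
  have C: "C \<in> carrier_mat d d" "C * ?U = 1\<^sub>m d" "?U * C = 1\<^sub>m d"
    using adj_mat[OF U] \<open>det ?U = 1\<close> by (auto simp: C_def)
  have CU: "(\<Sum>k<d. C $$ (i, k) * u ! j $ k) = (if i = j then 1 else 0)" if "i < d" "j < d" for i j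
  proof -
    have "(C * ?U) $$ (i, j) = (\<Sum>k<d. C $$ (i, k) * u ! j $ k)"
      using that C(1) U len by (simp add: scalar_prod_def lessThan_atLeast0 mat_of_cols_def)
    then show ?thesis using C(2) that by simp
  qed
  \<comment> \<open>Forward substitution in \<open>C * ?U = 1\<close>, column by column; the
    diagonal entries of \<open>?U\<close> are 1.\<close>
  have C_tri: "C $$ (i, j) = (if i = j then 1 else 0)" if "i < d" "j \<le> i" for i j
    using that
  proof (induction j rule: less_induct)
    case (less j)
    have "C $$ (i, k) * u ! j $ k = (if k = j then C $$ (i, j) else 0)" if "k < d" for k
      using that less u by (cases k j rule: linorder_cases) (auto simp: unitriangular_def)
    then have "(\<Sum>k<d. C $$ (i, k) * u ! j $ k) = C $$ (i, j)"
      using less.prems by simp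
    then show ?case using CU[of i j] less.prems by simp
  qed
  \<comment> \<open>The identity outside the first \<open>d\<close> rows and columns completes the
    inverse to an infinite upper unitriangular matrix.\<close>
  define B where "B i j = (if i < d \<and> j < d then C $$ (i, j) else of_bool (i = j))" for i j
  have B: "upper_unitriangular B"
    using C_tri by (auto simp: upper_unitriangular_def B_def)
  moreover have "pivot_det B us = of_bool (us = u)" if us: "unitriangular d us" for us
  proof -
    have ust: "us \<in> nonzero_tuples d d" and ulen: "length us = d" using us by (auto simp: unitriangular_def nonzero_tuples_def)
    note nth = nonzero_tuples_nth[OF ust]
    have le: "pivot B (us ! i) \<le> i" if "i < d" for i
    proof (rule ccontr)
      assume "\<not> ?thesis"
      then have "(\<Sum>j<d. B i j * us ! i $ j) = 0" using before_pivot[OF B] nth[OF that] by simp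
      moreover have "B i j * us ! i $ j = (if j = i then 1 else 0)" if "j < d" for j
        using that us B \<open>i < d\<close> by (cases j i rule: linorder_cases) (auto simp: unitriangular_def upper_unitriangular_def)
      ultimately show False using that by simp
    qed
    have "pivot_det B us = prod_list (diag_mat (mat d d (\<lambda>(i, j). of_bool (j = pivot B (us ! i)))))"
      unfolding pivot_det_def ulen
    proof (rule det_lower_triangular[of d])
      fix i j assume "i < j" "j < d"
      then show "mat d d (\<lambda>(i, j). of_bool (j = pivot B (us ! i))) $$ (i, j) = (0 :: rat)"
        using le[of i] by simp
    qed simp
    also have "\<dots> = (\<Prod>i<d. of_bool (i = pivot B (us ! i)))"
      by (simp add: diag_mat_def prod.list_conv_set_nth lessThan_atLeast0)
    also have "\<dots> = of_bool (\<forall>i<d. pivot B (us ! i) = i)"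
    proof (cases "\<forall>i<d. pivot B (us ! i) = i")
      case False
      then have "(\<Prod>i<d. of_bool (i = pivot B (us ! i)) :: rat) = 0"
        by (intro prod_zero) force+
      then show ?thesis using False by simp
    qed simp
    also have "(\<forall>i<d. pivot B (us ! i) = i) \<longleftrightarrow> us = u"
    proof
      assume piv: "\<forall>i<d. pivot B (us ! i) = i"
      show "us = u"
      proof (rule nth_equalityI)
        fix i assume "i < length us"
        then have i: "i < d" using ulen by simp
        have ui: "us ! i \<in> carrier_vec d" using nth[OF i] by simp
        have "C *\<^sub>v (us ! i) = unit_vec d i"
        proof (rule eq_vecI)
          fix l assume "l < dim_vec (unit_vec d i :: rat vec)"
          then have l: "l < d" by simp
          have eq: "(C *\<^sub>v (us ! i)) $ l = (\<Sum>j<d. B l j * us ! i $ j)"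
            using l C(1) ui by (simp add: scalar_prod_def lessThan_atLeast0 B_def)
          \<comment> \<open>Coordinates before \<open>i\<close> vanish because the pivot is
            \<open>i\<close>, the remaining ones are settled by the triangular shapes of
            \<open>B\<close> and \<open>us\<close>.\<close>
          show "(C *\<^sub>v (us ! i)) $ l = unit_vec d i $ l"
          proof (cases l i rule: linorder_cases)
            case less
            then show ?thesis using before_pivot[OF B, of "us ! i" d l] nth[OF i] piv i l eq by simp
          next
            case equal
            have "B i j * us ! i $ j = (if j = i then 1 else 0)" if "j < d" for j
              using that us B i by (cases j i rule: linorder_cases) (auto simp: unitriangular_def upper_unitriangular_def)
            then show ?thesis using equal eq i by simp
          next
            case greater
            have "B l j * us ! i $ j = 0" if "j < d" for j
              using that us B i greater by (cases "j < l") (auto simp: unitriangular_def upper_unitriangular_def)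
            then have "(\<Sum>j<d. B l j * us ! i $ j) = 0" by (intro sum.neutral) blast
            then show ?thesis using greater eq i l by simp
          qed
        qed (use C in auto)
        then have "(?U * C) *\<^sub>v (us ! i) = ?U *\<^sub>v unit_vec d i"
          using assoc_mult_mat_vec[OF U C(1) ui] by simp
        then have "us ! i = ?U *\<^sub>v unit_vec d i" using C(3) ui by simp
        also have "\<dots> = col ?U i" using U i by (intro eq_vecI) auto
        also have "\<dots> = u ! i" using i len nonzero_tuples_nth[OF ut i] by simp
        finally show "us ! i = u ! i" .
      qed (use len ulen in simp)
    next
      assume "us = u"
      show "\<forall>i<d. pivot B (us ! i) = i"
      proof (intro allI impI)
        fix i assume i: "i < d"
        have "(\<Sum>j<d. B (pivot B (us ! i)) j * us ! i $ j) \<noteq> 0"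
          using pivot_nonzero[OF B] nth[OF i] by blast
        moreover have p: "pivot B (us ! i) < d" using pivot_less[OF B] nth[OF i] by blast
        ultimately show "pivot B (us ! i) = i"
          using CU[OF p i] \<open>us = u\<close> by (auto simp: B_def split: if_splits)
      qed
    qed
    finally show ?thesis .
  qed
  ultimately show ?thesis using that by blast
qed

text \<open>Modulo relations \<open>x\<close> is a combination \<open>y\<close> of unitriangular
  tuples, and the flag dual to a tuple \<open>u\<close> reads off the coefficient of
  \<open>u\<close> in \<open>y\<close>.\<close>

lemma in_steinberg_relations_if_flag_functionals_zero:
  assumes x: "Poly_Mapping.keys x \<subseteq> nonzero_tuples d d"
    and zero: "\<And>B. upper_unitriangular B \<Longrightarrow> flag_functional B x = 0"
  shows "x \<in> steinberg_relations d"
proof -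
  note R = rat_closedD[OF rat_closed_steinberg[of d]]
  let ?V = "{z. \<exists>y. (\<forall>u\<in>Poly_Mapping.keys y. unitriangular d u) \<and> z - y \<in> steinberg_relations d}"
  have V: "rat_closed ?V"
    unfolding rat_closed_def
  proof (intro conjI ballI allI)
    show "0 \<in> ?V" using R(1) by (auto intro!: exI[of _ 0])
  next
    fix z z' assume "z \<in> ?V" "z' \<in> ?V"
    then obtain y y' where *: "\<forall>u\<in>Poly_Mapping.keys y. unitriangular d u" "z - y \<in> steinberg_relations d"
      "\<forall>u\<in>Poly_Mapping.keys y'. unitriangular d u" "z' - y' \<in> steinberg_relations d" by blast
    have "z + z' - (y + y') \<in> steinberg_relations d"
      using R(2)[OF *(2,4)] by (simp add: algebra_simps)
    then show "z + z' \<in> ?V" using * keys_add[of y y'] by blast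
  next
    fix r z assume "z \<in> ?V"
    then obtain y where *: "\<forall>u\<in>Poly_Mapping.keys y. unitriangular d u" "z - y \<in> steinberg_relations d" by blast
    have "Poly_Mapping.map ((*) r) z - Poly_Mapping.map ((*) r) y \<in> steinberg_relations d"
      using R(3)[OF *(2), of r] by (simp add: scale_diff)
    then show "Poly_Mapping.map ((*) r) z \<in> ?V" using * keys_scale[of r y] by blast
  qed
  have "steinberg_relations d \<subseteq> ?V" by (auto intro!: exI[of _ 0])
  moreover have "Poly_Mapping.single u 1 \<in> ?V" if "unitriangular d u" for u
    using that R(1) by (auto intro!: exI[of _ "Poly_Mapping.single u 1"])
  ultimately have "x \<in> ?V"
    using tuple_in_unitriangular_span[OF V] by (intro rat_closed_singles[OF V _ x]) blast
  then obtain y where y: "\<And>u. u \<in> Poly_Mapping.keys y \<Longrightarrow> unitriangular d u" and xy: "x - y \<in> steinberg_relations d"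
    by blast
  have "y = 0"
  proof (rule ccontr)
    assume "y \<noteq> 0"
    then obtain u where u: "u \<in> Poly_Mapping.keys y" by (metis keys_eq_empty ex_in_conv)
    from exists_dual_flag[OF y[OF u]] obtain B where B: "upper_unitriangular B"
      and dual: "\<And>us. unitriangular d us \<Longrightarrow> pivot_det B us = of_bool (us = u)" by blast
    have "flag_functional B x - flag_functional B y = 0"
      using flag_functional_steinberg[OF B xy] by (simp add: flag_functional_simps)
    then have "flag_functional B y = 0" using zero[OF B] by simp
    moreover have "flag_functional B y = (\<Sum>us\<in>Poly_Mapping.keys y. if us = u then Poly_Mapping.lookup y u else 0)"
      unfolding flag_functional_def lin_ext_def by (intro sum.cong refl) (use y dual in auto)
    ultimately show False using u by (simp add: in_keys_iff)
  qed
  then show ?thesis using xy by simp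
qed

section \<open>Functionals on Milnor K-theory\<close>

definition concat_mult :: "('a list \<Rightarrow>\<^sub>0 int) \<Rightarrow> ('a list \<Rightarrow>\<^sub>0 int) \<Rightarrow> 'a list \<Rightarrow>\<^sub>0 int" where
  "concat_mult p q = frag_extend (\<lambda>u. frag_extend (\<lambda>v. frag_of (u @ v)) q) p"

lemma frag_extend_fun_diff:
  fixes f g :: "'a \<Rightarrow> 'b \<Rightarrow>\<^sub>0 int"
  shows "frag_extend (\<lambda>x. f x - g x) p = frag_extend f p - frag_extend g p"
proof -
  have "frag_cmul c (a - b) = frag_cmul c a - frag_cmul c b" for c and a b :: "'b \<Rightarrow>\<^sub>0 int"
    by (rule poly_mapping_eqI) (simp add: lookup_minus algebra_simps)
  then show ?thesis by (simp add: frag_extend_def sum_subtractf)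
qed

lemma concat_mult_simps:
  "concat_mult (frag_of u) (frag_of v) = frag_of (u @ v)"
  "concat_mult (p - p') q = concat_mult p q - concat_mult p' q"
  "concat_mult p (q - q') = concat_mult p q - concat_mult p q'"
  "concat_mult 0 q = 0" "concat_mult p 0 = 0"
  by (simp_all add: concat_mult_def frag_extend_diff frag_extend_fun_diff frag_extend_eq_0)

lemma concat_mult_minus: "concat_mult (- p) q = - concat_mult p q" "concat_mult p (- q) = - concat_mult p q"
  using concat_mult_simps(2)[of 0 p q] concat_mult_simps(3)[of p 0 q] by (simp_all add: concat_mult_simps)

lemma concat_mult_add:
  "concat_mult (p + p') q = concat_mult p q + concat_mult p' q"
  "concat_mult p (q + q') = concat_mult p q + concat_mult p q'"
  using concat_mult_simps(2)[of p "- p'" q] concat_mult_simps(3)[of p q "- q'"]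
  by (simp_all add: concat_mult_minus)

lemma keys_concat_mult:
  assumes "Poly_Mapping.keys p \<subseteq> lists S" "Poly_Mapping.keys q \<subseteq> lists S"
  shows "Poly_Mapping.keys (concat_mult p q) \<subseteq> lists S"
proof -
  have "Poly_Mapping.keys (frag_extend (\<lambda>v. frag_of (u @ v)) q) \<subseteq> lists S" if "u \<in> lists S" for u
    using keys_frag_extend[of "\<lambda>v. frag_of (u @ v)" q] that assms(2) by fastforce
  then show ?thesis
    unfolding concat_mult_def using keys_frag_extend assms(1) by fastforce
qed

lemma concat_mult_assoc: "concat_mult (concat_mult p q) r = concat_mult p (concat_mult q r)"
proof (induction p rule: frag_induction[OF subset_UNIV])
  case (2 u)
  show ?case
  proof (induction q rule: frag_induction[OF subset_UNIV])
    case (2 v)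
    show ?case
      by (induction r rule: frag_induction[OF subset_UNIV]) (simp_all add: concat_mult_simps)
  qed (simp_all add: concat_mult_simps)
qed (simp_all add: concat_mult_simps)

lemma concat_mult_one: "concat_mult (frag_of []) p = p" "concat_mult p (frag_of []) = p"
  by (induction p rule: frag_induction[OF subset_UNIV]) (simp_all add: concat_mult_simps)

lemma free_ring_simps [simp]:
  "carrier (free_ring S) = {p. Poly_Mapping.keys p \<subseteq> lists S}"
  "p \<otimes>\<^bsub>free_ring S\<^esub> q = concat_mult p q"
  "\<one>\<^bsub>free_ring S\<^esub> = frag_of []"
  "\<zero>\<^bsub>free_ring S\<^esub> = 0"
  "p \<oplus>\<^bsub>free_ring S\<^esub> q = p + q"
  by (simp_all add: free_ring_def concat_mult_def)

lemma ring_free_ring: "ring (free_ring S)"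
proof (rule ringI)
  show "abelian_group (free_ring S)"
  proof (rule abelian_groupI)
    fix x y assume "x \<in> carrier (free_ring S)" "y \<in> carrier (free_ring S)"
    then show "x \<oplus>\<^bsub>free_ring S\<^esub> y \<in> carrier (free_ring S)"
      using keys_add[of x y] by auto
  next
    fix x assume "x \<in> carrier (free_ring S)"
    then show "\<exists>y\<in>carrier (free_ring S). y \<oplus>\<^bsub>free_ring S\<^esub> x = \<zero>\<^bsub>free_ring S\<^esub>"
      by (intro bexI[of _ "- x"]) auto
  qed (simp_all add: ac_simps)
  show "Group.monoid (free_ring S)"
    by (rule monoidI) (simp_all add: keys_concat_mult concat_mult_assoc concat_mult_one)
qed (simp_all add: concat_mult_add)

lemma a_inv_free_ring:
  assumes "p \<in> carrier (free_ring S)"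
  shows "\<ominus>\<^bsub>free_ring S\<^esub> p = - p"
proof -
  interpret ring "free_ring S" by (rule ring_free_ring)
  show ?thesis using assms by (intro minus_equality) auto
qed

section \<open>Functionals on words and the ideals they annihilate\<close>

definition word_functional :: "('a list \<Rightarrow> rat) \<Rightarrow> ('a list \<Rightarrow>\<^sub>0 int) \<Rightarrow> rat" where
  "word_functional \<delta> = lin_ext of_int \<delta>"

lemma word_functional_simps:
  "word_functional \<delta> (p + q) = word_functional \<delta> p + word_functional \<delta> q"
  "word_functional \<delta> (p - q) = word_functional \<delta> p - word_functional \<delta> q"
  "word_functional \<delta> (frag_of w) = \<delta> w"
  "word_functional \<delta> 0 = 0"
  by (simp_all add: word_functional_def lin_ext_add lin_ext_diff lin_ext_single)

lemma word_functional_minus: "word_functional \<delta> (- p) = - word_functional \<delta> p"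
  using word_functional_simps(2)[of \<delta> 0 p] by (simp add: word_functional_simps)

text \<open>The largest two-sided ideal contained in the kernel of a functional on words.\<close>

definition kernel_ideal :: "'a set \<Rightarrow> ('a list \<Rightarrow> rat) \<Rightarrow> ('a list \<Rightarrow>\<^sub>0 int) set" where
  "kernel_ideal S \<delta> = {p \<in> carrier (free_ring S).
     \<forall>u\<in>lists S. \<forall>v\<in>lists S. word_functional \<delta> (concat_mult (frag_of u) (concat_mult p (frag_of v))) = 0}"

lemma kernel_ideal_functional: "p \<in> kernel_ideal S \<delta> \<Longrightarrow> word_functional \<delta> p = 0"
proof -
  assume "p \<in> kernel_ideal S \<delta>"
  then have "word_functional \<delta> (concat_mult (frag_of []) (concat_mult p (frag_of []))) = 0"
    unfolding kernel_ideal_def by blast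
  then show ?thesis by (simp add: concat_mult_one)
qed

text \<open>Multiplication by a word merely lengthens the context \<open>u\<close> or
  \<open>v\<close>, and every element is an integral combination of words.\<close>

lemma ideal_kernel_ideal: "ideal (kernel_ideal S \<delta>) (free_ring S)"
proof (rule idealI[OF ring_free_ring])
  interpret ring "free_ring S" by (rule ring_free_ring)
  show "subgroup (kernel_ideal S \<delta>) (add_monoid (free_ring S))"
  proof (rule add.subgroupI)
    show "kernel_ideal S \<delta> \<subseteq> carrier (free_ring S)" by (auto simp: kernel_ideal_def)
    have "0 \<in> kernel_ideal S \<delta>"
      by (simp add: kernel_ideal_def concat_mult_simps word_functional_simps)
    then show "kernel_ideal S \<delta> \<noteq> {}" by blast
    show "\<ominus>\<^bsub>free_ring S\<^esub> a \<in> kernel_ideal S \<delta>" if "a \<in> kernel_ideal S \<delta>" for a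
      using that by (auto simp: kernel_ideal_def a_inv_free_ring concat_mult_minus word_functional_minus)
    show "a \<oplus>\<^bsub>free_ring S\<^esub> b \<in> kernel_ideal S \<delta>" if "a \<in> kernel_ideal S \<delta>" "b \<in> kernel_ideal S \<delta>" for a b
      using that add.m_closed[of a b]
      by (auto simp: kernel_ideal_def concat_mult_add word_functional_simps)
  qed
  fix a x assume a: "a \<in> kernel_ideal S \<delta>" and x: "x \<in> carrier (free_ring S)"
  have carr: "a \<in> carrier (free_ring S)" using a by (simp add: kernel_ideal_def)
  have xk: "Poly_Mapping.keys x \<subseteq> lists S" using x by simp
  have "word_functional \<delta> (concat_mult (frag_of u) (concat_mult (concat_mult x a) (frag_of v))) = 0"
    if "u \<in> lists S" "v \<in> lists S" for u v
    using xk
  proof (induction x rule: frag_induction)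
    case (one w)
    have "u @ w \<in> lists S" using that one by simp
    then have "word_functional \<delta> (concat_mult (frag_of (u @ w)) (concat_mult a (frag_of v))) = 0"
      using a that by (simp add: kernel_ideal_def)
    then show ?case by (simp add: concat_mult_assoc flip: concat_mult_simps(1))
  qed (simp_all add: concat_mult_simps word_functional_simps)
  then show "x \<otimes>\<^bsub>free_ring S\<^esub> a \<in> kernel_ideal S \<delta>"
    using m_closed[OF x carr] by (simp add: kernel_ideal_def)
  have "word_functional \<delta> (concat_mult (frag_of u) (concat_mult (concat_mult a x) (frag_of v))) = 0"
    if "u \<in> lists S" "v \<in> lists S" for u v
    using xk
  proof (induction x rule: frag_induction)
    case (one w)
    have "w @ v \<in> lists S" using that one by simp
    then have "word_functional \<delta> (concat_mult (frag_of u) (concat_mult a (frag_of (w @ v)))) = 0"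
      using a that by (simp add: kernel_ideal_def)
    then show ?case by (simp add: concat_mult_assoc flip: concat_mult_simps(1))
  qed (simp_all add: concat_mult_simps word_functional_simps)
  then show "a \<otimes>\<^bsub>free_ring S\<^esub> x \<in> kernel_ideal S \<delta>"
    using m_closed[OF carr x] by (simp add: kernel_ideal_def)
qed

text \<open>The context words \<open>u\<close> and \<open>v\<close> appear because the tensor and
  Milnor relations generate two-sided ideals. Characters are required only at the end of a word,
  where multiplication from the right puts them.\<close>

locale milnor_functional = ring F for F :: "('a, 'b) ring_scheme" (structure) +
  fixes L :: "'a set" and n :: nat and \<delta> :: "'a list \<Rightarrow> rat"
  assumes chars: "L \<subseteq> Units F"
    and word_mult: "\<And>u v a b. u \<in> lists (Units F) \<Longrightarrow> v \<in> lists (Units F) \<Longrightarrow> a \<in> Units F \<Longrightarrow> b \<in> Units F \<Longrightarrow>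
       \<delta> (u @ [a \<otimes> b] @ v) = \<delta> (u @ [a] @ v) + \<delta> (u @ [b] @ v)"
    and word_steinberg: "\<And>u v a. u \<in> lists (Units F) \<Longrightarrow> v \<in> lists (Units F) \<Longrightarrow> a \<in> Units F \<Longrightarrow> \<one> \<ominus> a \<in> Units F \<Longrightarrow>
       \<delta> (u @ [a, \<one> \<ominus> a] @ v) = 0"
    and word_char: "\<And>u \<chi>. u \<in> lists (Units F) \<Longrightarrow> \<chi> \<in> L \<Longrightarrow> \<delta> (u @ [\<chi>]) = 0"
begin

abbreviation words :: "('a list \<Rightarrow>\<^sub>0 int) ring" where
  "words \<equiv> free_ring (Units F)"

abbreviation J :: "('a list \<Rightarrow>\<^sub>0 int) set" where
  "J \<equiv> tensor_algebra_ideal (units_of F)"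

abbreviation T :: "('a list \<Rightarrow>\<^sub>0 int) set ring" where
  "T \<equiv> tensor_algebra (units_of F)"

definition proj :: "('a list \<Rightarrow>\<^sub>0 int) \<Rightarrow> ('a list \<Rightarrow>\<^sub>0 int) set set" where
  "proj p = milnor_ideal F +>\<^bsub>T\<^esub> (J +>\<^bsub>words\<^esub> p)"

lemma units: "carrier (units_of F) = Units F" "monoid.mult (units_of F) = monoid.mult F"
  by (simp_all add: units_of_def)

lemma J_eq: "J = genideal words {frag_of [a \<otimes> b] - frag_of [a] - frag_of [b] |a b. a \<in> Units F \<and> b \<in> Units F}"
  by (simp add: tensor_algebra_ideal_def units)

lemma keys_diff_subset: "Poly_Mapping.keys p \<subseteq> W \<Longrightarrow> Poly_Mapping.keys q \<subseteq> W \<Longrightarrow> Poly_Mapping.keys (p - q) \<subseteq> W"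
  for p q :: "'c \<Rightarrow>\<^sub>0 int"
  using keys_diff[of p q] by blast

lemma J_generators: "{frag_of [a \<otimes> b] - frag_of [a] - frag_of [b] |a b. a \<in> Units F \<and> b \<in> Units F} \<subseteq> carrier words"
proof (rule subsetI, clarify)
  fix a b assume "a \<in> Units F" "b \<in> Units F"
  then show "frag_of [a \<otimes> b] - frag_of [a] - frag_of [b] \<in> carrier words"
    unfolding free_ring_simps mem_Collect_eq by (intro keys_diff_subset) auto
qed

lemma ideal_J: "ideal J words"
  unfolding J_eq by (rule ring.genideal_ideal[OF ring_free_ring J_generators])

lemma J_subset: "J \<subseteq> kernel_ideal (Units F) \<delta>"
  unfolding J_eq
proof (rule ring.genideal_minimal[OF ring_free_ring ideal_kernel_ideal], rule subsetI)
  fix x assume x: "x \<in> {frag_of [a \<otimes> b] - frag_of [a] - frag_of [b] |a b. a \<in> Units F \<and> b \<in> Units F}"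
  then obtain a b where ab: "x = frag_of [a \<otimes> b] - frag_of [a] - frag_of [b]" "a \<in> Units F" "b \<in> Units F" by blast
  have "word_functional \<delta> (concat_mult (frag_of u) (concat_mult x (frag_of v))) = 0"
    if "u \<in> lists (Units F)" "v \<in> lists (Units F)" for u v
    using word_mult[OF that ab(2,3)] by (simp add: ab(1) concat_mult_simps word_functional_simps)
  then show "x \<in> kernel_ideal (Units F) \<delta>" using x J_generators unfolding kernel_ideal_def by blast
qed

lemma T_eq: "T = words Quot J"
  by (simp add: tensor_algebra_def units)

lemma ring_T: "ring T"
  unfolding T_eq by (rule ideal.quotient_is_ring[OF ideal_J])

lemma ring_hom_T: "ring_hom_ring words T (\<lambda>p. J +>\<^bsub>words\<^esub> p)"
  unfolding T_eq by (rule ideal.rcos_ring_hom_ring[OF ideal_J])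

lemmas T_simps = ring_hom_ring.homh[OF ring_hom_T, THEN Ring.ring_hom_one]
  ring_hom_ring.homh[OF ring_hom_T, THEN Ring.ring_hom_mult]
  ring_hom_ring.homh[OF ring_hom_T, THEN Ring.ring_hom_closed]

lemma pure_tensor_eq: "as \<in> lists (Units F) \<Longrightarrow> pure_tensor (units_of F) as = J +>\<^bsub>words\<^esub> frag_of as"
proof (induction as)
  case Nil
  show ?case using T_simps(1) by (simp add: pure_tensor_def)
next
  case (Cons a as)
  then have "pure_tensor (units_of F) (a # as) = (J +>\<^bsub>words\<^esub> frag_of [a]) \<otimes>\<^bsub>T\<^esub> (J +>\<^bsub>words\<^esub> frag_of as)"
    by (simp add: pure_tensor_def tensor_gen_def units)
  also have "\<dots> = J +>\<^bsub>words\<^esub> (frag_of [a] \<otimes>\<^bsub>words\<^esub> frag_of as)"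
    using Cons.prems by (subst T_simps(2)) auto
  finally show ?case by (simp add: concat_mult_simps)
qed

lemma milnor_ideal_eq:
  "milnor_ideal F = genideal T {J +>\<^bsub>words\<^esub> frag_of [a, \<one> \<ominus> a] |a. a \<in> Units F \<and> \<one> \<ominus> a \<in> Units F}"
  unfolding milnor_ideal_def
  by (intro arg_cong[of _ _ "genideal T"] Collect_cong ex_cong1) (auto simp: pure_tensor_eq)

lemma milnor_generators: "{J +>\<^bsub>words\<^esub> frag_of [a, \<one> \<ominus> a] |a. a \<in> Units F \<and> \<one> \<ominus> a \<in> Units F} \<subseteq> carrier T"
  by (rule subsetI, clarify, rule T_simps(3)) auto

lemma ideal_milnor: "ideal (milnor_ideal F) T"
  unfolding milnor_ideal_eq by (rule ring.genideal_ideal[OF ring_T milnor_generators])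

text \<open>The Milnor ideal consists of cosets, so it cannot be compared with
  \<open>kernel_ideal\<close> directly. But the image of an ideal under the quotient map is an
  ideal, and this one contains the Steinberg elements.\<close>

lemma milnor_ideal_subset: "milnor_ideal F \<subseteq> (\<lambda>p. J +>\<^bsub>words\<^esub> p) ` kernel_ideal (Units F) \<delta>"
  unfolding milnor_ideal_eq
proof (rule ring.genideal_minimal[OF ring_T])
  show "ideal ((\<lambda>p. J +>\<^bsub>words\<^esub> p) ` kernel_ideal (Units F) \<delta>) T"
    unfolding T_eq by (rule ring.ring_ideal_imp_quot_ideal[OF ring_free_ring ideal_J ideal_kernel_ideal])
  have "frag_of [a, \<one> \<ominus> a] \<in> kernel_ideal (Units F) \<delta>" if "a \<in> Units F" "\<one> \<ominus> a \<in> Units F" for a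
    using that word_steinberg[OF _ _ that] by (simp add: kernel_ideal_def concat_mult_simps word_functional_simps)
  then show "{J +>\<^bsub>words\<^esub> frag_of [a, \<one> \<ominus> a] |a. a \<in> Units F \<and> \<one> \<ominus> a \<in> Units F}
      \<subseteq> (\<lambda>p. J +>\<^bsub>words\<^esub> p) ` kernel_ideal (Units F) \<delta>" by blast
qed

lemma ring_M: "ring (milnor_ring F)"
  unfolding milnor_ring_def by (rule ideal.quotient_is_ring[OF ideal_milnor])

lemma proj_hom: "proj \<in> Ring.ring_hom words (milnor_ring F)"
proof -
  have "(\<lambda>C. milnor_ideal F +>\<^bsub>T\<^esub> C) \<circ> (\<lambda>p. J +>\<^bsub>words\<^esub> p) \<in> Ring.ring_hom words (milnor_ring F)"
    using ring_hom_ring.homh[OF ring_hom_T] ideal.rcos_ring_hom[OF ideal_milnor] unfolding milnor_ring_def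
    by (rule ring_hom_trans)
  moreover have "(\<lambda>C. milnor_ideal F +>\<^bsub>T\<^esub> C) \<circ> (\<lambda>p. J +>\<^bsub>words\<^esub> p) = proj"
    by (simp add: fun_eq_iff proj_def)
  ultimately show ?thesis by simp
qed

lemmas proj_simps = Ring.ring_hom_add[OF proj_hom] Ring.ring_hom_mult[OF proj_hom]
  Ring.ring_hom_closed[OF proj_hom]

lemma proj_surj: "Z \<in> carrier (milnor_ring F) \<Longrightarrow> \<exists>p\<in>carrier words. Z = proj p"
proof -
  assume "Z \<in> carrier (milnor_ring F)"
  then obtain C where "C \<in> carrier T" "Z = milnor_ideal F +>\<^bsub>T\<^esub> C"
    by (auto simp: milnor_ring_def FactRing_def A_RCOSETS_def')
  moreover then obtain p where "p \<in> carrier words" "C = J +>\<^bsub>words\<^esub> p"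
    unfolding T_eq by (auto simp: FactRing_def A_RCOSETS_def' simp del: free_ring_simps)
  ultimately show ?thesis by (auto simp: proj_def simp del: free_ring_simps)
qed

text \<open>The two quotients are undone in turn: equality in the Milnor ring makes
  \<open>p - p'\<close> congruent modulo \<open>J\<close> to some \<open>k\<close> in the kernel
  ideal, and \<open>J\<close> lies in the kernel ideal too.\<close>

lemma proj_eq_imp:
  assumes p: "p \<in> carrier words" "p' \<in> carrier words" and eq: "proj p = proj p'"
  shows "word_functional \<delta> p = word_functional \<delta> p'"
proof -
  have C: "J +>\<^bsub>words\<^esub> p \<in> carrier T" "J +>\<^bsub>words\<^esub> p' \<in> carrier T"
    using p T_simps(3) by blast+
  have diff: "r \<ominus>\<^bsub>words\<^esub> r' = r - r'" if "r' \<in> carrier words" for r r'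
    using that by (simp add: a_minus_def a_inv_free_ring)
  have pp: "p - p' \<in> carrier words" using keys_diff_subset[of p "lists (Units F)" p'] p by simp
  have "(J +>\<^bsub>words\<^esub> p) \<ominus>\<^bsub>T\<^esub> (J +>\<^bsub>words\<^esub> p') \<in> milnor_ideal F"
    using eq ring.quotient_eq_iff_same_a_r_cos[OF ring_T ideal_milnor C] by (simp add: proj_def)
  moreover have "(J +>\<^bsub>words\<^esub> p) \<ominus>\<^bsub>T\<^esub> (J +>\<^bsub>words\<^esub> p') = J +>\<^bsub>words\<^esub> (p \<ominus>\<^bsub>words\<^esub> p')"
  proof -
    interpret h: ring_hom_ring words T "\<lambda>p. J +>\<^bsub>words\<^esub> p" by (rule ring_hom_T)
    show ?thesis
      unfolding a_minus_def using h.hom_add[OF p(1) h.R.a_inv_closed[OF p(2)]] h.hom_a_inv[OF p(2)] by simp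
  qed
  ultimately obtain k where k: "k \<in> kernel_ideal (Units F) \<delta>" "J +>\<^bsub>words\<^esub> (p - p') = J +>\<^bsub>words\<^esub> k"
    using milnor_ideal_subset diff[OF p(2)] by auto
  have kc: "k \<in> carrier words" using k(1) unfolding kernel_ideal_def by blast
  have "(p - p') - k \<in> kernel_ideal (Units F) \<delta>"
    using ring.quotient_eq_iff_same_a_r_cos[OF ring_free_ring ideal_J pp kc] k(2) J_subset diff[OF kc] by auto
  then have "word_functional \<delta> ((p - p') - k) = 0" by (rule kernel_ideal_functional)
  then show ?thesis
    using kernel_ideal_functional[OF k(1)] by (simp add: word_functional_simps)
qed

definition functional :: "('a list \<Rightarrow>\<^sub>0 int) set set \<Rightarrow> rat" where
  "functional Z = word_functional \<delta> (SOME p. p \<in> carrier words \<and> proj p = Z)"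

lemma functional_proj: "p \<in> carrier words \<Longrightarrow> functional (proj p) = word_functional \<delta> p"
proof -
  assume p: "p \<in> carrier words"
  let ?P = "\<lambda>r. r \<in> carrier words \<and> proj r = proj p"
  have "?P (SOME r. ?P r)" by (rule someI[of ?P p]) (use p in simp)
  then show ?thesis unfolding functional_def using proj_eq_imp p by blast
qed

lemma symbol_eq: "as \<in> lists (Units F) \<Longrightarrow> milnor_symbol F as = proj (frag_of as)"
  by (simp add: milnor_symbol_def proj_def pure_tensor_eq)

lemma functional_symbol: "as \<in> lists (Units F) \<Longrightarrow> functional (milnor_symbol F as) = \<delta> as"
  using functional_proj[of "frag_of as"] by (simp add: symbol_eq word_functional_simps)

lemma functional_add:
  assumes "Z \<in> carrier (milnor_ring F)" "Y \<in> carrier (milnor_ring F)"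
  shows "functional (Z \<oplus>\<^bsub>milnor_ring F\<^esub> Y) = functional Z + functional Y"
proof -
  obtain p r where p: "p \<in> carrier words" "Z = proj p" and r: "r \<in> carrier words" "Y = proj r"
    using proj_surj assms by metis
  have "functional (Z \<oplus>\<^bsub>milnor_ring F\<^esub> Y) = functional (proj (p \<oplus>\<^bsub>words\<^esub> r))"
    using p r by (simp only: proj_simps)
  also have "\<dots> = word_functional \<delta> (p \<oplus>\<^bsub>words\<^esub> r)"
    using p(1) r(1) keys_add[of p r] by (intro functional_proj) auto
  also have "\<dots> = functional Z + functional Y"
    using functional_proj[OF p(1)] functional_proj[OF r(1)] p r by (simp add: word_functional_simps)
  finally show ?thesis .
qed

lemma functional_mult_char:
  assumes "Z \<in> carrier (milnor_ring F)" "\<chi> \<in> L"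
  shows "functional (Z \<otimes>\<^bsub>milnor_ring F\<^esub> milnor_symbol F [\<chi>]) = 0"
proof -
  obtain p where p: "p \<in> carrier words" "Z = proj p" using proj_surj assms by metis
  have \<chi>: "frag_of [\<chi>] \<in> carrier words" using assms(2) chars by auto
  have "functional (Z \<otimes>\<^bsub>milnor_ring F\<^esub> milnor_symbol F [\<chi>]) = functional (proj (p \<otimes>\<^bsub>words\<^esub> frag_of [\<chi>]))"
    using symbol_eq[of "[\<chi>]"] assms(2) chars proj_simps(2)[OF p(1) \<chi>] p(2) by auto
  also have "\<dots> = word_functional \<delta> (concat_mult p (frag_of [\<chi>]))"
    using functional_proj[of "concat_mult p (frag_of [\<chi>])"] keys_concat_mult[of p "Units F" "frag_of [\<chi>]"] p(1) \<chi> by simp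
  also have "\<dots> = 0"
  proof -
    have "Poly_Mapping.keys p \<subseteq> lists (Units F)" using p(1) by simp
    then show ?thesis
      by (induction p rule: frag_induction)
         (use word_char assms(2) in \<open>simp_all add: concat_mult_simps word_functional_simps\<close>)
  qed
  finally show ?thesis .
qed

section \<open>The graded pieces and the cokernel\<close>

abbreviation K where "K \<equiv> milnor_K F"

lemma comm_group_K: "comm_group (K m)"
proof -
  interpret M: ring "milnor_ring F" by (rule ring_M)
  show ?thesis
    unfolding milnor_K_def by (rule M.add.abelian_subgroup_generated) (rule M.a_comm_group)
qed

lemma group_K: "group (K m)"
  using comm_group_K comm_group.axioms(2) by blast

lemma K_simps [simp]: "monoid.mult (K m) = ring.add (milnor_ring F)" "monoid.one (K m) = ring.zero (milnor_ring F)"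
  by (simp_all add: milnor_K_def)

lemma K_carrier: "carrier (K m) \<subseteq> carrier (milnor_ring F)"
proof -
  interpret M: ring "milnor_ring F" by (rule ring_M)
  show ?thesis unfolding milnor_K_def using M.add.carrier_subgroup_generated_subset by simp
qed

lemma symbol_in_K:
  assumes "as \<in> lists (Units F)" "length as = m"
  shows "milnor_symbol F as \<in> carrier (K m)"
proof -
  have "milnor_symbol F as \<in> carrier (milnor_ring F)"
    using assms(1) proj_simps(3)[of "frag_of as"] by (simp add: symbol_eq)
  then show ?thesis
    unfolding milnor_K_def carrier_subgroup_generated using assms
    by (intro generate.incl) auto
qed

lemma symbol_mult_char:
  assumes "as \<in> lists (Units F)" "\<chi> \<in> L"
  shows "milnor_symbol F as \<otimes>\<^bsub>milnor_ring F\<^esub> milnor_symbol F [\<chi>] = milnor_symbol F (as @ [\<chi>])"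
proof -
  have \<chi>: "[\<chi>] \<in> lists (Units F)" using assms(2) chars by auto
  have "proj (frag_of as \<otimes>\<^bsub>words\<^esub> frag_of [\<chi>]) = proj (frag_of as) \<otimes>\<^bsub>milnor_ring F\<^esub> proj (frag_of [\<chi>])"
    using assms(1) \<chi> by (intro proj_simps(2)) auto
  then show ?thesis using assms(1) \<chi> by (simp add: symbol_eq concat_mult_simps)
qed

text \<open>The elements whose product with the symbol of \<open>\<chi>\<close> lands in degree
  \<open>Suc m\<close> form a subgroup, and it contains the generating symbols. This places the
  generators of \<open>milnor_mult_image\<close> inside the group whose quotient is taken.\<close>

lemma mult_char_in_K:
  assumes y: "y \<in> carrier (K m)" and \<chi>: "\<chi> \<in> L"
  shows "y \<otimes>\<^bsub>milnor_ring F\<^esub> milnor_symbol F [\<chi>] \<in> carrier (K (Suc m))"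
proof -
  interpret M: ring "milnor_ring F" by (rule ring_M)
  let ?s = "milnor_symbol F [\<chi>]"
  let ?G = "{milnor_symbol F as |as. length as = m \<and> set as \<subseteq> Units F}"
  let ?H = "{y \<in> carrier (milnor_ring F). y \<otimes>\<^bsub>milnor_ring F\<^esub> ?s \<in> carrier (K (Suc m))}"
  have s: "?s \<in> carrier (milnor_ring F)"
    using symbol_in_K[of "[\<chi>]" 1] K_carrier[of 1] \<chi> chars by auto
  have sub: "subgroup (carrier (K (Suc m))) (add_monoid (milnor_ring F))"
    unfolding milnor_K_def by (rule M.add.subgroup_subgroup_generated)
  have "subgroup ?H (add_monoid (milnor_ring F))"
  proof (rule M.add.subgroupI)
    show "?H \<noteq> {}" using s subgroup.one_closed[OF sub] by (auto intro!: exI[of _ "\<zero>\<^bsub>milnor_ring F\<^esub>"])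
    show "\<ominus>\<^bsub>milnor_ring F\<^esub> a \<in> ?H" if "a \<in> ?H" for a
    proof -
      have "\<ominus>\<^bsub>milnor_ring F\<^esub> (a \<otimes>\<^bsub>milnor_ring F\<^esub> ?s) \<in> carrier (K (Suc m))"
        unfolding a_inv_def using that by (intro subgroup.m_inv_closed[OF sub]) simp
      then show ?thesis using that s by (simp add: M.l_minus)
    qed
    show "a \<oplus>\<^bsub>milnor_ring F\<^esub> b \<in> ?H" if "a \<in> ?H" "b \<in> ?H" for a b
      using that s subgroup.m_closed[OF sub] by (simp add: M.l_distr)
  qed auto
  moreover have "?G \<subseteq> ?H"
  proof
    fix y assume "y \<in> ?G"
    then obtain as where as: "y = milnor_symbol F as" "length as = m" "as \<in> lists (Units F)" by blast
    have "y \<in> carrier (milnor_ring F)" using symbol_in_K[OF as(3,2)] K_carrier as(1) by blast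
    then show "y \<in> ?H"
      using symbol_mult_char[OF as(3) \<chi>] symbol_in_K[of "as @ [\<chi>]" "Suc m"] as \<chi> chars by auto
  qed
  ultimately have "generate (add_monoid (milnor_ring F)) (carrier (add_monoid (milnor_ring F)) \<inter> ?G) \<subseteq> ?H"
    by (intro M.add.generate_subgroup_incl) auto
  then show ?thesis using y unfolding milnor_K_def[of F m] carrier_subgroup_generated by blast
qed

abbreviation rat_group :: "rat monoid" where
  "rat_group \<equiv> \<lparr>carrier = UNIV, monoid.mult = (+), monoid.one = 0\<rparr>"

lemma functional_group_hom: "group_hom (K m) rat_group functional"
proof -
  have "group rat_group" by (rule groupI) (auto intro: exI[of _ "- _"])
  moreover have "functional \<in> hom (K m) rat_group"
    using K_carrier by (intro homI) (auto intro!: functional_add)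
  ultimately show ?thesis by (simp add: group_hom_def group_hom_axioms_def group_K)
qed

lemma mult_image_normal: "milnor_mult_image F L n \<lhd> K n"
  and mult_image_kernel: "milnor_mult_image F L n \<subseteq> kernel (K n) rat_group functional"
proof -
  interpret h: group_hom "K n" rat_group functional by (rule functional_group_hom)
  let ?G = "{y \<otimes>\<^bsub>milnor_ring F\<^esub> milnor_symbol F [\<chi>] |y \<chi> m. n = Suc m \<and> y \<in> carrier (milnor_K F m) \<and> \<chi> \<in> L}"
  have "?G \<subseteq> carrier (K n)" using mult_char_in_K by blast
  then have "subgroup (milnor_mult_image F L n) (K n)"
    unfolding milnor_mult_image_def by (rule group.generate_is_subgroup[OF group_K])
  then show "milnor_mult_image F L n \<lhd> K n" by (rule comm_group.subgroup_imp_normal[OF comm_group_K])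
  have "?G \<subseteq> kernel (K n) rat_group functional"
    using mult_char_in_K functional_mult_char[OF subsetD[OF K_carrier]] unfolding kernel_def by auto
  then show "milnor_mult_image F L n \<subseteq> kernel (K n) rat_group functional"
    unfolding milnor_mult_image_def by (rule group.generate_subgroup_incl[OF group_K _ h.subgroup_kernel])
qed

text \<open>\<open>functional\<close> vanishes on products with characters, hence passes to the
  cokernel. Its linear extension to formal rational combinations kills the additivity relations,
  hence passes to the tensor product.\<close>

lemma reduced_functional:
  obtains \<Phi> where
    "\<And>x y. x \<in> carrier (reduced_milnor_K F L n) \<Longrightarrow> y \<in> carrier (reduced_milnor_K F L n) \<Longrightarrow>
       \<Phi> (x \<oplus>\<^bsub>reduced_milnor_K F L n\<^esub> y) = \<Phi> x + \<Phi> y"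
    "\<And>r x. x \<in> carrier (reduced_milnor_K F L n) \<Longrightarrow> \<Phi> (r \<odot>\<^bsub>reduced_milnor_K F L n\<^esub> x) = r * \<Phi> x"
    "\<And>as. as \<in> lists (Units F) \<Longrightarrow> length as = n \<Longrightarrow> \<Phi> (reduced_milnor_symbol F L as) = \<delta> as"
proof -
  interpret h: group_hom "K n" rat_group functional by (rule functional_group_hom)
  let ?N = "milnor_mult_image F L n"
  let ?A = "milnor_coker F L n"
  obtain \<theta> where \<theta>: "\<theta> \<in> hom (K n Mod ?N) rat_group"
    and \<theta>_coset: "\<And>x. x \<in> carrier (K n) \<Longrightarrow> \<theta> (?N #>\<^bsub>K n\<^esub> x) = functional x"
    using h.FactGroup_universal_kernel[OF mult_image_normal mult_image_kernel] by blast
  interpret A: group ?A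
    unfolding milnor_coker_def by (rule normal.factorgroup_is_group[OF mult_image_normal])
  let ?B = "{Poly_Mapping.single (a \<otimes>\<^bsub>?A\<^esub> b) 1 - Poly_Mapping.single a 1 - Poly_Mapping.single b 1 |a b.
        a \<in> carrier ?A \<and> b \<in> carrier ?A} :: (('a list \<Rightarrow>\<^sub>0 int) set set set \<Rightarrow>\<^sub>0 rat) set"
  have B: "?B \<subseteq> carrier (free_module (carrier ?A))"
    by (auto simp: in_keys_iff lookup_minus lookup_single when_def split: if_splits)
  let ?R = "tensor_rat_relations ?A"
  have R: "rat_closed ?R" unfolding tensor_rat_relations_def by (rule rat_closed_rat_span[OF B])
  let ?\<Lambda> = "lin_ext (\<lambda>r. r) \<theta>"
  have add: "?\<Lambda> (x + y) = ?\<Lambda> x + ?\<Lambda> y" for x y by (simp add: lin_ext_add)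
  have scale: "?\<Lambda> (Poly_Mapping.map ((*) r) x) = r * ?\<Lambda> x" for r x
    by (rule lin_ext_scale)
  have "?R \<subseteq> {x. ?\<Lambda> x = 0}"
    unfolding tensor_rat_relations_def
  proof (rule rat_span_minimal[OF B])
    show "rat_closed {x. ?\<Lambda> x = 0}" by (auto simp: rat_closed_def add scale)
    show "?B \<subseteq> {x. ?\<Lambda> x = 0}"
      using \<theta> by (auto simp: lin_ext_diff lin_ext_single milnor_coker_def hom_def)
  qed
  then obtain \<Phi> where \<Phi>: "\<And>x. \<Phi> (?R +>\<^bsub>free_module (carrier ?A)\<^esub> x) = ?\<Lambda> x"
    using quotient_functional[of ?R ?\<Lambda>] R add by blast
  have eq: "reduced_milnor_K F L n = quotient_module (free_module (carrier ?A)) ?R"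
    by (simp add: reduced_milnor_K_def tensor_rat_def)
  show ?thesis
  proof
    show "\<Phi> (x \<oplus>\<^bsub>reduced_milnor_K F L n\<^esub> y) = \<Phi> x + \<Phi> y"
      if "x \<in> carrier (reduced_milnor_K F L n)" "y \<in> carrier (reduced_milnor_K F L n)" for x y
      using that unfolding eq quotient_module_carrier by (auto simp: quotient_module_add[OF R] \<Phi> add)
    show "\<Phi> (r \<odot>\<^bsub>reduced_milnor_K F L n\<^esub> x) = r * \<Phi> x" if "x \<in> carrier (reduced_milnor_K F L n)" for r x
      using that unfolding eq quotient_module_carrier by (auto simp: quotient_module_smult[OF R] \<Phi> scale)
    show "\<Phi> (reduced_milnor_symbol F L as) = \<delta> as" if "as \<in> lists (Units F)" "length as = n" for as
      using that \<theta>_coset[OF symbol_in_K[OF that]]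
      by (simp add: reduced_milnor_symbol_def tensor_one_def \<Phi> lin_ext_single functional_symbol)
  qed
qed

end

section \<open>Valuations at the identity of the torus\<close>

definition lead_key :: "('e::linorder \<Rightarrow>\<^sub>0 'k::zero) \<Rightarrow> 'e" where
  "lead_key p = Max (Poly_Mapping.keys p)"

lemma lookup_lead_key: "p \<noteq> 0 \<Longrightarrow> Poly_Mapping.lookup p (lead_key p) \<noteq> 0"
  unfolding lead_key_def by (metis Max_in finite_keys in_keys_iff keys_eq_empty)

lemma lookup_above_lead_key: "lead_key p < a \<Longrightarrow> Poly_Mapping.lookup p a = 0"
  unfolding lead_key_def by (metis Max_ge finite_keys in_keys_iff leD)

lemma lead_keyI:
  assumes "Poly_Mapping.lookup p a \<noteq> 0" "\<And>b. a < b \<Longrightarrow> Poly_Mapping.lookup p b = 0"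
  shows "lead_key p = a"
  unfolding lead_key_def by (rule Max_eqI) (use assms in \<open>auto simp: in_keys_iff not_less[symmetric]\<close>)

lemma lead_key_uminus: "lead_key (- p) = lead_key (p :: 'e::linorder \<Rightarrow>\<^sub>0 'k::ab_group_add)"
  by (simp add: lead_key_def keys_def)

lemma lead_key_add:
  fixes p q :: "'e::linorder \<Rightarrow>\<^sub>0 'k::ab_group_add"
  assumes "q \<noteq> 0" "lead_key p < lead_key q"
  shows "lead_key (p + q) = lead_key q"
  by (rule lead_keyI) (use assms lookup_lead_key[of q] in
      \<open>auto simp: lookup_add lookup_above_lead_key\<close>)

text \<open>When the leading exponents differ, the larger one survives in the sum.\<close>

lemma lead_key_two_of_three:
  fixes p q :: "'e::linorder \<Rightarrow>\<^sub>0 'k::ab_group_add"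
  assumes "p \<noteq> 0" "q \<noteq> 0"
  shows "lead_key p = lead_key q \<or> lead_key p = lead_key (p + q) \<or> lead_key q = lead_key (p + q)"
  using lead_key_add[of q p] lead_key_add[of p q] assms
  by (metis add.commute linorder_cases)

text \<open>By strict monotonicity of addition the two leading exponents are the only pair of keys
  whose sum reaches \<open>lead_key p + lead_key q\<close>, and without zero divisors the
  coefficient there is nonzero.\<close>

lemma lead_key_mult:
  fixes p q :: "'e::{linorder, ordered_cancel_comm_monoid_add} \<Rightarrow>\<^sub>0 'k::idom"
  assumes "p \<noteq> 0" "q \<noteq> 0"
  shows "lead_key (p * q) = lead_key p + lead_key q"
proof (rule lead_keyI)
  have le: "a \<le> lead_key p" if "Poly_Mapping.lookup p a \<noteq> 0" for a
    using that lookup_above_lead_key[of p a] by force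
  have le': "a \<le> lead_key q" if "Poly_Mapping.lookup q a \<noteq> 0" for a
    using that lookup_above_lead_key[of q a] by force
  have expand: "Poly_Mapping.lookup (p * q) c =
      (\<Sum>a\<in>Poly_Mapping.keys p. \<Sum>b\<in>Poly_Mapping.keys q.
        if a + b = c then Poly_Mapping.lookup p a * Poly_Mapping.lookup q b else 0)" for c
    by (subst poly_mapping_sum_single[of p], subst poly_mapping_sum_single[of q])
       (simp add: sum_product mult_single lookup_sum lookup_single when_def)
  have eq: "a = lead_key p \<and> b = lead_key q"
    if "a \<in> Poly_Mapping.keys p" "b \<in> Poly_Mapping.keys q" "lead_key p + lead_key q \<le> a + b" for a b
  proof -
    have "a \<le> lead_key p" "b \<le> lead_key q" using that le le' by (auto simp: in_keys_iff)
    then show ?thesis using that(3)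
      by (metis add_le_less_mono add_less_le_mono leD order_le_less)
  qed
  have "Poly_Mapping.lookup (p * q) (lead_key p + lead_key q) =
      (\<Sum>a\<in>Poly_Mapping.keys p. \<Sum>b\<in>Poly_Mapping.keys q.
        if a = lead_key p then if b = lead_key q then
          Poly_Mapping.lookup p (lead_key p) * Poly_Mapping.lookup q (lead_key q) else 0 else 0)"
    unfolding expand by (intro sum.cong refl) (use eq in \<open>auto split: if_splits\<close>)
  also have "\<dots> = (\<Sum>a\<in>Poly_Mapping.keys p. if a = lead_key p then
       Poly_Mapping.lookup p (lead_key p) * Poly_Mapping.lookup q (lead_key q) else 0)"
    using lookup_lead_key[OF assms(2)] by (intro sum.cong refl) (auto simp: in_keys_iff)
  also have "\<dots> = Poly_Mapping.lookup p (lead_key p) * Poly_Mapping.lookup q (lead_key q)"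
    using lookup_lead_key[OF assms(1)] by (auto simp: in_keys_iff)
  finally show "Poly_Mapping.lookup (p * q) (lead_key p + lead_key q) \<noteq> 0"
    using lookup_lead_key assms by auto
  fix c assume c: "lead_key p + lead_key q < c"
  show "Poly_Mapping.lookup (p * q) c = 0"
    unfolding expand by (intro sum.neutral ballI) (use eq c in force)
qed

text \<open>If \<open>x^m\<close> stands for \<open>exp (ell m)\<close>, then the \<open>n\<close>-th moment is \<open>n!\<close> times the homogeneous part of
  degree \<open>n\<close> of \<open>p\<close>; this avoids power series and denominators.\<close>

definition moment :: "('m \<Rightarrow> ('e::{linorder, ordered_cancel_comm_monoid_add} \<Rightarrow>\<^sub>0 'k::idom)) \<Rightarrow> nat \<Rightarrow> ('m \<Rightarrow>\<^sub>0 'k) \<Rightarrow> 'e \<Rightarrow>\<^sub>0 'k" where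
  "moment ell n = lin_ext (Poly_Mapping.single 0) (\<lambda>m. ell m ^ n)"

lemma moment_single: "moment ell n (Poly_Mapping.single m c) = Poly_Mapping.single 0 c * ell m ^ n"
  by (simp add: moment_def lin_ext_single)

lemma moment_add: "moment ell n (p + q) = moment ell n p + moment ell n q"
  unfolding moment_def by (rule lin_ext_add) (simp_all add: single_add)

lemma moment_diff: "moment ell n (p - q) = moment ell n p - moment ell n q"
  unfolding moment_def by (rule lin_ext_diff) (simp_all add: single_add)

lemma moment_sum: "moment ell n (\<Sum>i\<in>I. p i) = (\<Sum>i\<in>I. moment ell n (p i))"
  unfolding moment_def by (rule lin_ext_sum) (simp_all add: single_add)

text \<open>The values \<open>ell a\<close> are distinct, so a polynomial \<open>Q\<close> vanishing
  at all but one of them isolates one coefficient of \<open>p\<close>; expanded by the powers of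
  \<open>ell a\<close>, the same sum is a combination of moments. This is the Vandermonde
  argument.\<close>

lemma moment_nonzero:
  fixes ell :: "'m \<Rightarrow> ('e::{linorder, ordered_cancel_comm_monoid_add} \<Rightarrow>\<^sub>0 'k::idom)"
  assumes "inj ell" "p \<noteq> 0"
  shows "\<exists>n. moment ell n p \<noteq> 0"
proof (rule ccontr)
  assume "\<not> ?thesis"
  then have zero: "moment ell n p = 0" for n by blast
  obtain m where m: "m \<in> Poly_Mapping.keys p" using assms(2) by (metis keys_eq_empty ex_in_conv)
  let ?h = "\<lambda>a. Poly_Mapping.single 0 (Poly_Mapping.lookup p a) :: 'e \<Rightarrow>\<^sub>0 'k"
  define Q where "Q = (\<Prod>a\<in>Poly_Mapping.keys p - {m}. [:- ell a, 1:])"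
  have "(\<Sum>a\<in>Poly_Mapping.keys p. ?h a * poly Q (ell a)) =
      (\<Sum>a\<in>Poly_Mapping.keys p. \<Sum>i\<le>Polynomial.degree Q. Polynomial.coeff Q i * (?h a * ell a ^ i))"
    by (simp add: poly_altdef sum_distrib_left mult_ac)
  also have "\<dots> = (\<Sum>i\<le>Polynomial.degree Q. Polynomial.coeff Q i * moment ell i p)"
    by (subst sum.swap) (simp add: moment_def lin_ext_def sum_distrib_left)
  finally have "(\<Sum>a\<in>Poly_Mapping.keys p. ?h a * poly Q (ell a)) = 0"
    by (simp add: zero)
  moreover have "poly Q (ell a) = 0" if "a \<in> Poly_Mapping.keys p - {m}" for a
    using that by (auto simp: Q_def poly_prod intro!: prod_zero)
  ultimately have "?h m * poly Q (ell m) = 0"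
    using m by (simp add: sum.remove[of _ m])
  moreover have "poly Q (ell m) \<noteq> 0"
    using assms(1) by (auto simp: Q_def poly_prod prod_zero_iff inj_eq)
  moreover have "?h m \<noteq> 0" using m by (metis in_keys_iff lookup_single_eq lookup_zero)
  ultimately show False by simp
qed

text \<open>For monomials this is the binomial theorem for \<open>(ell a + ell b) ^ n\<close>; in
  general it is the product rule for exponential generating functions.\<close>

lemma moment_mult:
  fixes ell :: "'m::comm_monoid_add \<Rightarrow> ('e::{linorder, ordered_cancel_comm_monoid_add} \<Rightarrow>\<^sub>0 'k::idom)"
  assumes add: "\<And>m m'. ell (m + m') = ell m + ell m'"
  shows "moment ell n (p * q) = (\<Sum>i\<le>n. of_nat (n choose i) * moment ell i p * moment ell (n - i) q)"
proof -
  have single: "moment ell n (Poly_Mapping.single a c * Poly_Mapping.single b e) =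
      (\<Sum>i\<le>n. of_nat (n choose i) * moment ell i (Poly_Mapping.single a c) *
        moment ell (n - i) (Poly_Mapping.single b e))" for a b c e
  proof -
    have eq: "Poly_Mapping.single 0 (c * e) = Poly_Mapping.single 0 c * (Poly_Mapping.single 0 e :: 'e \<Rightarrow>\<^sub>0 'k)"
      by (simp add: mult_single)
    have "moment ell n (Poly_Mapping.single a c * Poly_Mapping.single b e) =
        Poly_Mapping.single 0 (c * e) * (ell a + ell b) ^ n"
      by (simp only: mult_single moment_single add)
    then show ?thesis
      by (simp only: eq moment_single binomial_ring sum_distrib_left mult_ac)
  qed
  let ?P = "\<lambda>a. Poly_Mapping.single a (Poly_Mapping.lookup p a)"
  let ?Q = "\<lambda>a. Poly_Mapping.single a (Poly_Mapping.lookup q a)"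
  have mp: "moment ell i p = (\<Sum>a\<in>Poly_Mapping.keys p. moment ell i (?P a))" for i
    by (subst poly_mapping_sum_single[of p]) (rule moment_sum)
  have mq: "moment ell i q = (\<Sum>a\<in>Poly_Mapping.keys q. moment ell i (?Q a))" for i
    by (subst poly_mapping_sum_single[of q]) (rule moment_sum)
  have "moment ell n (p * q) =
      (\<Sum>a\<in>Poly_Mapping.keys p. \<Sum>b\<in>Poly_Mapping.keys q. moment ell n (?P a * ?Q b))"
    by (subst poly_mapping_sum_single[of p], subst poly_mapping_sum_single[of q])
       (simp only: sum_product moment_sum)
  also have "\<dots> = (\<Sum>a\<in>Poly_Mapping.keys p. \<Sum>b\<in>Poly_Mapping.keys q. \<Sum>i\<le>n.
      of_nat (n choose i) * moment ell i (?P a) * moment ell (n - i) (?Q b))"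
    by (simp only: single)
  also have "\<dots> = (\<Sum>a\<in>Poly_Mapping.keys p. \<Sum>i\<le>n. \<Sum>b\<in>Poly_Mapping.keys q.
      of_nat (n choose i) * moment ell i (?P a) * moment ell (n - i) (?Q b))"
    by (intro sum.cong refl sum.swap)
  also have "\<dots> = (\<Sum>i\<le>n. \<Sum>a\<in>Poly_Mapping.keys p. \<Sum>b\<in>Poly_Mapping.keys q. 
      of_nat (n choose i) * moment ell i (?P a) * moment ell (n - i) (?Q b))"
    by (rule sum.swap)
  also have "\<dots> = (\<Sum>i\<le>n. of_nat (n choose i) * moment ell i p * moment ell (n - i) q)"
    unfolding mp mq by (simp only: mult.assoc sum_product) (simp only: sum_distrib_left)
  finally show ?thesis .
qed

text \<open>These hypotheses make \<open>x^m \<mapsto> exp (t * ell m)\<close> an injective ring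
  homomorphism into power series in \<open>t\<close>, denominators being allowed. Characteristic 0
  keeps the binomial coefficients nonzero.\<close>

locale exponential_embedding =
  fixes ell :: "'m::comm_monoid_add \<Rightarrow> ('e::{linorder, ordered_cancel_comm_monoid_add} \<Rightarrow>\<^sub>0 'k::{idom, ring_char_0})"
  assumes ell_add: "ell (m + m') = ell m + ell m'"
    and inj_ell: "inj ell"
begin

definition order_at :: "('m \<Rightarrow>\<^sub>0 'k) \<Rightarrow> nat" where
  "order_at p = (LEAST n. moment ell n p \<noteq> 0)"

definition val :: "('m \<Rightarrow>\<^sub>0 'k) \<Rightarrow> 'e" where
  "val p = lead_key (moment ell (order_at p) p)"

lemma moment_order: "p \<noteq> 0 \<Longrightarrow> moment ell (order_at p) p \<noteq> 0"
  unfolding order_at_def by (rule LeastI_ex) (rule moment_nonzero[OF inj_ell])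

lemma moment_below_order: "n < order_at p \<Longrightarrow> moment ell n p = 0"
  unfolding order_at_def using not_less_Least by blast

lemma order_atI: "moment ell n p \<noteq> 0 \<Longrightarrow> (\<And>i. i < n \<Longrightarrow> moment ell i p = 0) \<Longrightarrow> order_at p = n"
  unfolding order_at_def by (rule Least_equality) (auto simp: not_less[symmetric])

text \<open>In the product formula everything below the sum of the orders vanishes, and in that
  degree only the product of the two lowest parts remains, times a binomial coefficient, which is a
  nonzero constant and so has leading exponent 0.\<close>

lemma val_mult:
  assumes "p \<noteq> 0" "q \<noteq> 0"
  shows "val (p * q) = val p + val q"
proof -
  let ?a = "order_at p" and ?b = "order_at q"
  have zero: "moment ell i p * moment ell (n - i) q = 0" if "i \<le> n" "n < ?a + ?b \<or> n = ?a + ?b \<and> i \<noteq> ?a" for i n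
  proof (cases "i < ?a")
    case False
    then have "n - i < ?b" using that by auto
    then show ?thesis by (simp add: moment_below_order)
  qed (simp add: moment_below_order)
  have top: "moment ell (?a + ?b) (p * q) = of_nat ((?a + ?b) choose ?a) * moment ell ?a p * moment ell ?b q"
    (is "_ = ?T")
  proof -
    have "moment ell (?a + ?b) (p * q) = (\<Sum>i\<le>?a + ?b. if i = ?a then ?T else 0)"
      unfolding moment_mult[OF ell_add]
      by (intro sum.cong refl) (use zero in \<open>auto simp: mult.assoc\<close>)
    then show ?thesis by simp
  qed
  have bin: "(of_nat ((?a + ?b) choose ?a) :: 'e \<Rightarrow>\<^sub>0 'k) \<noteq> 0"
    by simp
  have nz: "moment ell ?a p \<noteq> 0" "moment ell ?b q \<noteq> 0" using assms moment_order by auto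
  have "order_at (p * q) = ?a + ?b"
  proof (rule order_atI)
    show "moment ell (?a + ?b) (p * q) \<noteq> 0" unfolding top using bin nz by simp
    show "moment ell n (p * q) = 0" if "n < ?a + ?b" for n
      unfolding moment_mult[OF ell_add]
      by (intro sum.neutral) (use zero that in \<open>auto simp: mult.assoc\<close>)
  qed
  moreover have "lead_key (of_nat ((?a + ?b) choose ?a) :: 'e \<Rightarrow>\<^sub>0 'k) = 0"
    using bin by (intro lead_keyI) (auto simp: lookup_of_nat when_def)
  ultimately show ?thesis
    unfolding val_def using top bin nz by (simp add: lead_key_mult)
qed

text \<open>If the orders differ, the lower one determines the sum. If they agree, either the lowest
  parts cancel, so they are negatives of each other and have the same leading exponent, or they add
  up to the lowest part of the sum and \<open>lead_key_two_of_three\<close> applies.\<close>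

lemma val_two_of_three:
  assumes "p \<noteq> 0" "q \<noteq> 0" "p + q \<noteq> 0"
  shows "val p = val q \<or> val p = val (p + q) \<or> val q = val (p + q)"
proof -
  note below = moment_below_order and at = moment_order
  have sum: "moment ell n (p + q) = moment ell n p + moment ell n q" for n by (rule moment_add)
  have cancel: "moment ell (order_at p) q = - moment ell (order_at p) p" if "order_at p < order_at (p + q)"
    using below[OF that] unfolding sum by (simp add: eq_neg_iff_add_eq_0 add.commute)
  consider "order_at p < order_at q" | "order_at q < order_at p" | "order_at p = order_at q"
    by linarith
  then show ?thesis
  proof cases
    case 1
    have "order_at (p + q) = order_at p"
      by (rule order_atI) (use 1 below at[OF assms(1)] in \<open>auto simp: sum\<close>)
    then show ?thesis using 1 by (simp add: val_def sum below)
  next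
    case 2
    have "order_at (p + q) = order_at q"
      by (rule order_atI) (use 2 below at[OF assms(2)] in \<open>auto simp: sum\<close>)
    then show ?thesis using 2 by (simp add: val_def sum below)
  next
    case 3
    have "order_at p \<le> order_at (p + q)"
      using at[OF assms(3)] below[of "order_at (p + q)"] 3 unfolding sum
      by (metis add.right_neutral not_le)
    then consider "order_at p < order_at (p + q)" | "order_at p = order_at (p + q)" by linarith
    then show ?thesis
    proof cases
      case 1
      then show ?thesis using cancel 3 by (simp add: val_def lead_key_uminus)
    next
      case 2
      then show ?thesis using 3 at assms unfolding val_def sum
        by (metis lead_key_two_of_three)
    qed
  qed
qed

lemma ell_zero: "ell 0 = 0"
  using ell_add[of 0 0] by simp

lemma val_monomial: "val (Poly_Mapping.single m 1) = 0"
proof -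
  have "order_at (Poly_Mapping.single m 1) = 0"
    by (rule order_atI) (simp_all add: moment_single)
  then show ?thesis by (simp add: val_def moment_single lead_key_def)
qed

text \<open>\<open>1 - exp (ell m)\<close> has order 1 and linear part \<open>- ell m\<close>, which
  is nonzero by injectivity of \<open>ell\<close>.\<close>

lemma val_one_minus_monomial:
  assumes "m \<noteq> 0"
  shows "val (1 - Poly_Mapping.single m 1) = lead_key (ell m)"
proof -
  have nz: "ell m \<noteq> 0" using assms inj_ell ell_zero by (metis injD)
  have one: "moment ell n 1 = 0 ^ n" for n
    using moment_single[of ell n 0 1] by (simp add: ell_zero)
  have eq: "moment ell n (1 - Poly_Mapping.single m 1) = 0 ^ n - ell m ^ n" for n
    by (simp add: moment_diff one moment_single)
  have "order_at (1 - Poly_Mapping.single m 1) = 1"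
    by (rule order_atI) (use nz in \<open>auto simp: eq\<close>)
  then show ?thesis by (simp add: val_def eq lead_key_uminus)
qed

end

section \<open>Determinants by rows, and logarithmic coordinates\<close>

lemma det_zero_row:
  assumes "(A :: 'a::comm_ring_1 mat) \<in> carrier_mat n n" "k < n" "\<And>j. j < n \<Longrightarrow> A $$ (k, j) = 0"
  shows "det A = 0"
  using assms(3) by (subst laplace_expansion_row[OF assms(1,2)]) (simp add: sum.neutral)

lemma det_row_additive:
  fixes A A' A'' :: "'a::comm_ring_1 mat"
  assumes A: "A \<in> carrier_mat n n" "A' \<in> carrier_mat n n" "A'' \<in> carrier_mat n n" and k: "k < n"
    and row: "\<And>j. j < n \<Longrightarrow> A $$ (k, j) = A' $$ (k, j) + A'' $$ (k, j)"
    and other: "\<And>i j. i < n \<Longrightarrow> i \<noteq> k \<Longrightarrow> j < n \<Longrightarrow> A' $$ (i, j) = A $$ (i, j) \<and> A'' $$ (i, j) = A $$ (i, j)"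
  shows "det A = det A' + det A''"
proof -
  have "mat_delete A' k j = mat_delete A k j" "mat_delete A'' k j = mat_delete A k j" if "j < n" for j
    using A other that k by (auto simp: mat_delete_def intro!: eq_matI)
  then have "cofactor A' k j = cofactor A k j" "cofactor A'' k j = cofactor A k j" if "j < n" for j
    using that by (simp_all add: cofactor_def)
  then show ?thesis
    using row by (simp add: laplace_expansion_row[OF _ k] A distrib_right sum.distrib)
qed

text \<open>The logarithm of the torus coordinate \<open>j\<close>, read off from column
  \<open>j\<close> of \<open>B\<close>. Entries of \<open>B\<close> below the diagonal are zero, so
  stopping at \<open>j\<close> loses nothing and keeps the sum finite.\<close>

definition coordinate_form :: "(nat \<Rightarrow> nat \<Rightarrow> rat) \<Rightarrow> nat \<Rightarrow> (nat \<Rightarrow>\<^sub>0 nat) \<Rightarrow>\<^sub>0 rat alg_closure" where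
  "coordinate_form B j = (\<Sum>i\<le>j. Poly_Mapping.single (Poly_Mapping.single i 1) (of_rat (B i j)))"

text \<open>The logarithm of the monomial \<open>x^m\<close> in local coordinates at the identity of the torus, chosen
  adapted to the flag \<open>B\<close>.\<close>

definition log_form :: "(nat \<Rightarrow> nat \<Rightarrow> rat) \<Rightarrow> (nat \<Rightarrow>\<^sub>0 int) \<Rightarrow> (nat \<Rightarrow>\<^sub>0 nat) \<Rightarrow>\<^sub>0 rat alg_closure" where
  "log_form B = lin_ext of_int (coordinate_form B)"

lemma log_form_expand:
  "log_form B m = (\<Sum>j\<in>Poly_Mapping.keys m. \<Sum>i\<le>j.
     Poly_Mapping.single (Poly_Mapping.single i 1) (of_rat (of_int (Poly_Mapping.lookup m j) * B i j)))"
proof -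
  have scale: "of_int k * Poly_Mapping.single e (of_rat r) =
      (Poly_Mapping.single e (of_rat (of_int k * r)) :: (nat \<Rightarrow>\<^sub>0 nat) \<Rightarrow>\<^sub>0 rat alg_closure)" for k r e
    unfolding single_of_int[symmetric] mult_single by (simp add: of_rat_mult)
  show ?thesis
    by (simp only: log_form_def lin_ext_def coordinate_form_def sum_distrib_left scale)
qed

lemma single_one_eq_iff: "Poly_Mapping.single i (Suc 0) = Poly_Mapping.single i' (Suc 0) \<longleftrightarrow> i = i'"
  by (auto dest: arg_cong[of _ _ "\<lambda>p. Poly_Mapping.lookup p i"] simp: lookup_single when_def split: if_splits)

text \<open>Upper triangularity makes up for the truncated sums. For an exponent vector the result
  is the number whose nonvanishing \<open>pivot\<close> tests.\<close>

lemma lookup_log_form: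
  assumes "upper_unitriangular B"
  shows "Poly_Mapping.lookup (log_form B m) (Poly_Mapping.single i 1) =
    of_rat (\<Sum>j\<in>Poly_Mapping.keys m. of_int (Poly_Mapping.lookup m j) * B i j)"
proof -
  have "Poly_Mapping.lookup (log_form B m) (Poly_Mapping.single i 1) = (\<Sum>j\<in>Poly_Mapping.keys m. \<Sum>i'\<le>j.
     if i' = i then of_rat (of_int (Poly_Mapping.lookup m j) * B i j) else 0)"
    unfolding log_form_expand lookup_sum
    by (intro sum.cong refl) (auto simp: lookup_single when_def single_one_eq_iff)
  also have "\<dots> = (\<Sum>j\<in>Poly_Mapping.keys m. of_rat (of_int (Poly_Mapping.lookup m j) * B i j))"
    using assms by (intro sum.cong refl) (auto simp: upper_unitriangular_def)
  finally show ?thesis by (simp add: of_rat_sum)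
qed

lemma lookup_log_form_other:
  assumes "\<And>i. k \<noteq> Poly_Mapping.single i 1"
  shows "Poly_Mapping.lookup (log_form B m) k = 0"
  unfolding log_form_expand lookup_sum
  by (intro sum.neutral ballI) (simp add: lookup_single when_def assms[symmetric] del: One_nat_def)

lemma log_form_add: "log_form B (m + m') = log_form B m + log_form B m'"
  unfolding log_form_def by (rule lin_ext_add) simp_all

lemma log_form_diff: "log_form B (m - m') = log_form B m - log_form B m'"
  unfolding log_form_def by (rule lin_ext_diff) simp_all

text \<open>In a nonzero exponent the last variable \<open>?J\<close> alone contributes to local
  coordinate \<open>?J\<close>, with diagonal entry 1, and characteristic 0 keeps its integral
  coefficient nonzero.\<close>

lemma inj_log_form:
  assumes B: "upper_unitriangular B"
  shows "inj (log_form B)"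
proof (rule injI, rule ccontr)
  fix m m' assume eq: "log_form B m = log_form B m'" and "m \<noteq> m'"
  define x where "x = m - m'"
  have x: "x \<noteq> 0" "log_form B x = 0" using \<open>m \<noteq> m'\<close> eq by (simp_all add: x_def log_form_diff)
  let ?J = "Max (Poly_Mapping.keys x)"
  have J: "?J \<in> Poly_Mapping.keys x" using x(1) by (intro Max_in) auto
  have "B ?J j = 0" if "j \<in> Poly_Mapping.keys x" "j \<noteq> ?J" for j
  proof -
    have "j \<le> ?J" using that(1) by (intro Max_ge) auto
    then have "j < ?J" using that(2) by (rule le_neq_implies_less)
    then show ?thesis using B by (simp add: upper_unitriangular_def)
  qed
  then have "(\<Sum>j\<in>Poly_Mapping.keys x. of_int (Poly_Mapping.lookup x j) * B ?J j) =
      (\<Sum>j\<in>Poly_Mapping.keys x. if j = ?J then of_int (Poly_Mapping.lookup x ?J) else 0)"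
    using B by (intro sum.cong refl) (auto simp: upper_unitriangular_def)
  also have "\<dots> = of_int (Poly_Mapping.lookup x ?J)" using J by simp
  finally have "(of_rat (of_int (Poly_Mapping.lookup x ?J)) :: rat alg_closure) = 0"
    using lookup_log_form[OF B, of x ?J] x(2) by simp
  then show False using J by (simp add: in_keys_iff)
qed

definition exponent :: "int vec \<Rightarrow> nat \<Rightarrow>\<^sub>0 int" where
  "exponent v = (\<Sum>i<dim_vec v. Poly_Mapping.single i (v $ i))"

lemma lookup_exponent: "Poly_Mapping.lookup (exponent v) j = (if j < dim_vec v then v $ j else 0)"
  by (auto simp: exponent_def lookup_sum lookup_single when_def)

lemma keys_exponent: "Poly_Mapping.keys (exponent v) \<subseteq> {..<dim_vec v}"
  by (auto simp: in_keys_iff lookup_exponent split: if_splits)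

lemma exponent_nonzero: "v \<in> carrier_vec d \<Longrightarrow> v \<noteq> 0\<^sub>v d \<Longrightarrow> exponent v \<noteq> 0"
  by (auto simp: vec_eq_iff poly_mapping_eq_iff fun_eq_iff lookup_exponent)

text \<open>Exponents are compared at the first index where they differ, so earlier coordinates are
  the larger ones. This orientation makes the leading exponent of a linear form its first coordinate
  with nonzero coefficient, matching the \<open>LEAST\<close> in \<open>pivot\<close>.\<close>

lemma single_less_single: "i < i' \<Longrightarrow> Poly_Mapping.single i' (1::nat) < Poly_Mapping.single i 1" for i :: nat
  unfolding less_poly_mapping.rep_eq less_fun_def
  by (intro exI[of _ i]) (auto simp: lookup_single when_def)

lemma lead_key_log_form:
  assumes B: "upper_unitriangular B" and v: "v \<in> carrier_vec d" "v \<noteq> 0\<^sub>v d"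
  shows "lead_key (log_form B (exponent v)) = Poly_Mapping.single (pivot B (map_vec rat_of_int v)) 1"
proof -
  let ?v = "map_vec rat_of_int v"
  have v': "?v \<in> carrier_vec d" "?v \<noteq> 0\<^sub>v d" using v by auto
  have coeff: "Poly_Mapping.lookup (log_form B (exponent v)) (Poly_Mapping.single i 1) = of_rat (\<Sum>j<d. B i j * ?v $ j)" for i
  proof -
    have "(\<Sum>j\<in>Poly_Mapping.keys (exponent v). of_int (Poly_Mapping.lookup (exponent v) j) * B i j) =
        (\<Sum>j<d. of_int (Poly_Mapping.lookup (exponent v) j) * B i j)"
      using keys_exponent[of v] v(1) by (intro sum.mono_neutral_left) (auto simp: in_keys_iff)
    also have "\<dots> = (\<Sum>j<d. B i j * ?v $ j)"
      using v(1) by (intro sum.cong refl) (auto simp: lookup_exponent)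
    finally show ?thesis by (simp only: lookup_log_form[OF B])
  qed
  show ?thesis
  proof (rule lead_keyI)
    show "Poly_Mapping.lookup (log_form B (exponent v)) (Poly_Mapping.single (pivot B ?v) 1) \<noteq> 0"
      unfolding coeff using pivot_nonzero[OF B v'] by simp
    fix k :: "nat \<Rightarrow>\<^sub>0 nat" assume k: "Poly_Mapping.single (pivot B ?v) 1 < k"
    show "Poly_Mapping.lookup (log_form B (exponent v)) k = 0"
    proof (cases "\<exists>i. k = Poly_Mapping.single i 1")
      case True
      then obtain i where i: "k = Poly_Mapping.single i 1" by blast
      then have "i < pivot B ?v"
        using k single_less_single[of "pivot B ?v" i] by (metis linorder_neqE_nat order_less_asym order_less_irrefl)
      then show ?thesis using coeff before_pivot[OF B v'] i by simp
    next
      case False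
      then show ?thesis using lookup_log_form_other by metis
    qed
  qed
qed

section \<open>The valuation on the function field and its determinant\<close>

locale flag_valuation =
  fixes B :: "nat \<Rightarrow> nat \<Rightarrow> rat"
  assumes B: "upper_unitriangular B"
begin

sublocale exponential_embedding "log_form B"
  by unfold_locales (rule log_form_add, rule inj_log_form[OF B])

text \<open>Exponents of polynomials are natural numbers, so a fraction takes their difference in
  the integers. \<open>0\<close> is no quotient of nonzero polynomials, and its value is left
  unspecified.\<close>

definition field_val :: "laurent_poly fract \<Rightarrow> nat \<Rightarrow> int" where
  "field_val z = (SOME f. \<exists>p q. p \<noteq> 0 \<and> q \<noteq> 0 \<and> z = Fract p q \<and>
     f = (\<lambda>i. int (Poly_Mapping.lookup (val p) i) - int (Poly_Mapping.lookup (val q) i)))"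

text \<open>Cross multiplication turns equality of fractions into equality of products, on which
  \<open>val\<close> is additive.\<close>

lemma field_val_Fract:
  assumes "p \<noteq> 0" "q \<noteq> 0"
  shows "field_val (Fract p q) = (\<lambda>i. int (Poly_Mapping.lookup (val p) i) - int (Poly_Mapping.lookup (val q) i))"
proof -
  let ?P = "\<lambda>f. \<exists>p' q'. p' \<noteq> 0 \<and> q' \<noteq> 0 \<and> Fract p q = Fract p' q' \<and>
     f = (\<lambda>i. int (Poly_Mapping.lookup (val p') i) - int (Poly_Mapping.lookup (val q') i))"
  have "\<exists>f. ?P f" using assms by blast
  then have "?P (SOME f. ?P f)" by (rule someI_ex)
  then obtain p' q' where pq: "p' \<noteq> 0" "q' \<noteq> 0" "Fract p q = Fract p' q'"
    and eq: "field_val (Fract p q) = (\<lambda>i. int (Poly_Mapping.lookup (val p') i) - int (Poly_Mapping.lookup (val q') i))"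
    unfolding field_val_def by blast
  have "p * q' = p' * q" using pq assms by (simp add: eq_fract)
  then have "val p + val q' = val p' + val q" using val_mult assms pq by metis
  then have sum: "Poly_Mapping.lookup (val p) i + Poly_Mapping.lookup (val q') i =
      Poly_Mapping.lookup (val p') i + Poly_Mapping.lookup (val q) i" for i
    by (simp flip: lookup_add)
  show ?thesis
    unfolding eq
  proof
    show "int (Poly_Mapping.lookup (val p') i) - int (Poly_Mapping.lookup (val q') i) =
        int (Poly_Mapping.lookup (val p) i) - int (Poly_Mapping.lookup (val q) i)" for i
      using sum[of i] by linarith
  qed
qed

lemma field_val_mult:
  assumes "x \<noteq> 0" "y \<noteq> 0"
  shows "field_val (x * y) i = field_val x i + field_val y i"
proof -
  obtain p q where x: "x = Fract p q" "q \<noteq> 0" by (cases x) auto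
  obtain r s where y: "y = Fract r s" "s \<noteq> 0" by (cases y) auto
  have "p \<noteq> 0" "r \<noteq> 0" using assms x y by (auto simp: Zero_fract_def eq_fract)
  then show ?thesis using x y by (simp add: field_val_Fract val_mult lookup_add)
qed

text \<open>With \<open>x = p / q\<close> this is \<open>val_two_of_three\<close> for
  \<open>p + (q - p) = q\<close>, after subtracting \<open>val q\<close>.\<close>

lemma field_val_steinberg:
  assumes "x \<noteq> 0" "1 - x \<noteq> 0"
  shows "field_val x = (\<lambda>_. 0) \<or> field_val (1 - x) = (\<lambda>_. 0) \<or> field_val x = field_val (1 - x)"
proof -
  obtain p q where x: "x = Fract p q" "q \<noteq> 0" by (cases x) auto
  have p: "p \<noteq> 0" using assms(1) x by (auto simp: Zero_fract_def eq_fract)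
  have x': "1 - x = Fract (q - p) q" using x by (simp add: One_fract_def)
  then have "q - p \<noteq> 0" using assms(2) x(2) by (auto simp: Zero_fract_def eq_fract)
  from val_two_of_three[OF p this] show ?thesis
    using x x' p \<open>q - p \<noteq> 0\<close> by (auto simp: field_val_Fract)
qed

text \<open>Words of any other length get 0, so that this is a functional on the entire word ring
  and not just on one degree.\<close>

definition val_det :: "nat \<Rightarrow> laurent_poly fract list \<Rightarrow> rat" where
  "val_det d as = (if length as = d then det (mat d d (\<lambda>(i, j). of_int (field_val (as ! i) j))) else 0)"

lemma val_det_mult:
  assumes "a \<noteq> 0" "b \<noteq> 0"
  shows "val_det d (u @ [a * b] @ v) = val_det d (u @ [a] @ v) + val_det d (u @ [b] @ v)"
proof (cases "d = length u + Suc (length v)")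
  case True
  have "det (mat d d (\<lambda>(i, j). of_int (field_val ((u @ [a * b] @ v) ! i) j)) :: rat mat) =
      det (mat d d (\<lambda>(i, j). of_int (field_val ((u @ [a] @ v) ! i) j))) +
      det (mat d d (\<lambda>(i, j). of_int (field_val ((u @ [b] @ v) ! i) j)))"
    by (rule det_row_additive[of _ d _ _ "length u"])
       (use True assms in \<open>auto simp: field_val_mult nth_append nth_Cons'\<close>)
  then show ?thesis using True by (simp add: val_det_def)
qed (simp add: val_det_def)

lemma val_det_zero_entry:
  assumes "a \<in> set as" "field_val a = (\<lambda>_. 0)"
  shows "val_det d as = 0"
proof (cases "length as = d")
  case True
  then obtain k where "k < d" "as ! k = a" using assms(1) by (auto simp: in_set_conv_nth)
  then show ?thesis
    unfolding val_det_def using True assms(2) by (auto intro!: det_zero_row[of _ d k])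
qed (simp add: val_det_def)

text \<open>Each alternative of \<open>field_val_steinberg\<close> makes one row zero or two
  adjacent rows equal.\<close>

lemma val_det_steinberg:
  assumes "a \<noteq> 0" "1 - a \<noteq> 0"
  shows "val_det d (u @ [a, 1 - a] @ v) = 0"
proof (cases "d = length u + Suc (Suc (length v))")
  case True
  from field_val_steinberg[OF assms] consider "field_val a = (\<lambda>_. 0)" | "field_val (1 - a) = (\<lambda>_. 0)"
    | "field_val a = field_val (1 - a)" by blast
  then show ?thesis
  proof cases
    case 1
    then show ?thesis by (intro val_det_zero_entry[of a]) auto
  next
    case 2
    then show ?thesis by (intro val_det_zero_entry[of "1 - a"]) auto
  next
    case 3
    have "det (mat d d (\<lambda>(i, j). of_int (field_val ((u @ [a, 1 - a] @ v) ! i) j)) :: rat mat) = 0"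
      by (rule det_identical_rows[of _ d "length u" "Suc (length u)"])
         (use True 3 in \<open>auto simp: nth_append intro!: eq_vecI\<close>)
    then show ?thesis using True by (simp add: val_det_def)
  qed
qed (simp add: val_det_def)

end

section \<open>The function field of the torus\<close>

lemma monomial_powi:
  "Fract (Poly_Mapping.single (Poly_Mapping.single i 1) 1) 1 powi n =
   Fract (Poly_Mapping.single (Poly_Mapping.single i n) 1) (1 :: laurent_poly)"
proof -
  define M where "M n = Fract (Poly_Mapping.single (Poly_Mapping.single i n) 1) (1 :: laurent_poly)" for n
  have mult: "M n * M n' = M (n + n')" for n n' by (simp add: M_def mult_single single_add)
  have one: "M 0 = 1" by (simp add: M_def One_fract_def)
  have pow: "M 1 ^ k = M (int k)" for k
    by (induction k) (simp_all add: one mult)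
  have "M 1 powi n = M n"
  proof (cases "n \<ge> 0")
    case True
    then show ?thesis using pow[of "nat n"] by (simp add: power_int_def)
  next
    case False
    have "inverse (M (- n)) = M n"
      by (rule inverse_unique) (simp add: mult one)
    then show ?thesis using False pow[of "nat (- n)"] by (simp add: power_int_def power_inverse)
  qed
  then show ?thesis by (simp only: M_def)
qed

lemma torus_char_eq: "torus_char v = Fract (Poly_Mapping.single (exponent v) 1) 1"
proof -
  have "(\<Prod>i\<in>I. Fract (Poly_Mapping.single (f i) 1) (1 :: laurent_poly)) = Fract (Poly_Mapping.single (\<Sum>i\<in>I. f i) 1) 1"
    if "finite I" for I and f :: "nat \<Rightarrow> nat \<Rightarrow>\<^sub>0 int"
    using that by induction (simp_all add: One_fract_def mult_single)
  then show ?thesis by (simp add: torus_char_def torus_coord_def monomial_powi exponent_def)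
qed

lemma torus_ring_closed:
  "0 \<in> torus_ring d" "1 \<in> torus_ring d"
  "p \<in> torus_ring d \<Longrightarrow> q \<in> torus_ring d \<Longrightarrow> p + q \<in> torus_ring d"
  "p \<in> torus_ring d \<Longrightarrow> q \<in> torus_ring d \<Longrightarrow> p - q \<in> torus_ring d"
  "p \<in> torus_ring d \<Longrightarrow> q \<in> torus_ring d \<Longrightarrow> p * q \<in> torus_ring d"
  "p \<in> torus_ring d \<Longrightarrow> - p \<in> torus_ring d"
proof -
  show "0 \<in> torus_ring d" "1 \<in> torus_ring d" by (auto simp: torus_ring_def)
  show "p \<in> torus_ring d \<Longrightarrow> q \<in> torus_ring d \<Longrightarrow> p + q \<in> torus_ring d"
    using keys_add[of p q] by (auto simp: torus_ring_def)
  show "p \<in> torus_ring d \<Longrightarrow> - p \<in> torus_ring d"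
    by (auto simp: torus_ring_def in_keys_iff)
  show "p \<in> torus_ring d \<Longrightarrow> q \<in> torus_ring d \<Longrightarrow> p - q \<in> torus_ring d"
    by (auto simp: torus_ring_def in_keys_iff lookup_minus subset_iff)
  show "p * q \<in> torus_ring d" if "p \<in> torus_ring d" "q \<in> torus_ring d"
    unfolding torus_ring_def
  proof (intro CollectI ballI)
    fix m assume "m \<in> Poly_Mapping.keys (p * q)"
    then obtain a b where "m = a + b" "a \<in> Poly_Mapping.keys p" "b \<in> Poly_Mapping.keys q"
      using keys_mult[of p q] by blast
    then show "Poly_Mapping.keys m \<subseteq> {..<d}"
      using keys_add[of a b] that unfolding torus_ring_def by blast
  qed
qed

lemma torus_field_simps [simp]:
  "x \<otimes>\<^bsub>torus_field d\<^esub> y = x * y" "x \<oplus>\<^bsub>torus_field d\<^esub> y = x + y"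
  "\<one>\<^bsub>torus_field d\<^esub> = 1" "\<zero>\<^bsub>torus_field d\<^esub> = 0"
  "carrier (torus_field d) = {Fract p q |p q. p \<in> torus_ring d \<and> q \<in> torus_ring d \<and> q \<noteq> 0}"
  by (simp_all add: torus_field_def)

lemma Fract_in_torus_field:
  "p \<in> torus_ring d \<Longrightarrow> q \<in> torus_ring d \<Longrightarrow> q \<noteq> 0 \<Longrightarrow> Fract p q \<in> carrier (torus_field d)"
  by auto

lemma torus_fieldE:
  assumes "x \<in> carrier (torus_field d)"
  obtains p q where "x = Fract p q" "q \<noteq> 0" "p \<in> torus_ring d" "q \<in> torus_ring d"
  using assms by auto

lemma torus_field_uminus: "x \<in> carrier (torus_field d) \<Longrightarrow> - x \<in> carrier (torus_field d)"
proof -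
  assume "x \<in> carrier (torus_field d)"
  then obtain p q where "x = Fract p q" "q \<noteq> 0" "p \<in> torus_ring d" "q \<in> torus_ring d" by (rule torus_fieldE)
  then show ?thesis
    using Fract_in_torus_field[of "- p" d q] by (simp add: torus_ring_closed del: torus_field_simps(5))
qed

lemma ring_torus_field: "ring (torus_field d)"
proof (rule ringI)
  show "abelian_group (torus_field d)"
  proof (rule abelian_groupI)
    show "x \<oplus>\<^bsub>torus_field d\<^esub> y \<in> carrier (torus_field d)"
      if x: "x \<in> carrier (torus_field d)" and y: "y \<in> carrier (torus_field d)" for x y
    proof -
      obtain p q where "x = Fract p q" "q \<noteq> 0" "p \<in> torus_ring d" "q \<in> torus_ring d"
        using x by (rule torus_fieldE)
      moreover obtain r s where "y = Fract r s" "s \<noteq> 0" "r \<in> torus_ring d" "s \<in> torus_ring d"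
        using y by (rule torus_fieldE)
      ultimately show ?thesis
        using Fract_in_torus_field[of "p * s + r * q" d "q * s"] by (simp add: torus_ring_closed del: torus_field_simps(5))
    qed
    show "\<exists>y\<in>carrier (torus_field d). y \<oplus>\<^bsub>torus_field d\<^esub> x = \<zero>\<^bsub>torus_field d\<^esub>"
      if "x \<in> carrier (torus_field d)" for x
      using torus_field_uminus[OF that] by (intro bexI[of _ "- x"]) simp_all
    show "\<zero>\<^bsub>torus_field d\<^esub> \<in> carrier (torus_field d)"
      using Fract_in_torus_field[of 0 d 1] by (simp add: torus_ring_closed Zero_fract_def del: torus_field_simps(5))
  qed (simp_all add: ac_simps)
  show "Group.monoid (torus_field d)"
  proof (rule monoidI)
    show "x \<otimes>\<^bsub>torus_field d\<^esub> y \<in> carrier (torus_field d)"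
      if x: "x \<in> carrier (torus_field d)" and y: "y \<in> carrier (torus_field d)" for x y
    proof -
      obtain p q where "x = Fract p q" "q \<noteq> 0" "p \<in> torus_ring d" "q \<in> torus_ring d"
        using x by (rule torus_fieldE)
      moreover obtain r s where "y = Fract r s" "s \<noteq> 0" "r \<in> torus_ring d" "s \<in> torus_ring d"
        using y by (rule torus_fieldE)
      ultimately show ?thesis
        using Fract_in_torus_field[of "p * r" d "q * s"] by (simp add: torus_ring_closed del: torus_field_simps(5))
    qed
    show "\<one>\<^bsub>torus_field d\<^esub> \<in> carrier (torus_field d)"
      using Fract_in_torus_field[of 1 d 1] by (simp add: torus_ring_closed One_fract_def del: torus_field_simps(5))
  qed (simp_all add: ac_simps)
qed (simp_all add: algebra_simps)

lemma torus_field_minus: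
  assumes "x \<in> carrier (torus_field d)" "y \<in> carrier (torus_field d)"
  shows "x \<ominus>\<^bsub>torus_field d\<^esub> y = x - y"
proof -
  interpret ring "torus_field d" by (rule ring_torus_field)
  have "\<ominus>\<^bsub>torus_field d\<^esub> y = - y"
    using assms torus_field_uminus by (intro minus_equality) (simp_all del: torus_field_simps(5))
  then show ?thesis by (simp add: a_minus_def)
qed

lemma Units_torus_field: "x \<in> Units (torus_field d) \<longleftrightarrow> x \<in> carrier (torus_field d) \<and> x \<noteq> 0"
proof
  assume "x \<in> Units (torus_field d)"
  then show "x \<in> carrier (torus_field d) \<and> x \<noteq> 0" unfolding Units_def by auto
next
  assume x: "x \<in> carrier (torus_field d) \<and> x \<noteq> 0"
  then obtain p q where pq: "x = Fract p q" "q \<noteq> 0" "p \<in> torus_ring d" "q \<in> torus_ring d" by auto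
  have p: "p \<noteq> 0" using x pq by (auto simp: Zero_fract_def eq_fract)
  have "Fract q p \<in> carrier (torus_field d)" using Fract_in_torus_field p pq by blast
  moreover have "Fract q p * x = 1" using p pq by (simp add: One_fract_def eq_fract)
  ultimately show "x \<in> Units (torus_field d)"
    using x unfolding Units_def mem_Collect_eq torus_field_simps(1,3)
    by (intro conjI bexI[of _ "Fract q p"]) (simp_all only: mult.commute[of x])
qed

lemma torus_char_carrier: "v \<in> carrier_vec d \<Longrightarrow> torus_char v \<in> carrier (torus_field d)"
  unfolding torus_char_eq using keys_exponent[of v]
  by (intro Fract_in_torus_field torus_ring_closed(2) one_neq_zero) (auto simp: torus_ring_def)

lemma Fract_nonzero: "p \<noteq> 0 \<Longrightarrow> q \<noteq> 0 \<Longrightarrow> Fract p q \<noteq> 0"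
  by (simp add: Zero_fract_def eq_fract)

lemma monomial_nonzero: "Poly_Mapping.single m 1 \<noteq> (0 :: laurent_poly)"
proof
  assume "Poly_Mapping.single m 1 = (0 :: laurent_poly)"
  then have "Poly_Mapping.lookup (Poly_Mapping.single m (1 :: rat alg_closure)) m = 0" by (simp only: lookup_zero)
  then show False by simp
qed

lemma torus_char_nonzero: "torus_char v \<noteq> 0"
  unfolding torus_char_eq by (rule Fract_nonzero[OF monomial_nonzero one_neq_zero])

lemma one_minus_torus_char: "1 - torus_char v = Fract (1 - Poly_Mapping.single (exponent v) 1) 1"
  by (simp add: torus_char_eq One_fract_def)

lemma one_minus_monomial_nonzero:
  assumes "m \<noteq> 0"
  shows "1 - Poly_Mapping.single m 1 \<noteq> (0 :: laurent_poly)"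
proof
  assume "1 - Poly_Mapping.single m 1 = (0 :: laurent_poly)"
  then have "Poly_Mapping.lookup (1 - Poly_Mapping.single m (1 :: rat alg_closure)) 0 = 0" by (simp only: lookup_zero)
  then show False using assms by (simp add: lookup_minus lookup_one lookup_single when_def)
qed

lemma one_minus_torus_char_unit:
  assumes "v \<in> carrier_vec d" "v \<noteq> 0\<^sub>v d"
  shows "1 - torus_char v \<in> Units (torus_field d)"
proof -
  have "Poly_Mapping.single (exponent v) 1 \<in> torus_ring d"
    using assms(1) keys_exponent[of v] by (auto simp: torus_ring_def)
  then have "1 - Poly_Mapping.single (exponent v) 1 \<in> torus_ring d"
    by (intro torus_ring_closed(2,4))
  then have "Fract (1 - Poly_Mapping.single (exponent v) 1) 1 \<in> carrier (torus_field d)"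
    by (rule Fract_in_torus_field) (simp_all only: torus_ring_closed(2) one_neq_zero not_False_eq_True)
  moreover have "Fract (1 - Poly_Mapping.single (exponent v) 1) (1 :: laurent_poly) \<noteq> 0"
    by (rule Fract_nonzero) (rule one_minus_monomial_nonzero[OF exponent_nonzero[OF assms]], rule one_neq_zero)
  ultimately show ?thesis unfolding Units_torus_field one_minus_torus_char by blast
qed

section \<open>Values of characters and the functional on symbols\<close>

context flag_valuation
begin

lemma field_val_torus_char: "field_val (torus_char v) = (\<lambda>_. 0)"
proof -
  have "val 1 = 0" using val_monomial[of 0] by simp
  then show ?thesis by (simp add: torus_char_eq field_val_Fract monomial_nonzero val_monomial)
qed

lemma field_val_one_minus_torus_char:
  assumes "v \<in> carrier_vec d" "v \<noteq> 0\<^sub>v d"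
  shows "field_val (1 - torus_char v) j = of_bool (j = pivot B (map_vec rat_of_int v))"
proof -
  have one: "val 1 = 0" using val_monomial[of 0] by simp
  note m = exponent_nonzero[OF assms]
  have "field_val (1 - torus_char v) j = int (Poly_Mapping.lookup (val (1 - Poly_Mapping.single (exponent v) 1)) j)"
    unfolding one_minus_torus_char
    by (subst field_val_Fract[OF one_minus_monomial_nonzero[OF m] one_neq_zero]) (simp add: one)
  then show ?thesis
    unfolding val_one_minus_monomial[OF m] lead_key_log_form[OF B assms]
    by (simp add: lookup_single when_def)
qed

text \<open>Row \<open>i\<close> of either matrix is the unit vector at the pivot of
  \<open>vs ! i\<close>. Here the Milnor side meets the Steinberg side.\<close>

lemma val_det_integral:
  assumes "length vs = d" "\<And>v. v \<in> set vs \<Longrightarrow> v \<in> carrier_vec d \<and> v \<noteq> 0\<^sub>v d"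
  shows "val_det d (map (\<lambda>v. 1 - torus_char v) vs) = pivot_det B (map (map_vec rat_of_int) vs)"
proof -
  have "field_val (1 - torus_char (vs ! i)) j = of_bool (j = pivot B (map_vec rat_of_int (vs ! i)))" if "i < d" for i j
    using that assms nth_mem[of i vs] by (intro field_val_one_minus_torus_char[of _ d]) auto
  then show ?thesis
    unfolding val_det_def pivot_det_def using assms(1)
    by (auto intro!: arg_cong[of _ _ det] eq_matI)
qed

lemma milnor_functional_val_det: "milnor_functional (torus_field d) (character_lattice d) (val_det d)"
proof (intro milnor_functional.intro milnor_functional_axioms.intro ring_torus_field)
  show "character_lattice d \<subseteq> Units (torus_field d)"
    using torus_char_carrier torus_char_nonzero by (auto simp: character_lattice_def Units_torus_field simp del: torus_field_simps(5))
  fix u v :: "laurent_poly fract list" and a b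
  show "val_det d (u @ [a \<otimes>\<^bsub>torus_field d\<^esub> b] @ v) = val_det d (u @ [a] @ v) + val_det d (u @ [b] @ v)"
    if "a \<in> Units (torus_field d)" "b \<in> Units (torus_field d)"
    using that val_det_mult by (simp add: Units_torus_field)
  show "val_det d (u @ [a, \<one>\<^bsub>torus_field d\<^esub> \<ominus>\<^bsub>torus_field d\<^esub> a] @ v) = 0"
    if "a \<in> Units (torus_field d)" "\<one>\<^bsub>torus_field d\<^esub> \<ominus>\<^bsub>torus_field d\<^esub> a \<in> Units (torus_field d)"
  proof -
    interpret ring "torus_field d" by (rule ring_torus_field)
    have "\<one>\<^bsub>torus_field d\<^esub> \<ominus>\<^bsub>torus_field d\<^esub> a = 1 - a"
      using that(1) torus_field_minus[OF one_closed, of a] by (simp add: Units_torus_field)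
    then show ?thesis using that val_det_steinberg[of a] by (simp add: Units_torus_field)
  qed
  show "val_det d (u @ [a]) = 0" if "a \<in> character_lattice d"
    using that field_val_torus_char by (intro val_det_zero_entry[of a]) (auto simp: character_lattice_def)
qed

lemma torus_functional:
  "\<exists>\<Phi>. (\<forall>x\<in>carrier (torus_K d d). \<forall>y\<in>carrier (torus_K d d). \<Phi> (x \<oplus>\<^bsub>torus_K d d\<^esub> y) = \<Phi> x + \<Phi> y) \<and>
     (\<forall>r. \<forall>x\<in>carrier (torus_K d d). \<Phi> (r \<odot>\<^bsub>torus_K d d\<^esub> x) = r * \<Phi> x) \<and>
     (\<forall>as\<in>lists (Units (torus_field d)). length as = d \<longrightarrow> \<Phi> (torus_symbol d as) = val_det d as)"
proof (rule milnor_functional.reduced_functional[OF milnor_functional_val_det[of d], where n = d])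
  fix \<Phi>
  assume "\<And>x y. x \<in> carrier (torus_K d d) \<Longrightarrow> y \<in> carrier (torus_K d d) \<Longrightarrow> \<Phi> (x \<oplus>\<^bsub>torus_K d d\<^esub> y) = \<Phi> x + \<Phi> y"
    "\<And>r x. x \<in> carrier (torus_K d d) \<Longrightarrow> \<Phi> (r \<odot>\<^bsub>torus_K d d\<^esub> x) = r * \<Phi> x"
    "\<And>as. as \<in> lists (Units (torus_field d)) \<Longrightarrow> length as = d \<Longrightarrow> \<Phi> (torus_symbol d as) = val_det d as"
  then show ?thesis by (intro exI[of _ \<Phi>] conjI ballI allI impI)
qed

end

section \<open>Injectivity\<close>

lemma integral_frame_nonzero:
  assumes "integral_frame d vs" "v \<in> set vs"
  shows "v \<in> carrier_vec d" "v \<noteq> 0\<^sub>v d"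
proof -
  have vs: "length vs = d" "set vs \<subseteq> carrier_vec d" "det (mat_of_cols d vs) \<noteq> 0"
    using assms(1) by (auto simp: integral_frame_def)
  show v: "v \<in> carrier_vec d" using vs assms(2) by blast
  obtain k where k: "k < d" "vs ! k = v" using assms(2) vs(1) by (auto simp: in_set_conv_nth)
  show "v \<noteq> 0\<^sub>v d"
  proof
    assume "v = 0\<^sub>v d"
    then have "det (mat_of_cols d vs) = 0"
      using k vs(1) by (subst laplace_expansion_column[of _ d k]) (auto simp: mat_of_cols_def)
    then show False using vs(3) by simp
  qed
qed

theorem proposition47:
  fixes d :: nat
    and K :: "(rat vec list \<Rightarrow>\<^sub>0 rat) set \<Rightarrow>
              ((laurent_poly fract list \<Rightarrow>\<^sub>0 int) set set set \<Rightarrow>\<^sub>0 rat) set"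
  assumes K_linear:
      "K \<in> LinearCombinations.module_hom (class_ring :: rat ring) (steinberg_module d) (torus_K d d)"
    and K_integral:
      "\<And>vs. integral_frame d vs \<Longrightarrow>
         K (integral_apartment d vs) = torus_symbol d (map (\<lambda>v. 1 - torus_char v) vs)"
  shows "inj_on K (carrier (steinberg_module d))"
proof (rule inj_onI)
  let ?R = "steinberg_relations d" and ?S = "nonzero_tuples d d"
  let ?C = "\<lambda>x. ?R +>\<^bsub>free_module ?S\<^esub> x"
  note R = rat_closed_steinberg[of d]
  have carr: "carrier (steinberg_module d) = ?C ` {f. Poly_Mapping.keys f \<subseteq> ?S}"
    by (simp add: steinberg_module_def quotient_module_carrier)
  fix Z W assume "Z \<in> carrier (steinberg_module d)" "W \<in> carrier (steinberg_module d)" and KXY: "K Z = K W"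
  then obtain x y where x: "Z = ?C x" "Poly_Mapping.keys x \<subseteq> ?S" and y: "W = ?C y" "Poly_Mapping.keys y \<subseteq> ?S"
    unfolding carr by blast
  have C_carr: "?C z \<in> carrier (steinberg_module d)" if "Poly_Mapping.keys z \<subseteq> ?S" for z
    using that carr by blast
  have "x - y \<in> ?R"
  proof (rule in_steinberg_relations_if_flag_functionals_zero)
    show "Poly_Mapping.keys (x - y) \<subseteq> ?S"
      using rat_closedD(4)[OF rat_closed_carrier[of ?S], of x y] x y by simp
    fix B assume B: "upper_unitriangular B"
    interpret flag_valuation B by unfold_locales (rule B)
    from torus_functional[of d] obtain \<Phi> where
      \<Phi>_add: "\<And>x y. x \<in> carrier (torus_K d d) \<Longrightarrow> y \<in> carrier (torus_K d d) \<Longrightarrow>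
         \<Phi> (x \<oplus>\<^bsub>torus_K d d\<^esub> y) = \<Phi> x + \<Phi> y"
      and \<Phi>_scale: "\<And>r x. x \<in> carrier (torus_K d d) \<Longrightarrow> \<Phi> (r \<odot>\<^bsub>torus_K d d\<^esub> x) = r * \<Phi> x"
      and \<Phi>_symbol: "\<And>as. as \<in> lists (Units (torus_field d)) \<Longrightarrow> length as = d \<Longrightarrow>
         \<Phi> (torus_symbol d as) = val_det d as"
      by metis
    have K_carr: "K (?C z) \<in> carrier (torus_K d d)" if "Poly_Mapping.keys z \<subseteq> ?S" for z
      using LinearCombinations.module_hom_closed[OF K_linear] C_carr[OF that] by blast
    \<comment> \<open>\<open>K\<close> followed by the functional, pulled back to formal
      combinations of tuples, where it can be compared with
      \<open>flag_functional B\<close>.\<close>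
    define g where "g z = \<Phi> (K (?C z))" for z
    have g_add: "g (z + z') = g z + g z'" if "Poly_Mapping.keys z \<subseteq> ?S" "Poly_Mapping.keys z' \<subseteq> ?S" for z z'
    proof -
      have "?C (z + z') = ?C z \<oplus>\<^bsub>steinberg_module d\<^esub> ?C z'"
        unfolding steinberg_module_def by (rule quotient_module_add[OF R, symmetric])
      then show ?thesis
        using LinearCombinations.module_hom_add[OF K_linear C_carr[OF that(1)] C_carr[OF that(2)]] \<Phi>_add K_carr that
        by (simp add: g_def)
    qed
    have g_scale: "g (Poly_Mapping.map ((*) r) z) = r * g z" if "Poly_Mapping.keys z \<subseteq> ?S" for r z
    proof -
      have "?C (Poly_Mapping.map ((*) r) z) = r \<odot>\<^bsub>steinberg_module d\<^esub> ?C z"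
        unfolding steinberg_module_def by (rule quotient_module_smult[OF R, symmetric])
      then show ?thesis
        using LinearCombinations.module_hom_smult[OF K_linear _ C_carr[OF that], of r] \<Phi>_scale K_carr that
        by (simp add: g_def)
    qed
    have g_zero: "g 0 = 0" using g_add[of 0 0] by simp
    \<comment> \<open>The locus of agreement is closed under rational combinations and contains the
      relations, on which both functionals vanish; with the integral tuples in it,
      \<open>tuple_in_integral_span\<close> yields every tuple.\<close>
    let ?V = "{z. Poly_Mapping.keys z \<subseteq> ?S \<and> g z = flag_functional B z}"
    have V: "rat_closed ?V"
      unfolding rat_closed_def
    proof (intro conjI ballI allI)
      show "0 \<in> ?V" by (simp add: g_zero flag_functional_simps)
      show "z + z' \<in> ?V" if "z \<in> ?V" "z' \<in> ?V" for z z'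
        using that g_add[of z z'] keys_add[of z z'] by (auto simp: flag_functional_simps)
      show "Poly_Mapping.map ((*) r) z \<in> ?V" if "z \<in> ?V" for r z
        using that g_scale[of z r] keys_scale[of r z] by (auto simp: flag_functional_def lin_ext_scale)
    qed
    have RV: "?R \<subseteq> ?V"
    proof
      fix z assume z: "z \<in> ?R"
      then have "?C z = ?C 0" using a_r_coset_free_module_eq_iff[OF R, of ?S z 0] by simp
      then have "g z = 0" using g_zero by (simp add: g_def)
      then show "z \<in> ?V"
        using z steinberg_relations_carrier[of d] flag_functional_steinberg[OF B z] by auto
    qed
    have "Poly_Mapping.single (map (map_vec rat_of_int) vs) 1 \<in> ?V" if vs: "integral_frame d vs" for vs
    proof -
      note nz = integral_frame_nonzero[OF vs]
      have len: "length vs = d" using vs by (simp add: integral_frame_def)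
      have "map (\<lambda>v. 1 - torus_char v) vs \<in> lists (Units (torus_field d))"
        using one_minus_torus_char_unit nz by auto
      then have "g (Poly_Mapping.single (map (map_vec rat_of_int) vs) 1) = val_det d (map (\<lambda>v. 1 - torus_char v) vs)"
        using K_integral[OF vs] \<Phi>_symbol len by (simp add: g_def integral_apartment_def apartment_def)
      also have "\<dots> = pivot_det B (map (map_vec rat_of_int) vs)"
        using len nz by (intro val_det_integral) auto
      finally show ?thesis
        using nz len by (auto simp: flag_functional_simps nonzero_tuples_def)
    qed
    then have single: "Poly_Mapping.single vs 1 \<in> ?V" if "vs \<in> ?S" for vs
      using tuple_in_integral_span[OF V RV] that by blast
    have "x \<in> ?V" "y \<in> ?V"
      using rat_closed_singles[OF V single] x(2) y(2) by blast+
    moreover have "g x = g y" using KXY x(1) y(1) by (simp add: g_def)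
    ultimately show "flag_functional B (x - y) = 0" by (simp add: flag_functional_simps)
  qed
  then show "Z = W" using x(1) y(1) a_r_coset_free_module_eq_iff[OF R, of ?S x y] by simp
qed

end
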